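(* For $0<\alpha,\beta\le\frac12$, with $\rho=1-2\beta$, \[ \Lambda_\rho(\alpha)\le\Gamma_{\mathrm{odd,S}}(\alpha,\beta)=\Gamma_{\mathrm{odd,B}}(\alpha,\beta)\le\alpha^{\frac{1}{1-\beta}}, \] \[ \tfrac12\Lambda_\rho(2\alpha)\le\underline\Gamma_{\mathrm{even,S}}(\alpha,\beta)\le\overline\Gamma_{\mathrm{even,S}}(\alpha,\beta)\le2\alpha^{\frac1{1-\beta}}, \] \[ \Lambda_\rho(\alpha)\le\underline\Gamma_{\mathrm{even,B}}(\alpha,\beta)\le\overline\Gamma_{\mathrm{even,B}}(\alpha,\beta)\le2(1-\beta)\alpha^{\frac1{1-\beta}}. \] Moreover, if $k=\log_2\frac1\alpha$ is a positive integer, then $\Gamma_{\mathrm{odd,S}}(\alpha,\beta)\ge(\frac{1-\beta}{2})^k$, $\underline\Gamma_{\mathrm{even,B}}(\alpha,\beta)\ge(\frac{1-\beta}2)^k$, and $\underline\Gamma_{\mathrm{even,S}}(\alpha,\beta)\ge\frac12(\frac{1-\beta}2)^{k-1}$.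
   Context: $\Lambda_\rho(\alpha)=\mathbb P[Z_1>t,Z_2>t]$ where $Z_1,Z_2$ are jointly Gaussian standard normals with $\mathbb E[Z_1Z_2]=\rho$ and $t\in\mathbb R$ satisfies $\mathbb P[Z_1>t]=\alpha$. $d_{\mathrm H}$ is Hamming distance on $\{-1,1\}^n$, $\mathbf 1=(1,\dots,1)$, $S_r=\{\mathbf{x}:d_{\mathrm H}(\mathbf{x},\mathbf 1)=r\}$, $B_r=\{\mathbf{x}:d_{\mathrm H}(\mathbf{x},\mathbf 1)\le r\}$. Let $\mathbf X\sim\mathrm{Unif}\{-1,1\}^n$, $\mathbf Z$ independent of $\mathbf X$, $\mathbf Y=\mathbf X\circ\mathbf Z$ (coordinatewise product). For $f:\{-1,1\}^n\to\mathbb R$: $\mathbf{SStab}_r[f]=\mathbb E[f(\mathbf X)f(\mathbf Y)]$ with $\mathbf Z\sim\mathrm{Unif}(S_r)$; $\mathbf{BStab}_r[f]$ the same with $\mathbf Z\sim\mathrm{Unif}(B_r)$. For $M\in[1:2^n]$ let $\Gamma^{(n)}_{\mathrm S}(M,r)$, $\Gamma^{(n)}_{\mathrm B}(M,r)$ be the maxima of $\mathbf{SStab}_r[f]$, $\mathbf{BStab}_r[f]$ over $f:\{-1,1\}^n\to\{0,1\}$ with $\mathbb P[f(\mathbf X)=1]=M/2^n$. Define $\Gamma_{\mathrm{odd,S}}(\alpha,\beta)=\lim_{n}\Gamma^{(n)}_{\mathrm S}(\lfloor\alpha2^n\rfloor,2\lfloor\beta n/2\rfloor+1)$, $\overline\Gamma_{\mathrm{even,S}}(\alpha,\beta)=\limsup_n\Gamma^{(n)}_{\mathrm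 S}(\lfloor\alpha2^n\rfloor,2\lfloor\beta n/2\rfloor)$, $\underline\Gamma_{\mathrm{even,S}}$ the corresponding $\liminf$, and $\Gamma_{\mathrm{odd,B}},\overline\Gamma_{\mathrm{even,B}},\underline\Gamma_{\mathrm{even,B}}$ analogously with $\Gamma^{(n)}_{\mathrm B}$. *)

theory Defs
  imports "HOL-Probability.Probability"
begin

section \<open>Gaussian quadrant probabilities\<close>

text \<open>
  The joint law of standard normals \<open>Z\<^sub>1, Z\<^sub>2\<close> that are jointly Gaussian with correlation
  \<open>\<rho> \<in> [-1, 1]\<close>, realised as the image of a pair \<open>(U, V)\<close> of independent standard normals
  under the linear map \<open>(U, \<rho> U + sqrt (1 - \<rho>\<^sup>2) V)\<close>.
\<close>

definition std_normal_pair :: "real \<Rightarrow> (real \<times> real) measure" where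
  "std_normal_pair \<rho> =
     distr (std_normal_distribution \<Otimes>\<^sub>M std_normal_distribution) (borel \<Otimes>\<^sub>M borel)
       (\<lambda>(u, v). (u, \<rho> * u + sqrt (1 - \<rho>\<^sup>2) * v))"

text \<open>
  This is the characteristic function of the Gaussian law with mean \<open>0\<close>, unit variances and
  covariance \<open>\<rho>\<close>, so the construction above yields the intended law.
\<close>

lemma char_std_normal_pair:
  assumes "\<bar>\<rho>\<bar> \<le> 1"
  shows "(CLINT (z1, z2) | std_normal_pair \<rho>. iexp (a * z1 + b * z2)) =
           exp (- complex_of_real ((a\<^sup>2 + 2 * \<rho> * a * b + b\<^sup>2) / 2))"
proof -
  interpret N: real_distribution std_normal_distribution by (rule real_dist_normal_dist)
  interpret P: pair_prob_space std_normal_distribution std_normal_distribution ..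
  define c where "c = a + b * \<rho>"
  define d where "d = b * sqrt (1 - \<rho>\<^sup>2)"
  have sq: "\<rho>\<^sup>2 \<le> 1" using assms by (simp add: abs_square_le_1)
  have cd: "c\<^sup>2 + d\<^sup>2 = a\<^sup>2 + 2 * \<rho> * a * b + b\<^sup>2"
    using sq
    by (simp add: c_def d_def power2_sum power_mult_distrib)
       (simp add: algebra_simps power2_eq_square)
  have meas: "(\<lambda>(u, v). (u, \<rho> * u + sqrt (1 - \<rho>\<^sup>2) * v)) \<in>
      (std_normal_distribution \<Otimes>\<^sub>M std_normal_distribution) \<rightarrow>\<^sub>M (borel \<Otimes>\<^sub>M borel)"
    by measurable
  have bm: "(\<lambda>x. case x of (u, v) \<Rightarrow> iexp (c * u) * iexp (d * v)) \<in>
     borel_measurable (std_normal_distribution \<Otimes>\<^sub>M std_normal_distribution)"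
    by measurable
  have int: "integrable (std_normal_distribution \<Otimes>\<^sub>M std_normal_distribution) (\<lambda>(u, v). iexp (c * u) * iexp (d * v))"
    by (rule P.P.integrable_const_bound[where B = 1]) (use bm in \<open>auto simp: norm_mult\<close>)
  have "(CLINT (z1, z2) | std_normal_pair \<rho>. iexp (a * z1 + b * z2)) =
        (CLINT (u, v) | std_normal_distribution \<Otimes>\<^sub>M std_normal_distribution. iexp (c * u) * iexp (d * v))"
    unfolding std_normal_pair_def
    by (subst integral_distr[OF meas])
       (auto simp: c_def d_def case_prod_beta exp_add[symmetric] algebra_simps intro!: Bochner_Integration.integral_cong)
  also have "\<dots> = (CLINT u | std_normal_distribution. CLINT v | std_normal_distribution. iexp (c * u) * iexp (d * v))"
    using P.integral_fst'[OF int] by simp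
  also have "\<dots> = char std_normal_distribution c * char std_normal_distribution d"
    by (simp add: char_def)
  also have "\<dots> = exp (- complex_of_real ((c\<^sup>2 + d\<^sup>2) / 2))"
    by (simp add: char_std_normal_distribution exp_of_real[symmetric] exp_add[symmetric] add_divide_distrib)
  finally show ?thesis by (simp only: cd)
qed

text \<open>
  The threshold is extended-real, so that it also exists for \<open>a = 1\<close>, where it is \<open>-\<infinity>\<close>.
  It is unique for every \<open>a \<in> [0, 1]\<close>, and a real number for \<open>a \<in> (0, 1)\<close>.
\<close>

definition normal_threshold :: "real \<Rightarrow> ereal" where
  "normal_threshold a = (THE t. measure std_normal_distribution {z. t < ereal z} = a)"

definition Lambda :: "real \<Rightarrow> real \<Rightarrow> real" where
  "Lambda \<rho> a = measure (std_normal_pair \<rho>)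
     {(z1, z2). normal_threshold a < ereal z1 \<and> normal_threshold a < ereal z2}"


section \<open>The discrete cube\<close>

definition cube :: "nat \<Rightarrow> (nat \<Rightarrow> int) set" where
  "cube n = {..<n} \<rightarrow>\<^sub>E {-1, 1}"

definition ones :: "nat \<Rightarrow> nat \<Rightarrow> int" where
  "ones n = (\<lambda>i\<in>{..<n}. 1)"

definition hamming :: "nat \<Rightarrow> (nat \<Rightarrow> int) \<Rightarrow> (nat \<Rightarrow> int) \<Rightarrow> nat" where
  "hamming n x y = card {i \<in> {..<n}. x i \<noteq> y i}"

definition cube_sphere :: "nat \<Rightarrow> nat \<Rightarrow> (nat \<Rightarrow> int) set" where
  "cube_sphere n r = {x \<in> cube n. hamming n x (ones n) = r}"

definition cube_ball :: "nat \<Rightarrow> nat \<Rightarrow> (nat \<Rightarrow> int) set" where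
  "cube_ball n r = {x \<in> cube n. hamming n x (ones n) \<le> r}"

definition cube_mult :: "nat \<Rightarrow> (nat \<Rightarrow> int) \<Rightarrow> (nat \<Rightarrow> int) \<Rightarrow> nat \<Rightarrow> int" where
  "cube_mult n x z = (\<lambda>i\<in>{..<n}. x i * z i)"


section \<open>Sphere and ball noise stability\<close>

definition noise_stab :: "nat \<Rightarrow> (nat \<Rightarrow> int) pmf \<Rightarrow> ((nat \<Rightarrow> int) \<Rightarrow> real) \<Rightarrow> real" where
  "noise_stab n Z f =
     measure_pmf.expectation (pair_pmf (pmf_of_set (cube n)) Z)
       (\<lambda>(x, z). f x * f (cube_mult n x z))"

text \<open>
  The radius must satisfy \<open>r \<le> n\<close> in \<open>SStab n r\<close>; otherwise the sphere is empty and
  the uniform distribution on it is unspecified.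
\<close>

definition SStab :: "nat \<Rightarrow> nat \<Rightarrow> ((nat \<Rightarrow> int) \<Rightarrow> real) \<Rightarrow> real" where
  "SStab n r f = noise_stab n (pmf_of_set (cube_sphere n r)) f"

definition BStab :: "nat \<Rightarrow> nat \<Rightarrow> ((nat \<Rightarrow> int) \<Rightarrow> real) \<Rightarrow> real" where
  "BStab n r f = noise_stab n (pmf_of_set (cube_ball n r)) f"

definition boolean_funs :: "nat \<Rightarrow> nat \<Rightarrow> ((nat \<Rightarrow> int) \<Rightarrow> real) set" where
  "boolean_funs n M =
     {f \<in> cube n \<rightarrow>\<^sub>E {0, 1}.
        measure_pmf.prob (pmf_of_set (cube n)) {x. f x = 1} = real M / 2 ^ n}"

definition Gamma_S :: "nat \<Rightarrow> nat \<Rightarrow> nat \<Rightarrow> real" where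
  "Gamma_S n M r = Max (SStab n r ` boolean_funs n M)"

definition Gamma_B :: "nat \<Rightarrow> nat \<Rightarrow> nat \<Rightarrow> real" where
  "Gamma_B n M r = Max (BStab n r ` boolean_funs n M)"


section \<open>Asymptotic quantities\<close>

definition vol_seq :: "real \<Rightarrow> nat \<Rightarrow> nat" where
  "vol_seq \<alpha> n = nat \<lfloor>\<alpha> * 2 ^ n\<rfloor>"

definition odd_radius :: "real \<Rightarrow> nat \<Rightarrow> nat" where
  "odd_radius \<beta> n = 2 * nat \<lfloor>\<beta> * real n / 2\<rfloor> + 1"

definition even_radius :: "real \<Rightarrow> nat \<Rightarrow> nat" where
  "even_radius \<beta> n = 2 * nat \<lfloor>\<beta> * real n / 2\<rfloor>"

definition odd_S_seq :: "real \<Rightarrow> real \<Rightarrow> nat \<Rightarrow> real" where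
  "odd_S_seq \<alpha> \<beta> n = Gamma_S n (vol_seq \<alpha> n) (odd_radius \<beta> n)"

definition odd_B_seq :: "real \<Rightarrow> real \<Rightarrow> nat \<Rightarrow> real" where
  "odd_B_seq \<alpha> \<beta> n = Gamma_B n (vol_seq \<alpha> n) (odd_radius \<beta> n)"

definition even_S_seq :: "real \<Rightarrow> real \<Rightarrow> nat \<Rightarrow> real" where
  "even_S_seq \<alpha> \<beta> n = Gamma_S n (vol_seq \<alpha> n) (even_radius \<beta> n)"

definition even_B_seq :: "real \<Rightarrow> real \<Rightarrow> nat \<Rightarrow> real" where
  "even_B_seq \<alpha> \<beta> n = Gamma_B n (vol_seq \<alpha> n) (even_radius \<beta> n)"

text \<open>
  \<open>lim\<close> is meaningful only for convergent sequences; convergence of \<open>odd_S_seq\<close> and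
  \<open>odd_B_seq\<close> has to be claimed separately.
\<close>

definition Gamma_odd_S :: "real \<Rightarrow> real \<Rightarrow> real" where
  "Gamma_odd_S \<alpha> \<beta> = lim (odd_S_seq \<alpha> \<beta>)"

definition Gamma_odd_B :: "real \<Rightarrow> real \<Rightarrow> real" where
  "Gamma_odd_B \<alpha> \<beta> = lim (odd_B_seq \<alpha> \<beta>)"

definition Gamma_even_S_sup :: "real \<Rightarrow> real \<Rightarrow> ereal" where
  "Gamma_even_S_sup \<alpha> \<beta> = limsup (\<lambda>n. ereal (even_S_seq \<alpha> \<beta> n))"

definition Gamma_even_S_inf :: "real \<Rightarrow> real \<Rightarrow> ereal" where
  "Gamma_even_S_inf \<alpha> \<beta> = liminf (\<lambda>n. ereal (even_S_seq \<alpha> \<beta> n))"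

definition Gamma_even_B_sup :: "real \<Rightarrow> real \<Rightarrow> ereal" where
  "Gamma_even_B_sup \<alpha> \<beta> = limsup (\<lambda>n. ereal (even_B_seq \<alpha> \<beta> n))"

definition Gamma_even_B_inf :: "real \<Rightarrow> real \<Rightarrow> ereal" where
  "Gamma_even_B_inf \<alpha> \<beta> = liminf (\<lambda>n. ereal (even_B_seq \<alpha> \<beta> n))"

end

theory Submission
  imports Defs
begin

text \<open>
  Identify \<open>x \<in> {-1,1}\<^sup>n\<close> with the set \<open>X\<close> of its negative coordinates. The eigenvalue of the
  sphere noise of radius \<open>j \<approx> \<beta> n\<close> on the character \<open>chi S\<close> is \<open>\<rho> ^ |S| + o(1)\<close> uniformly in
  \<open>|S| \<le> n / 2\<close>: for bounded \<open>|S|\<close> this is the convergence of finite marginals to Bernoulli noise,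
  and for large \<open>|S|\<close> a pairing of \<open>S\<close> with its complement makes both sides small. Complementing
  \<open>S\<close> multiplies the eigenvalue by \<open>(-1) ^ j\<close>, so the high frequencies contribute
  \<open>\<tau> \<rho> ^ (n - |S|)\<close> with \<open>\<tau>\<close> the mean of \<open>(-1) ^ j\<close>, which is \<open>\<plusminus>1\<close> for spheres and asymptotically
  \<open>\<plusminus>\<rho>\<close> for balls. Hence the stability is at most \<open>1 + max 0 \<tau>\<close> times the stability under
  independent noise, which hypercontractivity bounds by \<open>\<alpha> powr (1 / (1 - \<beta>))\<close>.

  Conversely, a set that depends on a fixed number of coordinates does not distinguish the noises in the
  limit, so the supremum \<open>iid_sup \<beta> \<alpha>\<close> of the stabilities under independent noise is a lower bound; for
  spheres of even radius, intersecting such a set with the even vectors halves its measure and its stability.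
  Subcubes and Hamming balls, the latter through a bivariate central limit theorem, bound \<open>iid_sup\<close> below.
\<close>

section \<open>Fourier analysis of noise stability\<close>

text \<open>The eigenvalue estimate has to hold for all \<open>2 ^ n\<close> characters at once,
  because an arbitrary set may carry Fourier weight at every level; the error then meets only the
  total weight, which Parseval bounds by 1. The high frequencies cannot be made small: on the full
  set a sphere eigenvalue has modulus 1. They are absorbed instead. Multiplication by the character
  of the full set moves the coefficient at \<open>S\<close> to its complement, so their contribution
  is again a stability under independent noise, of a signed function, and a nonnegative kernel can
  only gain when the signs are removed. This produces the factor 1 + \<tau>. The exponent comes from
  the bilinear hypercontractive inequality with \<open>p = 2 * (1 - \<beta>)\<close>, which is 1 +
  \<rho>: each of the two norms of an indicator contributes \<open>1 / p\<close>. For odd radii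
  \<tau> is asymptotically at most 0, so the upper and lower bounds meet at
  \<open>iid_sup \<beta> \<alpha>\<close>. The limits therefore exist and agree for spheres and
  balls although their common value is not computed.\<close>

definition chi :: "'a set \<Rightarrow> 'a set \<Rightarrow> real" where
  "chi S X = (\<Prod>i\<in>S. if i \<in> X then - 1 else 1)"

text \<open>Two functions are kept, although the theorem needs only \<open>f = g\<close>: splitting
  off a coordinate produces mixed terms between the two restrictions of a function, so the induction
  for hypercontractivity has to be bilinear.\<close>

definition stab :: "'a set \<Rightarrow> ('a set \<Rightarrow> real) \<Rightarrow> ('a set \<Rightarrow> real) \<Rightarrow> ('a set \<Rightarrow> real) \<Rightarrow> real" where
  "stab U k f g = (\<Sum>X\<in>Pow U. \<Sum>J\<in>Pow U. k J * f X * g (sym_diff X J)) / 2 ^ card U"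

definition bern :: "real \<Rightarrow> 'a set \<Rightarrow> 'a set \<Rightarrow> real" where
  "bern \<beta> U J = \<beta> ^ card J * (1 - \<beta>) ^ card (U - J)"

definition fourier :: "'a set \<Rightarrow> ('a set \<Rightarrow> real) \<Rightarrow> 'a set \<Rightarrow> real" where
  "fourier U f S = (\<Sum>X\<in>Pow U. f X * chi S X) / 2 ^ card U"

lemma sum_Pow_insert:
  assumes "finite U" "u \<notin> U"
  shows "(\<Sum>X\<in>Pow (insert u U). h X) = (\<Sum>X\<in>Pow U. h X + h (insert u X))"
proof -
  have "inj_on (insert u) (Pow U)"
    using assms(2) by (auto simp: inj_on_def)
  moreover have "Pow U \<inter> insert u ` Pow U = {}"
    using assms(2) by auto
  ultimately show ?thesis
    using assms(1)
    by (simp add: Pow_insert sum.union_disjoint sum.reindex sum.distrib)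
qed

lemma sum_Pow_Un:
  assumes "finite V" "finite W" "V \<inter> W = {}"
  shows "(\<Sum>X\<in>Pow (V \<union> W). h X) = (\<Sum>X\<in>Pow V. \<Sum>Y\<in>Pow W. h (X \<union> Y))"
proof -
  have "(\<Sum>X\<in>Pow (V \<union> W). h X) = (\<Sum>(X, Y)\<in>Pow V \<times> Pow W. h (X \<union> Y))"
    using assms(3)
    by (intro sum.reindex_bij_witness[where i = "\<lambda>(X, Y). X \<union> Y" and j = "\<lambda>X. (X \<inter> V, X \<inter> W)"])
       (auto simp: Int_Un_distrib[symmetric] Int_absorb2)
  then show ?thesis by (simp add: sum.cartesian_product)
qed

lemma chi_sym_diff: "chi S (sym_diff X Y) = chi S X * chi S Y"
  unfolding chi_def prod.distrib[symmetric] by (intro prod.cong) auto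

lemma chi_insert: "finite S \<Longrightarrow> u \<notin> S \<Longrightarrow> chi (insert u S) X = (if u \<in> X then - 1 else 1) * chi S X"
  by (simp add: chi_def)

lemma chi_square: "chi S X * chi S X = 1"
  unfolding chi_def prod.distrib[symmetric] by (intro prod.neutral) auto

lemma abs_chi: "\<bar>chi S X\<bar> = 1"
  by (simp add: chi_def abs_prod cong: if_cong) (intro prod.neutral, auto)

lemma chi_superset:
  assumes "finite U" "X \<subseteq> U"
  shows "chi U X = (- 1) ^ card X"
proof -
  have "chi U X = (\<Prod>i\<in>X. - 1)"
    unfolding chi_def using assms by (intro prod.mono_neutral_cong_right) auto
  then show ?thesis by simp
qed

lemma chi_Diff:
  assumes "finite U" "S \<subseteq> U"
  shows "chi (U - S) X = chi U X * chi S X"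
proof -
  have "chi U X = chi (U - S) X * chi S X"
    unfolding chi_def using prod.subset_diff[OF assms(2,1)] by blast
  then show ?thesis by (simp add: chi_square mult.assoc)
qed

text \<open>The expectation factorises over coordinates: a coordinate of \<open>S\<close>
  contributes \<open>(1 - \<beta>) - \<beta>\<close>, any other one contributes 1.
  \<open>prod_add\<close> is the expansion of such a product into a sum over subsets.\<close>

lemma sum_bern_chi:
  assumes "finite U" "S \<subseteq> U"
  shows "(\<Sum>J\<in>Pow U. bern \<beta> U J * chi S J) = (1 - 2 * \<beta>) ^ card S"
proof -
  have *: "bern \<beta> U J * chi S J
      = (\<Prod>i\<in>J. if i \<in> S then - \<beta> else \<beta>) * (\<Prod>i\<in>U - J. 1 - \<beta>)" if "J \<in> Pow U" for J
  proof -
    have fin: "finite J" "finite S" using that assms finite_subset by auto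
    have "chi S J = (\<Prod>i\<in>J \<inter> S. - 1)"
      unfolding chi_def using fin by (intro prod.mono_neutral_cong_right) auto
    also have "\<dots> = (\<Prod>i\<in>J. if i \<in> S then - 1 else 1)"
      using fin by (intro prod.mono_neutral_cong_left) auto
    finally have "\<beta> ^ card J * chi S J = (\<Prod>i\<in>J. \<beta> * (if i \<in> S then - 1 else 1))"
      by (simp add: prod.distrib)
    also have "\<dots> = (\<Prod>i\<in>J. if i \<in> S then - \<beta> else \<beta>)" by (intro prod.cong) auto
    finally show ?thesis by (simp add: bern_def ac_simps)
  qed
  have "(\<Sum>J\<in>Pow U. bern \<beta> U J * chi S J)
      = (\<Sum>J\<in>Pow U. (\<Prod>i\<in>J. if i \<in> S then - \<beta> else \<beta>) * (\<Prod>i\<in>U - J. 1 - \<beta>))"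
    by (rule sum.cong[OF refl *])
  also have "\<dots> = (\<Prod>i\<in>U. (if i \<in> S then - \<beta> else \<beta>) + (1 - \<beta>))"
    by (rule prod_add[OF assms(1), symmetric])
  also have "\<dots> = (\<Prod>i\<in>S. 1 - 2 * \<beta>)"
    using assms by (intro prod.mono_neutral_cong_right) auto
  finally show ?thesis by simp
qed

lemma sum_bern: "finite U \<Longrightarrow> (\<Sum>J\<in>Pow U. bern \<beta> U J) = 1"
  using sum_bern_chi[of U "{}" \<beta>] by (simp add: chi_def)

lemma sum_chi:
  assumes "finite U" "Z \<subseteq> U"
  shows "(\<Sum>S\<in>Pow U. chi S Z) = (if Z = {} then 2 ^ card U else 0)"
proof -
  have "(\<Sum>S\<in>Pow U. chi S Z) = (\<Prod>i\<in>U. (if i \<in> Z then - 1 else 1) + 1)"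
    using prod_add[OF assms(1), of "\<lambda>i. if i \<in> Z then - 1 else 1" "\<lambda>i. 1 :: real"]
    by (simp add: chi_def)
  also have "\<dots> = (if Z = {} then 2 ^ card U else 0)"
    using assms by (auto simp: prod_zero_iff)
  finally show ?thesis .
qed

lemma fourier_inversion:
  assumes "finite U" "X \<subseteq> U"
  shows "(\<Sum>S\<in>Pow U. fourier U f S * chi S X) = f X"
proof -
  have "(\<Sum>S\<in>Pow U. fourier U f S * chi S X)
      = (\<Sum>S\<in>Pow U. \<Sum>Y\<in>Pow U. f Y * chi S (sym_diff Y X) / 2 ^ card U)"
    by (simp add: fourier_def sum_divide_distrib sum_distrib_right chi_sym_diff mult.assoc)
  also have "\<dots> = (\<Sum>Y\<in>Pow U. f Y / 2 ^ card U * (\<Sum>S\<in>Pow U. chi S (sym_diff Y X)))"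
    by (subst sum.swap) (simp add: sum_distrib_left)
  also have "\<dots> = (\<Sum>Y\<in>Pow U. if Y = X then f Y else 0)"
  proof (intro sum.cong refl)
    fix Y assume "Y \<in> Pow U"
    then have "sym_diff Y X \<subseteq> U" using assms(2) by auto
    moreover have "sym_diff Y X = {} \<longleftrightarrow> Y = X" by auto
    ultimately show "f Y / 2 ^ card U * (\<Sum>S\<in>Pow U. chi S (sym_diff Y X)) = (if Y = X then f Y else 0)"
      using sum_chi[OF assms(1), of "sym_diff Y X"] by simp
  qed
  also have "\<dots> = f X" using assms by simp
  finally show ?thesis .
qed

text \<open>Characters diagonalise every translation-invariant kernel. Only the second factor is
  expanded; multiplicativity of \<open>chi S\<close> on symmetric differences separates
  \<open>X\<close> from \<open>J\<close>, and the sum over \<open>X\<close> gives back a Fourier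
  coefficient.\<close>

lemma stab_fourier:
  assumes "finite U"
  shows "stab U k f f = (\<Sum>S\<in>Pow U. (fourier U f S)\<^sup>2 * (\<Sum>J\<in>Pow U. k J * chi S J))"
proof -
  have "(\<Sum>X\<in>Pow U. \<Sum>J\<in>Pow U. k J * f X * f (sym_diff X J))
     = (\<Sum>X\<in>Pow U. \<Sum>J\<in>Pow U. \<Sum>S\<in>Pow U. fourier U f S * (k J * chi S J) * (f X * chi S X))"
  proof (intro sum.cong refl)
    fix X J assume "X \<in> Pow U" "J \<in> Pow U"
    then have "sym_diff X J \<subseteq> U" by auto
    then have "f (sym_diff X J) = (\<Sum>S\<in>Pow U. fourier U f S * (chi S X * chi S J))"
      using fourier_inversion[OF assms, of "sym_diff X J" f] by (simp add: chi_sym_diff)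
    then show "k J * f X * f (sym_diff X J)
        = (\<Sum>S\<in>Pow U. fourier U f S * (k J * chi S J) * (f X * chi S X))"
      by (simp add: sum_distrib_left ac_simps)
  qed
  also have "\<dots> = (\<Sum>S\<in>Pow U. \<Sum>X\<in>Pow U. \<Sum>J\<in>Pow U. fourier U f S * (k J * chi S J) * (f X * chi S X))"
    by (subst sum.swap[of _ "Pow U" "Pow U"], subst sum.swap[of _ "Pow U" "Pow U"])
       (rule sum.swap[THEN trans], rule sum.cong[OF refl], rule sum.swap)
  also have "\<dots> = (\<Sum>S\<in>Pow U. fourier U f S * (\<Sum>J\<in>Pow U. k J * chi S J) * (\<Sum>X\<in>Pow U. f X * chi S X))"
    unfolding sum_distrib_left sum_distrib_right by (intro sum.cong refl sum.swap)
  finally have "stab U k f f = (\<Sum>S\<in>Pow U. fourier U f S * (\<Sum>J\<in>Pow U. k J * chi S J) * (\<Sum>X\<in>Pow U. f X * chi S X)) / 2 ^ card U"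
    by (simp only: stab_def)
  also have "\<dots> = (\<Sum>S\<in>Pow U. (fourier U f S)\<^sup>2 * (\<Sum>J\<in>Pow U. k J * chi S J))"
    unfolding sum_divide_distrib
    by (intro sum.cong refl) (simp add: fourier_def[of U f] power2_eq_square)
  finally show ?thesis .
qed

text \<open>The case of the diagonalisation in which the kernel is the point mass at the empty set,
  so that all eigenvalues are 1.\<close>

lemma parseval:
  assumes "finite U"
  shows "(\<Sum>S\<in>Pow U. (fourier U f S)\<^sup>2) = (\<Sum>X\<in>Pow U. (f X)\<^sup>2) / 2 ^ card U"
proof -
  let ?k = "\<lambda>J. if J = {} then 1 else 0 :: real"
  have pick: "(\<Sum>J\<in>Pow U. ?k J * h J) = h {}" for h :: "'a set \<Rightarrow> real"
  proof -
    have "(\<Sum>J\<in>Pow U. ?k J * h J) = (\<Sum>J\<in>{{}}. h J)"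
      using assms by (intro sum.mono_neutral_cong_right) auto
    then show ?thesis by simp
  qed
  show ?thesis
    using stab_fourier[OF assms, of ?k f]
    by (simp add: stab_def pick mult.assoc) (simp add: chi_def power2_eq_square)
qed

lemma fourier_mult_chi:
  assumes "finite U" "S \<subseteq> U"
  shows "fourier U (\<lambda>X. f X * chi U X) S = fourier U f (U - S)"
  using assms by (simp add: fourier_def chi_Diff mult.assoc)

lemma bern_nonneg: "0 \<le> \<beta> \<Longrightarrow> \<beta> \<le> 1 \<Longrightarrow> 0 \<le> bern \<beta> U J"
  by (simp add: bern_def)

lemma stab_le_abs:
  assumes "\<And>J. J \<subseteq> U \<Longrightarrow> 0 \<le> k J"
  shows "stab U k f g \<le> stab U k (\<lambda>X. \<bar>f X\<bar>) (\<lambda>X. \<bar>g X\<bar>)"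
  unfolding stab_def
proof (intro divide_right_mono sum_mono)
  fix X J assume "J \<in> Pow U"
  then have "k J * (f X * g (sym_diff X J)) \<le> k J * (\<bar>f X\<bar> * \<bar>g (sym_diff X J)\<bar>)"
    using assms by (intro mult_left_mono) (auto simp: abs_mult[symmetric])
  then show "k J * f X * g (sym_diff X J) \<le> k J * \<bar>f X\<bar> * \<bar>g (sym_diff X J)\<bar>"
    by (simp add: mult.assoc)
qed simp

lemma stab_mono:
  assumes "\<And>J. J \<subseteq> U \<Longrightarrow> 0 \<le> k J" "\<And>X. X \<subseteq> U \<Longrightarrow> 0 \<le> f X \<and> f X \<le> g X"
  shows "stab U k f f \<le> stab U k g g"
  unfolding stab_def
proof (intro divide_right_mono sum_mono)
  fix X J assume "X \<in> Pow U" "J \<in> Pow U"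
  then have "sym_diff X J \<subseteq> U" "X \<subseteq> U" "J \<subseteq> U" by auto
  then have "k J * (f X * f (sym_diff X J)) \<le> k J * (g X * g (sym_diff X J))"
    using assms(1)[of J] assms(2)[of X] assms(2)[of "sym_diff X J"]
    by (intro mult_left_mono mult_mono) auto
  then show "k J * f X * f (sym_diff X J) \<le> k J * g X * g (sym_diff X J)"
    by (simp add: mult.assoc)
qed simp

text \<open>The first two terms of the eigenvalue bound are the independent-noise spectrum and its
  reflection under complementation. The reflected one is the spectrum seen by
  \<open>f * chi U\<close>, and \<open>\<bar>f * chi U\<bar> = f\<close>, so it costs at most
  another copy of the same stability.\<close>

lemma stab_bern_le:
  assumes U: "finite U" and \<beta>: "0 \<le> \<beta>" "\<beta> \<le> 1" and "0 \<le> \<tau>"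
    and f: "\<And>X. X \<subseteq> U \<Longrightarrow> 0 \<le> f X"
    and eig: "\<And>S. S \<subseteq> U \<Longrightarrow> (\<Sum>J\<in>Pow U. k J * chi S J)
           \<le> (1 - 2 * \<beta>) ^ card S + \<tau> * (1 - 2 * \<beta>) ^ card (U - S) + \<epsilon>"
  shows "stab U k f f \<le> (1 + \<tau>) * stab U (bern \<beta> U) f f + \<epsilon> * ((\<Sum>X\<in>Pow U. (f X)\<^sup>2) / 2 ^ card U)"
proof -
  let ?F = "\<lambda>S. (fourier U f S)\<^sup>2"
  have st: "stab U (bern \<beta> U) f f = (\<Sum>S\<in>Pow U. (fourier U f S)\<^sup>2 * (1 - 2 * \<beta>) ^ card S)" for f
    using stab_fourier[OF U, of "bern \<beta> U" f] sum_bern_chi[OF U, of _ \<beta>] by simp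
  have "stab U k f f \<le> (\<Sum>S\<in>Pow U. ?F S * ((1 - 2 * \<beta>) ^ card S + \<tau> * (1 - 2 * \<beta>) ^ card (U - S) + \<epsilon>))"
    unfolding stab_fourier[OF U, of k f] using eig by (intro sum_mono mult_left_mono) auto
  also have "\<dots> = stab U (bern \<beta> U) f f + \<tau> * (\<Sum>S\<in>Pow U. ?F S * (1 - 2 * \<beta>) ^ card (U - S))
      + \<epsilon> * ((\<Sum>X\<in>Pow U. (f X)\<^sup>2) / 2 ^ card U)"
    unfolding st parseval[OF U, symmetric]
    by (simp add: algebra_simps sum.distrib sum_distrib_left)
  \<comment> \<open>Complementation of \<open>S\<close> moves the reflection from the eigenvalue to
    the coefficient, where it is multiplication by \<open>chi U\<close>.\<close>
  also have "(\<Sum>S\<in>Pow U. ?F S * (1 - 2 * \<beta>) ^ card (U - S))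
      = (\<Sum>S\<in>Pow U. ?F (U - S) * (1 - 2 * \<beta>) ^ card S)"
    by (rule sum.reindex_bij_witness[where i = "\<lambda>S. U - S" and j = "\<lambda>S. U - S"])
       (auto simp: double_diff)
  also have "\<dots> = stab U (bern \<beta> U) (\<lambda>X. f X * chi U X) (\<lambda>X. f X * chi U X)"
    unfolding st by (intro sum.cong refl) (simp add: fourier_mult_chi[OF U])
  also have "\<dots> \<le> stab U (bern \<beta> U) (\<lambda>X. \<bar>f X * chi U X\<bar>) (\<lambda>X. \<bar>f X * chi U X\<bar>)"
    using \<beta> by (intro stab_le_abs bern_nonneg)
  also have "\<dots> \<le> stab U (bern \<beta> U) f f"
    using \<beta> f by (intro stab_mono bern_nonneg) (auto simp: abs_mult abs_chi)
  finally have "stab U k f f \<le> stab U (bern \<beta> U) f f + \<tau> * stab U (bern \<beta> U) f f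
      + \<epsilon> * ((\<Sum>X\<in>Pow U. (f X)\<^sup>2) / 2 ^ card U)"
    using \<open>0 \<le> \<tau>\<close> by (simp add: mult_left_mono)
  then show ?thesis by (simp add: distrib_right)
qed

section \<open>Hypercontractivity\<close>

text \<open>Both sides agree to first order at 0. Differentiating twice reduces the claim to
  \<open>amgm\<close>. The bound \<open>y < 1\<close> keeps the powers of \<open>1 - y\<close>
  differentiable on the whole interval.\<close>

lemma two_point_aux:
  fixes p y :: real
  assumes p: "1 \<le> p" "p \<le> 2" and y: "0 \<le> y" "y < 1"
  shows "1 + p * (p - 1) / 2 * y\<^sup>2 \<le> ((1 + y) powr p + (1 - y) powr p) / 2"
proof -
  \<comment> \<open>Arithmetic-geometric mean: the product of the two powers is a power of
    \<open>1 - z\<^sup>2\<close> with exponent at most 0, as \<open>p \<le> 2\<close>, hence at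
    least 1.\<close>
  have amgm: "2 \<le> (1 + z) powr (p - 2) + (1 - z) powr (p - 2)" if z: "0 \<le> z" "z < 1" for z :: real
  proof -
    define u v where "u = (1 + z) powr ((p - 2) / 2)" and "v = (1 - z) powr ((p - 2) / 2)"
    have "u * v = (1 - z\<^sup>2) powr ((p - 2) / 2)"
      unfolding u_def v_def using z
      by (subst powr_mult[symmetric]) (auto simp: algebra_simps power2_eq_square)
    also have "\<dots> \<ge> 1"
    proof -
      have "0 < 1 - z\<^sup>2" "1 - z\<^sup>2 \<le> 1" using z by (auto simp: power_less_one_iff)
      then show ?thesis using powr_mono2'[of "(p - 2) / 2" "1 - z\<^sup>2" 1] p by simp
    qed
    finally have "1 \<le> u * v" .
    moreover have "0 \<le> (u - v)\<^sup>2" by simp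
    moreover have "(1 + z) powr (p - 2) = u\<^sup>2" "(1 - z) powr (p - 2) = v\<^sup>2"
      unfolding u_def v_def power2_eq_square using z by (auto simp: powr_add[symmetric])
    ultimately show ?thesis by (simp add: power2_diff)
  qed
  have d1: "((\<lambda>x. (1 + x) powr q) has_real_derivative q * (1 + x) powr (q - 1)) (at x)"
    if "0 \<le> x" for x q :: real
    using DERIV_fun_powr[of "\<lambda>x. 1 + x" 1 x q] that by (auto intro!: derivative_eq_intros)
  have d2: "((\<lambda>x. (1 - x) powr q) has_real_derivative - (q * (1 - x) powr (q - 1))) (at x)"
    if "x < 1" for x q :: real
    using DERIV_fun_powr[of "\<lambda>x. 1 - x" "-1" x q] that by (auto intro!: derivative_eq_intros)
  have g: "2 * (p - 1) * z \<le> (1 + z) powr (p - 1) - (1 - z) powr (p - 1)" if z: "0 \<le> z" "z < 1" for z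
  proof -
    let ?g = "\<lambda>x. (1 + x) powr (p - 1) - (1 - x) powr (p - 1) - 2 * (p - 1) * x"
    have "?g 0 \<le> ?g z"
    proof (rule DERIV_nonneg_imp_nondecreasing[OF z(1)])
      fix x assume x: "0 \<le> x" "x \<le> z"
      have "(?g has_real_derivative
          (p - 1) * ((1 + x) powr (p - 2) + (1 - x) powr (p - 2) - 2)) (at x)"
        using x z by (auto intro!: derivative_eq_intros d1 d2) (simp add: algebra_simps)
      moreover have "0 \<le> (p - 1) * ((1 + x) powr (p - 2) + (1 - x) powr (p - 2) - 2)"
        using amgm[of x] x z p by simp
      ultimately show "\<exists>y. (?g has_real_derivative y) (at x) \<and> 0 \<le> y" by blast
    qed
    then show ?thesis by simp
  qed
  let ?h = "\<lambda>x. ((1 + x) powr p + (1 - x) powr p) / 2 - p * (p - 1) / 2 * x\<^sup>2"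
  have "?h 0 \<le> ?h y"
  proof (rule DERIV_nonneg_imp_nondecreasing[OF y(1)])
    fix x assume x: "0 \<le> x" "x \<le> y"
    have "(?h has_real_derivative
        p / 2 * ((1 + x) powr (p - 1) - (1 - x) powr (p - 1) - 2 * (p - 1) * x)) (at x)"
      using x y by (auto intro!: derivative_eq_intros d1 d2) (simp add: field_simps)
    moreover have "0 \<le> p / 2 * ((1 + x) powr (p - 1) - (1 - x) powr (p - 1) - 2 * (p - 1) * x)"
      using g[of x] x y p by simp
    ultimately show "\<exists>y. (?h has_real_derivative y) (at x) \<and> 0 \<le> y" by blast
  qed
  then have "1 \<le> ?h y" by simp
  then show ?thesis by linarith
qed

lemma two_point_normalized:
  fixes p y :: real
  assumes p: "1 \<le> p" "p \<le> 2" and y: "0 \<le> y" "y \<le> 1"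
  shows "1 + (p - 1) * y\<^sup>2 \<le> (((1 + y) powr p + (1 - y) powr p) / 2) powr (2 / p)"
proof -
  have main: "1 + p * (p - 1) / 2 * y\<^sup>2 \<le> ((1 + y) powr p + (1 - y) powr p) / 2"
  proof (cases "y = 1")
    case True
    \<comment> \<open>At the endpoint differentiability may fail, but continuity does not, so the
      inequality is carried over by a left limit.\<close>
    have "((\<lambda>y. ((1 + y) powr p + (1 - y) powr p) / 2 - p * (p - 1) / 2 * y\<^sup>2) \<longlongrightarrow>
        ((1 + 1) powr p + (1 - 1) powr p) / 2 - p * (p - 1) / 2 * 1\<^sup>2) (at_left 1)"
      using p by (intro tendsto_intros tendsto_powr2) (auto simp: eventually_at_left_field intro: exI[of _ 0])
    moreover have "\<forall>\<^sub>F y in at_left 1. 1 \<le> ((1 + y) powr p + (1 - y) powr p) / 2 - p * (p - 1) / 2 * y\<^sup>2"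
      using two_point_aux[OF p] by (auto simp: eventually_at_left_field algebra_simps intro!: exI[of _ 0])
    ultimately have "1 \<le> ((1 + 1) powr p + (1 - 1) powr p) / 2 - p * (p - 1) / 2 * 1\<^sup>2"
      by (rule tendsto_lowerbound) simp
    then show ?thesis using True by simp
  qed (use y two_point_aux[OF p] in auto)
  \<comment> \<open>Bernoulli's inequality for the exponent \<open>p / 2 \<le> 1\<close>, obtained
    as Young's inequality with weights \<open>p / 2\<close> and \<open>1 - p / 2\<close>.\<close>
  have "(1 + (p - 1) * y\<^sup>2) powr (p / 2) * 1 powr (1 - p / 2)
      \<le> p / 2 * (1 + (p - 1) * y\<^sup>2) + (1 - p / 2) * 1"
    using p by (intro Youngs_inequality_0) (auto intro: add_pos_nonneg)
  also have "\<dots> = 1 + p * (p - 1) / 2 * y\<^sup>2" by (simp add: field_simps)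
  finally have "(1 + (p - 1) * y\<^sup>2) powr (p / 2) \<le> ((1 + y) powr p + (1 - y) powr p) / 2"
    using main by simp
  then have "((1 + (p - 1) * y\<^sup>2) powr (p / 2)) powr (2 / p)
      \<le> (((1 + y) powr p + (1 - y) powr p) / 2) powr (2 / p)"
    using p by (intro powr_mono2) auto
  moreover have "((1 + (p - 1) * y\<^sup>2) powr (p / 2)) powr (2 / p) = 1 + (p - 1) * y\<^sup>2"
    using p by (simp add: powr_powr add_pos_nonneg)
  ultimately show ?thesis by simp
qed

text \<open>Both sides are homogeneous of degree 2, so with mean \<open>s\<close> and relative
  deviation \<open>y\<close> the values become \<open>s * (1 + y)\<close> and
  \<open>s * (1 - y)\<close>. The form is then \<open>s\<^sup>2\<close> times
  \<open>1 + (1 - 2 * \<beta>) * y\<^sup>2\<close>, which fixes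
  \<open>p - 1 = 1 - 2 * \<beta>\<close>.\<close>

lemma two_point:
  fixes u v \<beta> :: real
  assumes \<beta>: "0 \<le> \<beta>" "\<beta> \<le> 1 / 2" and uv: "0 \<le> u" "0 \<le> v" and p: "p = 2 * (1 - \<beta>)"
  shows "(1 - \<beta>) / 2 * (u\<^sup>2 + v\<^sup>2) + \<beta> * u * v \<le> ((u powr p + v powr p) / 2) powr (2 / p)"
proof -
  have *: "(1 - \<beta>) / 2 * (u\<^sup>2 + v\<^sup>2) + \<beta> * u * v \<le> ((u powr p + v powr p) / 2) powr (2 / p)"
    if uv: "0 \<le> v" "v \<le> u" for u v :: real
  proof (cases "u + v = 0")
    case True
    then have "u = 0" "v = 0" using uv by auto
    then show ?thesis by simp
  next
    case False
    define s y where "s = (u + v) / 2" and "y = (u - v) / (u + v)"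
    have s: "0 < s" using False uv by (simp add: s_def)
    have y: "0 \<le> y" "y \<le> 1" using s uv by (auto simp: y_def s_def)
    have eq: "u = s * (1 + y)" "v = s * (1 - y)"
      using s by (auto simp: s_def y_def field_simps)
    have pp: "1 \<le> p" "p \<le> 2" using \<beta> p by auto
    have "(1 - \<beta>) / 2 * (u\<^sup>2 + v\<^sup>2) + \<beta> * u * v = s\<^sup>2 * (1 + (p - 1) * y\<^sup>2)"
      unfolding eq p by (simp add: power2_eq_square algebra_simps) (simp add: field_simps)
    also have "\<dots> \<le> s\<^sup>2 * (((1 + y) powr p + (1 - y) powr p) / 2) powr (2 / p)"
      using two_point_normalized[OF pp y] by (intro mult_left_mono) auto
    also have "s\<^sup>2 = (s powr p) powr (2 / p)"
      using s pp by (simp add: powr_powr)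
    also have "(s powr p) powr (2 / p) * (((1 + y) powr p + (1 - y) powr p) / 2) powr (2 / p)
        = (s powr p * (((1 + y) powr p + (1 - y) powr p) / 2)) powr (2 / p)"
      by (subst powr_mult) auto
    also have "s powr p * (((1 + y) powr p + (1 - y) powr p) / 2) = (u powr p + v powr p) / 2"
      unfolding eq using s y by (subst (1 2) powr_mult) (auto simp: distrib_left)
    finally show ?thesis .
  qed
  show ?thesis
    using *[of u v] *[of v u] uv by (cases "v \<le> u") (auto simp: add.commute mult_ac)
qed

text \<open>For \<beta> at most 1/2 the form \<open>Q\<close> is positive semidefinite, so
  Cauchy-Schwarz reduces the bilinear statement to the quadratic one. The identity \<open>id\<close>
  is the exact defect: the determinant \<open>(1 - 2 * \<beta>) / 4\<close> of the form times a
  squared cross product.\<close>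

lemma two_point_bilinear:
  fixes u v u' v' \<beta> :: real
  assumes \<beta>: "0 \<le> \<beta>" "\<beta> \<le> 1 / 2" and uv: "0 \<le> u" "0 \<le> v" "0 \<le> u'" "0 \<le> v'" and p: "p = 2 * (1 - \<beta>)"
  shows "((1 - \<beta>) * (u * u' + v * v') + \<beta> * (u * v' + v * u')) / 2
     \<le> ((u powr p + v powr p) / 2) powr (1 / p) * ((u' powr p + v' powr p) / 2) powr (1 / p)"
proof -
  define Q where "Q = (\<lambda>u v. (1 - \<beta>) / 2 * (u\<^sup>2 + v\<^sup>2) + \<beta> * u * v)"
  define N where "N = (\<lambda>u v. ((u powr p + v powr p) / 2) powr (1 / p))"
  define B where "B = ((1 - \<beta>) * (u * u' + v * v') + \<beta> * (u * v' + v * u')) / 2"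
  have Q: "0 \<le> Q u v" if "0 \<le> u" "0 \<le> v" for u v
    unfolding Q_def using that \<beta> by auto
  have QN: "Q u v \<le> (N u v)\<^sup>2" if "0 \<le> u" "0 \<le> v" for u v
    using two_point[OF \<beta> that p] by (simp add: Q_def N_def powr_powr power2_eq_square powr_add[symmetric])
  have id: "Q u v * Q u' v' - B\<^sup>2 = (1 - 2 * \<beta>) / 4 * (u * v' - v * u')\<^sup>2"
    unfolding Q_def B_def by (simp add: power2_eq_square field_simps)
  have "0 \<le> Q u v * Q u' v' - B\<^sup>2"
    unfolding id using \<beta> by (intro mult_nonneg_nonneg) auto
  also have "Q u v * Q u' v' \<le> (N u v)\<^sup>2 * (N u' v')\<^sup>2"
    using uv by (intro mult_mono QN Q) auto
  finally have "B\<^sup>2 \<le> (N u v * N u' v')\<^sup>2" by (simp add: power_mult_distrib)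
  then have "B \<le> N u v * N u' v'"
    by (rule power2_le_imp_le) (simp add: N_def)
  then show ?thesis by (simp add: B_def N_def)
qed

lemma bern_insert:
  assumes "finite U" "u \<notin> U" "J \<in> Pow U"
  shows "bern \<beta> (insert u U) J = (1 - \<beta>) * bern \<beta> U J"
    "bern \<beta> (insert u U) (insert u J) = \<beta> * bern \<beta> U J"
proof -
  have "finite J" "u \<notin> J" using assms finite_subset by auto
  moreover have "insert u U - J = insert u (U - J)" "insert u U - insert u J = U - J"
    using assms by auto
  ultimately show "bern \<beta> (insert u U) J = (1 - \<beta>) * bern \<beta> U J"
    "bern \<beta> (insert u U) (insert u J) = \<beta> * bern \<beta> U J"
    using assms by (auto simp: bern_def)
qed

text \<open>Conditioning on the coordinate \<open>u\<close>: \<open>f\<close> and \<open>s f\<close>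
  are the two restrictions. With probability \<open>1 - \<beta>\<close> both endpoints see the same
  restriction, with probability \<beta> they see different ones, and the two starting values are
  equally likely.\<close>

lemma stab_bern_insert:
  fixes \<beta> :: real
  assumes "finite U" "u \<notin> U"
  defines "B \<equiv> stab U (bern \<beta> U)" and "s \<equiv> \<lambda>f X. f (insert u X)"
  shows "stab (insert u U) (bern \<beta> (insert u U)) f g
    = ((1 - \<beta>) * (B f g + B (s f) (s g)) + \<beta> * (B f (s g) + B (s f) g)) / 2"
proof -
  let ?b = "bern \<beta> (insert u U)"
  note b = bern_insert[OF assms(1,2), of _ \<beta>]
  have d: "sym_diff (insert u X) J = insert u (sym_diff X J)"
    "sym_diff X (insert u J) = insert u (sym_diff X J)"
    "sym_diff (insert u X) (insert u J) = sym_diff X J" if "X \<in> Pow U" "J \<in> Pow U" for X J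
    using that assms(2) by auto
  have "(\<Sum>X\<in>Pow (insert u U). \<Sum>J\<in>Pow (insert u U). ?b J * f X * g (sym_diff X J))
     = (\<Sum>X\<in>Pow U. \<Sum>J\<in>Pow U.
         (1 - \<beta>) * (bern \<beta> U J * f X * g (sym_diff X J) + bern \<beta> U J * s f X * s g (sym_diff X J))
         + \<beta> * (bern \<beta> U J * f X * s g (sym_diff X J) + bern \<beta> U J * s f X * g (sym_diff X J)))"
    unfolding sum_Pow_insert[OF assms(1,2)] sum.distrib[symmetric]
    by (intro sum.cong refl) (simp only: b d s_def, simp add: algebra_simps)
  also have "\<dots> = 2 ^ card U * ((1 - \<beta>) * (B f g + B (s f) (s g)) + \<beta> * (B f (s g) + B (s f) g))"
    unfolding stab_def B_def sum.distrib sum_distrib_left[symmetric] by (simp add: field_simps)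
  finally show ?thesis
    using assms(1,2) unfolding stab_def[of "insert u U"] by simp
qed

text \<open>Tensorisation. The induction hypothesis bounds each of the four stabilities of
  restrictions by a product of norms, and the two-point inequality is then applied to these norms;
  the norm on the larger cube is the two-point norm of the norms of the restrictions.\<close>

lemma stab_bern_hypercontractive:
  fixes f g :: "'a set \<Rightarrow> real"
  assumes "finite U" and \<beta>: "0 \<le> \<beta>" "\<beta> \<le> 1 / 2" and p: "p = 2 * (1 - \<beta>)"
    and "\<And>X. 0 \<le> f X" "\<And>X. 0 \<le> g X"
  shows "stab U (bern \<beta> U) f g \<le> ((\<Sum>X\<in>Pow U. f X powr p) / 2 ^ card U) powr (1 / p)
     * ((\<Sum>X\<in>Pow U. g X powr p) / 2 ^ card U) powr (1 / p)"
  using assms(1,5,6)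
proof (induction U arbitrary: f g rule: finite_induct)
  case empty
  have "p > 0" using \<beta> p by auto
  then show ?case using empty by (simp add: stab_def bern_def powr_powr)
next
  case (insert u U)
  define N where "N = (\<lambda>f. ((\<Sum>X\<in>Pow U. f X powr p) / 2 ^ card U) powr (1 / p))"
  define s where "s = (\<lambda>f :: 'a set \<Rightarrow> real. \<lambda>X. f (insert u X))"
  have "p > 0" using \<beta> p by auto
  have NN: "((\<Sum>X\<in>Pow (insert u U). f X powr p) / 2 ^ card (insert u U)) powr (1 / p)
      = ((N f powr p + N (s f) powr p) / 2) powr (1 / p)" for f :: "'a set \<Rightarrow> real"
  proof -
    have "N f powr p = (\<Sum>X\<in>Pow U. f X powr p) / 2 ^ card U" for f :: "'a set \<Rightarrow> real"
      unfolding N_def using \<open>p > 0\<close> by (simp add: powr_powr sum_nonneg)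
    then show ?thesis
      unfolding sum_Pow_insert[OF insert.hyps(1,2)] using insert.hyps
      by (simp add: s_def sum.distrib add_divide_distrib mult.commute)
  qed
  have IH: "stab U (bern \<beta> U) f g \<le> N f * N g" if "\<And>X. 0 \<le> f X" "\<And>X. 0 \<le> g X" for f g
    using insert.IH[OF that] by (simp add: N_def)
  let ?B = "stab U (bern \<beta> U)"
  have pos: "\<And>X. 0 \<le> s f X" "\<And>X. 0 \<le> s g X" using insert.prems by (auto simp: s_def)
  have "stab (insert u U) (bern \<beta> (insert u U)) f g
      = ((1 - \<beta>) * (?B f g + ?B (s f) (s g)) + \<beta> * (?B f (s g) + ?B (s f) g)) / 2"
    unfolding s_def by (rule stab_bern_insert[OF insert.hyps(1,2)])
  also have "\<dots> \<le> ((1 - \<beta>) * (N f * N g + N (s f) * N (s g)) + \<beta> * (N f * N (s g) + N (s f) * N g)) / 2"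
    using \<beta> insert.prems pos by (intro divide_right_mono add_mono mult_left_mono IH) auto
  also have "\<dots> \<le> ((N f powr p + N (s f) powr p) / 2) powr (1 / p) * ((N g powr p + N (s g) powr p) / 2) powr (1 / p)"
    using \<beta> p by (intro two_point_bilinear) (auto simp: N_def)
  finally show ?case by (simp add: NN)
qed

definition ind :: "'b set \<Rightarrow> 'b \<Rightarrow> real" where
  "ind A X = (if X \<in> A then 1 else 0)"

text \<open>An indicator equals its own power with exponent \<open>p\<close>, so each norm is the
  measure of \<open>A\<close> raised to \<open>1 / p\<close>, and
  \<open>2 / p = 1 / (1 - \<beta>)\<close>.\<close>

lemma stab_bern_ind_le:
  assumes U: "finite U" and \<beta>: "0 \<le> \<beta>" "\<beta> \<le> 1 / 2" and A: "A \<subseteq> Pow U" "real (card A) \<le> \<alpha> * 2 ^ card U"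
  shows "stab U (bern \<beta> U) (ind A) (ind A) \<le> \<alpha> powr (1 / (1 - \<beta>))"
proof -
  define p where "p = 2 * (1 - \<beta>)"
  have p: "p > 0" using \<beta> p_def by auto
  define a where "a = real (card A) / 2 ^ card U"
  have a: "0 \<le> a" "a \<le> \<alpha>" using A by (auto simp: a_def field_simps)
  have "(\<Sum>X\<in>Pow U. ind A X powr p) = (\<Sum>X\<in>A. 1)"
    using A U by (intro sum.mono_neutral_cong_right) (auto simp: ind_def)
  then have "stab U (bern \<beta> U) (ind A) (ind A) \<le> a powr (1 / p) * a powr (1 / p)"
    using stab_bern_hypercontractive[OF U \<beta> p_def, of "ind A" "ind A"] by (simp add: ind_def a_def)
  also have "\<dots> = a powr (1 / (1 - \<beta>))"
  proof -
    have "1 / p + 1 / p = 1 / (1 - \<beta>)" using p by (simp add: p_def field_simps)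
    then show ?thesis by (simp add: powr_add[symmetric])
  qed
  also have "\<dots> \<le> \<alpha> powr (1 / (1 - \<beta>))"
    using a \<beta> by (intro powr_mono2) auto
  finally show ?thesis .
qed

section \<open>Asymptotics of Krawtchouk polynomials\<close>

text \<open>Dimension and radius are independent variables here, not a sequence of radii: ball noise
  mixes many radii in one dimension, and an eventual statement for this filter holds for all
  \<open>j\<close> with \<open>j / n\<close> close to \<beta> simultaneously.\<close>

definition scaling :: "real \<Rightarrow> (nat \<times> nat) filter" where
  "scaling \<beta> = inf (filtercomap fst at_top) (filtercomap (\<lambda>(n, j). real j / real n) (nhds \<beta>))"

lemma filterlim_scaling_iff:
  "filterlim r (scaling \<beta>) G \<longleftrightarrow>
     filterlim (\<lambda>x. fst (r x)) at_top G \<and> ((\<lambda>x. real (snd (r x)) / real (fst (r x))) \<longlongrightarrow> \<beta>) G"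
  by (simp add: scaling_def filterlim_inf filterlim_filtercomap_iff case_prod_beta comp_def)

lemma filterlim_fst_scaling: "filterlim fst at_top (scaling \<beta>)"
  and tendsto_ratio_scaling: "((\<lambda>x. real (snd x) / real (fst x)) \<longlongrightarrow> \<beta>) (scaling \<beta>)"
  using filterlim_ident[of "scaling \<beta>"] by (simp_all add: filterlim_scaling_iff)

lemma eventually_scaling_ge: "\<forall>\<^sub>F x in scaling \<beta>. m \<le> fst x"
  using filterlim_fst_scaling by (auto simp: filterlim_at_top)

lemma tendsto_inverse_fst_scaling: "((\<lambda>x. 1 / real (fst x)) \<longlongrightarrow> 0) (scaling \<beta>)"
  by (rule filterlim_compose[OF lim_1_over_n filterlim_fst_scaling])

lemma eventually_scaling_snd_ge:
  assumes "0 < \<beta>"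
  shows "\<forall>\<^sub>F x in scaling \<beta>. a \<le> snd x"
proof -
  have "\<beta> / 2 < \<beta>" using assms by simp
  from order_tendstoD(1)[OF tendsto_ratio_scaling this] eventually_scaling_ge[of "Suc (nat \<lceil>2 * real a / \<beta>\<rceil>)"]
  show ?thesis
  proof eventually_elim
    case (elim x)
    then have n: "0 < real (fst x)" "2 * real a / \<beta> \<le> real (fst x)" by linarith+
    then have "real a \<le> \<beta> / 2 * real (fst x)" using assms by (simp add: field_simps)
    also have "\<dots> < real (snd x)" using elim n by (simp add: field_simps)
    finally show ?case by simp
  qed
qed

lemma eventually_scaling_snd_pos:
  assumes "0 < \<beta>"
  shows "\<forall>\<^sub>F x in scaling \<beta>. 0 < snd x"
  using eventually_scaling_snd_ge[OF assms, of 1] by eventually_elim simp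

lemma eventually_scaling_snd_less:
  assumes "\<beta> < 1"
  shows "\<forall>\<^sub>F x in scaling \<beta>. snd x < fst x"
  using order_tendstoD(2)[OF tendsto_ratio_scaling assms] eventually_scaling_ge[of 1]
  by eventually_elim (auto simp: divide_less_eq)

lemma filterlim_scaling_pred_fst: "filterlim (\<lambda>x. (fst x - 1, snd x)) (scaling \<beta>) (scaling \<beta>)"
  and filterlim_scaling_pred_both:
    "0 < \<beta> \<Longrightarrow> filterlim (\<lambda>x. (fst x - 1, snd x - 1)) (scaling \<beta>) (scaling \<beta>)"
proof -
  have top: "filterlim (\<lambda>x. fst x - 1) at_top (scaling \<beta>)"
    by (rule filterlim_compose[OF _ filterlim_fst_scaling]) (rule filterlim_minus_const_nat_at_top)
  have "((\<lambda>x. (real (snd x) / real (fst x)) / (1 - 1 / real (fst x))) \<longlongrightarrow> \<beta> / (1 - 0)) (scaling \<beta>)"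
    by (intro tendsto_intros tendsto_ratio_scaling tendsto_inverse_fst_scaling) simp
  then have "((\<lambda>x. real (snd x) / real (fst x - 1)) \<longlongrightarrow> \<beta> / (1 - 0)) (scaling \<beta>)"
    by (rule Lim_transform_eventually)
       (use eventually_scaling_ge[of 2] in \<open>eventually_elim, auto simp: field_simps of_nat_diff\<close>)
  with top show "filterlim (\<lambda>x. (fst x - 1, snd x)) (scaling \<beta>) (scaling \<beta>)"
    by (simp add: filterlim_scaling_iff)
  assume "0 < \<beta>"
  have "((\<lambda>x. (real (snd x) / real (fst x) - 1 / real (fst x)) / (1 - 1 / real (fst x)))
      \<longlongrightarrow> (\<beta> - 0) / (1 - 0)) (scaling \<beta>)"
    by (intro tendsto_intros tendsto_ratio_scaling tendsto_inverse_fst_scaling) simp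
  then have "((\<lambda>x. real (snd x - 1) / real (fst x - 1)) \<longlongrightarrow> (\<beta> - 0) / (1 - 0)) (scaling \<beta>)"
    by (rule Lim_transform_eventually)
       (use eventually_scaling_ge[of 2] eventually_scaling_snd_pos[OF \<open>0 < \<beta>\<close>] in
        \<open>eventually_elim, auto simp: field_simps of_nat_diff\<close>)
  with top show "filterlim (\<lambda>x. (fst x - 1, snd x - 1)) (scaling \<beta>) (scaling \<beta>)"
    by (simp add: filterlim_scaling_iff)
qed

text \<open>Absorption gives \<open>(n - j) * (n choose j) = n * ((n - 1) choose j)\<close>. The
  ratio \<open>1 - j / n\<close> is the probability that a uniform \<open>j\<close>-set avoids a
  given point.\<close>

lemma scaling_shift_fst:
  fixes g :: "nat \<Rightarrow> nat \<Rightarrow> real"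
  assumes \<beta>: "\<beta> < 1" and g: "((\<lambda>(n, j). g n j / real (n choose j)) \<longlongrightarrow> L) (scaling \<beta>)"
  shows "((\<lambda>(n, j). g (n - 1) j / real (n choose j)) \<longlongrightarrow> (1 - \<beta>) * L) (scaling \<beta>)"
proof -
  have "((\<lambda>x. (1 - real (snd x) / real (fst x)) * (g (fst x - 1) (snd x) / real ((fst x - 1) choose snd x)))
      \<longlongrightarrow> (1 - \<beta>) * L) (scaling \<beta>)"
    using filterlim_compose[OF g filterlim_scaling_pred_fst]
    by (intro tendsto_intros tendsto_ratio_scaling) auto
  moreover have "\<forall>\<^sub>F x in scaling \<beta>.
      (1 - real (snd x) / real (fst x)) * (g (fst x - 1) (snd x) / real ((fst x - 1) choose snd x))
      = (case x of (n, j) \<Rightarrow> g (n - 1) j / real (n choose j))"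
    using eventually_scaling_snd_less[OF \<beta>]
  proof eventually_elim
    case (elim x)
    obtain n j where x: "x = (n, j)" by fastforce
    have "real (n - j) * real (n choose j) = real n * real ((n - 1) choose j)"
      using binomial_absorb_comp[of n j] by (metis of_nat_mult)
    then have "(1 - real j / real n) * real (n choose j) = real ((n - 1) choose j)"
      using elim by (simp add: x of_nat_diff field_simps)
    moreover have "real ((n - 1) choose j) \<noteq> 0" "real (n choose j) \<noteq> 0"
      using elim by (auto simp: x)
    ultimately have "(1 - real j / real n) / real ((n - 1) choose j) = 1 / real (n choose j)"
      by (simp add: divide_eq_eq eq_divide_eq)
    then have "(1 - real j / real n) / real ((n - 1) choose j) * g (n - 1) j = 1 / real (n choose j) * g (n - 1) j"
      by simp
    then show ?case by (simp add: x)
  qed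
  ultimately show ?thesis by (rule Lim_transform_eventually)
qed

text \<open>The companion absorption identity: \<open>j / n\<close> is the probability that a
  uniform \<open>j\<close>-set contains a given point.\<close>

lemma scaling_shift_both:
  fixes g :: "nat \<Rightarrow> nat \<Rightarrow> real"
  assumes \<beta>: "0 < \<beta>" "\<beta> < 1" and g: "((\<lambda>(n, j). g n j / real (n choose j)) \<longlongrightarrow> L) (scaling \<beta>)"
  shows "((\<lambda>(n, j). g (n - 1) (j - 1) / real (n choose j)) \<longlongrightarrow> \<beta> * L) (scaling \<beta>)"
proof -
  have "((\<lambda>x. (real (snd x) / real (fst x)) * (g (fst x - 1) (snd x - 1) / real ((fst x - 1) choose (snd x - 1))))
      \<longlongrightarrow> \<beta> * L) (scaling \<beta>)"
    using filterlim_compose[OF g filterlim_scaling_pred_both[OF \<beta>(1)]]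
    by (intro tendsto_intros tendsto_ratio_scaling) auto
  moreover have "\<forall>\<^sub>F x in scaling \<beta>.
      (real (snd x) / real (fst x)) * (g (fst x - 1) (snd x - 1) / real ((fst x - 1) choose (snd x - 1)))
      = (case x of (n, j) \<Rightarrow> g (n - 1) (j - 1) / real (n choose j))"
    using eventually_scaling_snd_less[OF \<beta>(2)] eventually_scaling_snd_pos[OF \<beta>(1)]
  proof eventually_elim
    case (elim x)
    obtain n j where x: "x = (n, Suc j)" using elim by (cases x; cases "snd x") auto
    have "real (Suc j) * real (n choose Suc j) = real n * real ((n - 1) choose j)"
      using binomial_absorption[of j n] by (metis of_nat_mult)
    then have "(real (Suc j) / real n) * real (n choose Suc j) = real ((n - 1) choose j)"
      using elim by (simp add: x field_simps)
    moreover have "real ((n - 1) choose j) \<noteq> 0" "real (n choose Suc j) \<noteq> 0"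
      using elim by (auto simp: x)
    ultimately have "(real (Suc j) / real n) / real ((n - 1) choose j) = 1 / real (n choose Suc j)"
      by (simp add: divide_eq_eq eq_divide_eq del: of_nat_Suc)
    then have "(real (Suc j) / real n) / real ((n - 1) choose j) * g (n - 1) j = 1 / real (n choose Suc j) * g (n - 1) j"
      by simp
    then show ?case by (simp add: x)
  qed
  ultimately show ?thesis by (rule Lim_transform_eventually)
qed

lemma tendsto_binomial_self_scaling:
  assumes "\<beta> < 1"
  shows "((\<lambda>(n, j). real (n choose j) / real (n choose j)) \<longlongrightarrow> 1) (scaling \<beta>)"
  by (rule tendsto_eventually)
     (use eventually_scaling_snd_less[OF assms] in
      \<open>eventually_elim, auto simp: case_prod_beta zero_less_binomial_iff\<close>)

text \<open>The quotient is the probability that a uniform \<open>j\<close>-set contains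
  \<open>a\<close> given points and avoids \<open>b\<close> others; in the limit the points decide
  independently.\<close>

lemma tendsto_binomial_shift_scaling:
  assumes \<beta>: "0 < \<beta>" "\<beta> < 1"
  shows "((\<lambda>(n, j). real ((n - (a + b)) choose (j - a)) / real (n choose j))
     \<longlongrightarrow> \<beta> ^ a * (1 - \<beta>) ^ b) (scaling \<beta>)"
proof (induction a)
  case 0
  show ?case
  proof (induction b)
    case 0
    show ?case using tendsto_binomial_self_scaling[OF \<beta>(2)] by simp
  next
    case (Suc b)
    show ?case
      using scaling_shift_fst[OF \<beta>(2), of "\<lambda>n j. real ((n - (0 + b)) choose (j - 0))", OF Suc]
      by (simp add: mult_ac)
  qed
next
  case (Suc a)
  show ?case
    using scaling_shift_both[OF \<beta>, of "\<lambda>n j. real ((n - (a + b)) choose (j - a))", OF Suc]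
    by (simp add: mult_ac)
qed

section \<open>Character sums with weights depending on the size only\<close>

definition ksum :: "'a set \<Rightarrow> 'a set \<Rightarrow> (nat \<Rightarrow> real) \<Rightarrow> real" where
  "ksum U S w = (\<Sum>J\<in>Pow U. w (card J) * chi S J)"

lemma ksum_diff: "ksum U S (\<lambda>i. v i - w i) = ksum U S v - ksum U S w"
  by (simp add: ksum_def left_diff_distrib sum_subtractf)

lemma ksum_zero: "ksum U S (\<lambda>i. 0) = 0"
  by (simp add: ksum_def)

text \<open>Sets containing \<open>u\<close> are traced back to \<open>U\<close> with their weight
  shifted by one, and with a minus sign if the character sees \<open>u\<close>. Arbitrary weights
  \<open>w\<close> are allowed so that removing coordinates only changes the weight.\<close>

lemma ksum_insert:
  assumes "finite U" "finite S" "u \<notin> U" "u \<notin> S"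
  shows ksum_insert_both: "ksum (insert u U) (insert u S) w = ksum U S (\<lambda>i. w i - w (Suc i))"
    and ksum_insert_fst: "ksum (insert u U) S w = ksum U S (\<lambda>i. w i + w (Suc i))"
proof -
  have J: "finite J \<and> u \<notin> J" if "J \<in> Pow U" for J
    using that assms finite_subset by auto
  have c: "chi S (insert u J) = chi S J" for J
    unfolding chi_def using assms by (intro prod.cong) auto
  show "ksum (insert u U) (insert u S) w = ksum U S (\<lambda>i. w i - w (Suc i))"
    unfolding ksum_def sum_Pow_insert[OF assms(1,3)]
    by (intro sum.cong refl) (use J in \<open>simp add: c chi_insert[OF assms(2,4)] left_diff_distrib\<close>)
  show "ksum (insert u U) S w = ksum U S (\<lambda>i. w i + w (Suc i))"
    unfolding ksum_def sum_Pow_insert[OF assms(1,3)]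
    by (intro sum.cong refl) (use J in \<open>simp add: c distrib_right\<close>)
qed

lemma sum_Pow_card:
  assumes "finite U"
  shows "(\<Sum>J\<in>Pow U. of_bool (card J = j)) = real (card U choose j)"
proof -
  have "(\<Sum>J\<in>Pow U. of_bool (card J = j)) = (\<Sum>J\<in>{J. J \<subseteq> U \<and> card J = j}. 1 :: real)"
    using assms by (intro sum.mono_neutral_cong_right) auto
  then show ?thesis using n_subsets[OF assms, of j] by simp
qed

lemma ksum_sphere_abs_le:
  assumes "finite U"
  shows "\<bar>ksum U S (\<lambda>i. of_bool (i = j))\<bar> \<le> real (card U choose j)"
proof -
  have "\<bar>ksum U S (\<lambda>i. of_bool (i = j))\<bar> \<le> (\<Sum>J\<in>Pow U. of_bool (card J = j))"
    unfolding ksum_def by (rule order_trans[OF sum_abs]) (simp add: abs_mult abs_chi)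
  then show ?thesis by (simp only: sum_Pow_card[OF assms])
qed

text \<open>
  \<open>kraw k n j\<close> is the coefficient of \<open>x ^ j\<close> in \<open>(1 - x) ^ k * (1 + x) ^ (n - k)\<close>.
\<close>

fun kraw :: "nat \<Rightarrow> nat \<Rightarrow> nat \<Rightarrow> real" where
  "kraw 0 n j = real (n choose j)"
| "kraw (Suc k) n j = kraw k (n - 1) j - (if j = 0 then 0 else kraw k (n - 1) (j - 1))"

lemma ksum_sphere_eq_kraw:
  assumes "finite U" "S \<subseteq> U" "card S = k"
  shows "ksum U S (\<lambda>i. of_bool (i = j)) = kraw k (card U) j"
  using assms
proof (induction k arbitrary: U S j)
  case 0
  then have "S = {}" using finite_subset[of S U] by auto
  then show ?case using sum_Pow_card[OF \<open>finite U\<close>, of j] by (simp add: ksum_def chi_def)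
next
  case (Suc k)
  then obtain u where u: "u \<in> S" by (metis card.empty ex_in_conv nat.distinct(1))
  define U' S' where "U' = U - {u}" and "S' = S - {u}"
  have eq: "U = insert u U'" "S = insert u S'" using u Suc.prems by (auto simp: U'_def S'_def)
  have fin: "finite U'" "finite S'" using Suc.prems finite_subset by (auto simp: U'_def S'_def)
  have nin: "u \<notin> U'" "u \<notin> S'" by (auto simp: U'_def S'_def)
  have sub: "S' \<subseteq> U'" "card S' = k" "card U = Suc (card U')"
    using Suc.prems(2,3) fin nin unfolding eq by auto
  have "ksum U S (\<lambda>i. of_bool (i = j)) = ksum U' S' (\<lambda>i. of_bool (i = j) - of_bool (Suc i = j))"
    unfolding eq using fin nin by (intro ksum_insert_both)
  also have "\<dots> = ksum U' S' (\<lambda>i. of_bool (i = j)) - ksum U' S' (\<lambda>i. of_bool (Suc i = j))"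
    by (rule ksum_diff)
  \<comment> \<open>The conditional matters at \<open>j = 0\<close>: no set containing the removed
    point has size 0, whereas truncated subtraction would turn \<open>j - 1\<close> into 0.\<close>
  also have "ksum U' S' (\<lambda>i. of_bool (Suc i = j)) = (if j = 0 then 0 else kraw k (card U') (j - 1))"
  proof (cases j)
    case 0
    then show ?thesis by (simp add: ksum_zero)
  next
    case (Suc j')
    then show ?thesis using Suc.IH[OF fin(1) sub(1,2), of j'] by simp
  qed
  finally show ?case using Suc.IH[OF fin(1) sub(1,2), of j] sub(3) by simp
qed

text \<open>The two terms of the recursion are the cases in which the next point of \<open>S\<close>
  is missed or hit by the flip set, so each step multiplies the limit by
  \<open>(1 - \<beta>) - \<beta>\<close>.\<close>

lemma tendsto_kraw_scaling:
  assumes \<beta>: "0 < \<beta>" "\<beta> < 1"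
  shows "((\<lambda>(n, j). kraw k n j / real (n choose j)) \<longlongrightarrow> (1 - 2 * \<beta>) ^ k) (scaling \<beta>)"
proof (induction k)
  case 0
  show ?case using tendsto_binomial_self_scaling[OF \<beta>(2)] by simp
next
  case (Suc k)
  have "((\<lambda>x. (case x of (n, j) \<Rightarrow> kraw k (n - 1) j / real (n choose j))
        - (case x of (n, j) \<Rightarrow> kraw k (n - 1) (j - 1) / real (n choose j)))
      \<longlongrightarrow> (1 - \<beta>) * (1 - 2 * \<beta>) ^ k - \<beta> * (1 - 2 * \<beta>) ^ k) (scaling \<beta>)"
    by (intro tendsto_diff scaling_shift_fst scaling_shift_both \<beta> Suc)
  moreover have "(1 - \<beta>) * (1 - 2 * \<beta>) ^ k - \<beta> * (1 - 2 * \<beta>) ^ k = (1 - 2 * \<beta>) ^ Suc k"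
    by (simp add: algebra_simps)
  moreover have "\<forall>\<^sub>F x in scaling \<beta>. (case x of (n, j) \<Rightarrow> kraw k (n - 1) j / real (n choose j))
        - (case x of (n, j) \<Rightarrow> kraw k (n - 1) (j - 1) / real (n choose j))
      = (case x of (n, j) \<Rightarrow> kraw (Suc k) n j / real (n choose j))"
    using eventually_scaling_snd_pos[OF \<beta>(1)]
    by eventually_elim (auto simp: case_prod_beta diff_divide_distrib)
  ultimately show ?case using Lim_transform_eventually by simp
qed

text \<open>
  \<open>pairb K n j\<close> is the coefficient of \<open>x ^ j\<close> in \<open>(1 + x\<^sup>2) ^ K * (1 + x) ^ (n - 2 * K)\<close>: it counts the
  \<open>j\<close>-sets that contain both or neither element of each of \<open>K\<close> disjoint pairs.
\<close>

fun pairb :: "nat \<Rightarrow> nat \<Rightarrow> nat \<Rightarrow> real" where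
  "pairb 0 n j = real (n choose j)"
| "pairb (Suc K) n j = pairb K (n - 1 - 1) j + (if j < 2 then 0 else pairb K (n - 1 - 1) (j - 1 - 1))"

text \<open>
  Swapping \<open>a \<in> S\<close> with \<open>b \<notin> S\<close> preserves the size of \<open>J\<close> and flips the sign of \<open>chi S J\<close>
  when exactly one of them lies in \<open>J\<close>, so only the sets \<open>J\<close> that contain both or neither survive.
\<close>

lemma ksum_sphere_pair_bound:
  assumes "finite U" "S \<subseteq> U" "K \<le> card S" "K \<le> card (U - S)"
  shows "\<bar>ksum U S (\<lambda>i. of_bool (i = j))\<bar> \<le> pairb K (card U) j"
  using assms
proof (induction K arbitrary: U S j)
  case 0
  then show ?case using ksum_sphere_abs_le by simp
next
  case (Suc K)
  have "S \<noteq> {}" "U - S \<noteq> {}"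
    using Suc.prems(3,4) by (metis card.empty not_less_eq_eq le0)+
  then obtain a b where a: "a \<in> S" and b: "b \<in> U - S" by blast
  define U' S' where "U' = U - {a, b}" and "S' = S - {a}"
  have eq: "U = insert a (insert b U')" "S = insert a S'"
    using a b Suc.prems by (auto simp: U'_def S'_def)
  have fin: "finite U'" "finite S'" using Suc.prems finite_subset by (auto simp: U'_def S'_def)
  have ab: "a \<notin> insert b U'" "a \<notin> S'" "b \<notin> U'" "b \<notin> S'" using a b by (auto simp: U'_def S'_def)
  have "U - S = insert b (U' - S')" using eq ab a b by auto
  then have sub: "S' \<subseteq> U'" "K \<le> card S'" "K \<le> card (U' - S')" "card U = Suc (Suc (card U'))"
    using Suc.prems(2-4) fin ab unfolding eq by auto
  have "ksum U S (\<lambda>i. of_bool (i = j))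
      = ksum (insert b U') S' (\<lambda>i. of_bool (i = j) - of_bool (Suc i = j))"
    unfolding eq using fin ab by (intro ksum_insert_both) auto
  also have "\<dots> = ksum U' S' (\<lambda>i. (of_bool (i = j) - of_bool (Suc i = j))
      + (of_bool (Suc i = j) - of_bool (Suc (Suc i) = j)))"
    using fin ab by (intro ksum_insert_fst) auto
  \<comment> \<open>The two middle weights cancel: they belong to the sets with exactly one of
    \<open>a\<close> and \<open>b\<close>.\<close>
  also have "\<dots> = ksum U' S' (\<lambda>i. of_bool (i = j) - of_bool (Suc (Suc i) = j))"
    by (simp only: add_diff_eq diff_add_cancel)
  also have "\<dots> = ksum U' S' (\<lambda>i. of_bool (i = j)) - ksum U' S' (\<lambda>i. of_bool (Suc (Suc i) = j))"
    by (rule ksum_diff)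
  also have "\<bar>\<dots>\<bar> \<le> \<bar>ksum U' S' (\<lambda>i. of_bool (i = j))\<bar> + \<bar>ksum U' S' (\<lambda>i. of_bool (Suc (Suc i) = j))\<bar>"
    by linarith
  also have "\<bar>ksum U' S' (\<lambda>i. of_bool (i = j))\<bar> \<le> pairb K (card U') j"
    by (rule Suc.IH[OF fin(1) sub(1-3)])
  also have "\<bar>ksum U' S' (\<lambda>i. of_bool (Suc (Suc i) = j))\<bar>
      \<le> (if j < 2 then 0 else pairb K (card U') (j - 1 - 1))"
  proof (cases "j < 2")
    case True
    then have "(\<lambda>i. of_bool (Suc (Suc i) = j)) = (\<lambda>i. 0 :: real)" by auto
    then show ?thesis using True by (simp add: ksum_zero)
  next
    case False
    then obtain j' where "j = Suc (Suc j')" by (metis add_2_eq_Suc le_Suc_ex not_less)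
    then show ?thesis using Suc.IH[OF fin(1) sub(1-3), of j'] by simp
  qed
  finally show ?case using sub(4) by (cases "j < 2") simp_all
qed

text \<open>Each pair is asymptotically avoided with probability
  \<open>(1 - \<beta>)\<^sup>2\<close> and contained with probability
  \<open>\<beta>\<^sup>2\<close>; a fixed number of pairs becomes independent.\<close>

lemma tendsto_pairb_scaling:
  assumes \<beta>: "0 < \<beta>" "\<beta> < 1"
  shows "((\<lambda>(n, j). pairb K n j / real (n choose j)) \<longlongrightarrow> ((1 - \<beta>)\<^sup>2 + \<beta>\<^sup>2) ^ K) (scaling \<beta>)"
proof (induction K)
  case 0
  show ?case using tendsto_binomial_self_scaling[OF \<beta>(2)] by simp
next
  case (Suc K)
  let ?L = "((1 - \<beta>)\<^sup>2 + \<beta>\<^sup>2) ^ K"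
  have "((\<lambda>(n, j). pairb K (n - 1 - 1) j / real (n choose j)) \<longlongrightarrow> (1 - \<beta>) * ((1 - \<beta>) * ?L)) (scaling \<beta>)"
    using scaling_shift_fst[OF \<beta>(2) scaling_shift_fst[OF \<beta>(2) Suc]] by simp
  moreover have "((\<lambda>(n, j). pairb K (n - 1 - 1) (j - 1 - 1) / real (n choose j)) \<longlongrightarrow> \<beta> * (\<beta> * ?L)) (scaling \<beta>)"
    using scaling_shift_both[OF \<beta> scaling_shift_both[OF \<beta> Suc]] by simp
  ultimately have "((\<lambda>x. (case x of (n, j) \<Rightarrow> pairb K (n - 1 - 1) j / real (n choose j))
        + (case x of (n, j) \<Rightarrow> pairb K (n - 1 - 1) (j - 1 - 1) / real (n choose j)))
      \<longlongrightarrow> (1 - \<beta>) * ((1 - \<beta>) * ?L) + \<beta> * (\<beta> * ?L)) (scaling \<beta>)"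
    by (rule tendsto_add)
  moreover have "(1 - \<beta>) * ((1 - \<beta>) * ?L) + \<beta> * (\<beta> * ?L) = ((1 - \<beta>)\<^sup>2 + \<beta>\<^sup>2) ^ Suc K"
    by (simp add: algebra_simps power2_eq_square)
  moreover have "\<forall>\<^sub>F x in scaling \<beta>. 0 < snd x - 1"
    using eventually_compose_filterlim[OF eventually_scaling_snd_pos filterlim_scaling_pred_both] \<beta>(1)
    by simp
  then have "\<forall>\<^sub>F x in scaling \<beta>. (case x of (n, j) \<Rightarrow> pairb K (n - 1 - 1) j / real (n choose j))
        + (case x of (n, j) \<Rightarrow> pairb K (n - 1 - 1) (j - 1 - 1) / real (n choose j))
      = (case x of (n, j) \<Rightarrow> pairb (Suc K) n j / real (n choose j))"
    by eventually_elim (auto simp: case_prod_beta add_divide_distrib)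
  ultimately show ?case using Lim_transform_eventually by simp
qed

text \<open>The restriction \<open>2 * card S \<le> n\<close> supplies as many partners outside
  \<open>S\<close> as there are points inside. Without it the claim fails for the full set, whose
  normalised sum is \<open>(- 1) ^ j\<close>.\<close>

lemma ksum_sphere_uniform:
  assumes \<beta>: "0 < \<beta>" "\<beta> \<le> 1 / 2" and \<epsilon>: "0 < \<epsilon>"
  shows "\<forall>\<^sub>F (n, j) in scaling \<beta>. \<forall>S. S \<subseteq> {..<n} \<and> 2 * card S \<le> n \<longrightarrow>
     \<bar>ksum {..<n} S (\<lambda>i. of_bool (i = j)) / real (n choose j) - (1 - 2 * \<beta>) ^ card S\<bar> \<le> \<epsilon>"
proof -
  \<comment> \<open>The limiting probability that both or neither point of a pair is flipped. It is
    less than 1, so a fixed number \<open>K\<close> of pairs makes the bound small independently of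
    \<open>n\<close> and \<open>S\<close>.\<close>
  define q where "q = (1 - \<beta>)\<^sup>2 + \<beta>\<^sup>2"
  have "q = 1 - 2 * \<beta> * (1 - \<beta>)" by (simp add: q_def power2_eq_square algebra_simps)
  moreover have "0 < 2 * \<beta> * (1 - \<beta>)" using \<beta> by simp
  ultimately have q: "q < 1" by simp
  have q0: "0 \<le> q" by (simp add: q_def)
  have b1: "\<beta> < 1" using \<beta> by simp
  have "\<forall>\<^sub>F K in sequentially. q ^ K < \<epsilon> / 4"
    using q q0 \<epsilon> by (intro order_tendstoD(2)[OF LIMSEQ_realpow_zero]) auto
  moreover have "\<forall>\<^sub>F K in sequentially. (1 - 2 * \<beta>) ^ K < \<epsilon> / 4"
    using \<beta> \<epsilon> by (intro order_tendstoD(2)[OF LIMSEQ_realpow_zero]) auto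
  ultimately obtain K where K: "q ^ K < \<epsilon> / 4" "(1 - 2 * \<beta>) ^ K < \<epsilon> / 4"
    using eventually_conj eventually_happens'[OF sequentially_bot] by blast
  have "\<forall>\<^sub>F (n, j) in scaling \<beta>. pairb K n j / real (n choose j) < \<epsilon> / 2"
    using order_tendstoD(2)[OF tendsto_pairb_scaling[OF \<beta>(1) b1, of K], of "\<epsilon> / 2"] K(1) \<epsilon>
    by (simp add: q_def split_def)
  moreover have "\<forall>\<^sub>F (n, j) in scaling \<beta>. \<forall>k\<in>{..<K}. \<bar>kraw k n j / real (n choose j) - (1 - 2 * \<beta>) ^ k\<bar> < \<epsilon>"
    unfolding case_prod_beta
    using tendstoD[OF tendsto_kraw_scaling[OF \<beta>(1) b1] \<epsilon>]
    by (intro eventually_ball_finite) (auto simp: dist_real_def split_def)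
  ultimately show ?thesis
  proof eventually_elim
    case (elim x)
    obtain n j where x: "x = (n, j)" by fastforce
    have "\<bar>ksum {..<n} S (\<lambda>i. of_bool (i = j)) / real (n choose j) - (1 - 2 * \<beta>) ^ card S\<bar> \<le> \<epsilon>"
      if S: "S \<subseteq> {..<n}" "2 * card S \<le> n" for S
    proof (cases "card S < K")
      case True
      then show ?thesis
        using elim S ksum_sphere_eq_kraw[of "{..<n}" S "card S" j] by (auto simp: x intro: less_imp_le)
    next
      case False
      have "card ({..<n} - S) = n - card S"
        using S by (simp add: card_Diff_subset finite_subset)
      then have "\<bar>ksum {..<n} S (\<lambda>i. of_bool (i = j))\<bar> \<le> pairb K n j"
        using ksum_sphere_pair_bound[of "{..<n}" S K j] S False by simp
      then have "\<bar>ksum {..<n} S (\<lambda>i. of_bool (i = j)) / real (n choose j)\<bar> \<le> pairb K n j / real (n choose j)"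
        by (simp add: divide_right_mono)
      moreover have "(1 - 2 * \<beta>) ^ card S \<le> (1 - 2 * \<beta>) ^ K" "0 \<le> (1 - 2 * \<beta>) ^ card S"
        using False \<beta> by (auto intro!: power_decreasing)
      moreover have "pairb K n j / real (n choose j) < \<epsilon> / 2" using elim(1) by (simp add: x)
      ultimately show ?thesis using K(2) by linarith
    qed
    then show ?case by (auto simp: x)
  qed
qed

lemma ksum_complement:
  assumes "finite U" "S \<subseteq> U"
  shows "ksum U (U - S) w = ksum U S (\<lambda>i. (- 1) ^ i * w i)"
  unfolding ksum_def
  by (intro sum.cong refl) (use assms in \<open>simp add: chi_Diff chi_superset\<close>)

text \<open>Once the trace on \<open>V\<close> is prescribed, only the \<open>j - card A\<close>
  points outside \<open>V\<close> are free. The condition \<open>card A \<le> j\<close> makes this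
  truncated subtraction the true difference.\<close>

lemma sum_Pow_card_trace:
  assumes "finite U" "V \<subseteq> U" "A \<subseteq> V" "card A \<le> j"
  shows "(\<Sum>J\<in>Pow U. of_bool (card J = j) * of_bool (J \<inter> V = A)) = real ((card U - card V) choose (j - card A))"
proof -
  have fin: "finite V" "finite (U - V)" "finite A"
    using assms finite_subset by (auto intro: finite_subset[of A U])
  have "(\<Sum>J\<in>Pow U. of_bool (card J = j) * of_bool (J \<inter> V = A))
      = (\<Sum>X\<in>Pow V. \<Sum>Y\<in>Pow (U - V). of_bool (card (X \<union> Y) = j) * of_bool ((X \<union> Y) \<inter> V = A) :: real)"
    using sum_Pow_Un[OF fin(1,2), of "\<lambda>J. of_bool (card J = j) * of_bool (J \<inter> V = A)"] assms(2)
    by (simp add: Un_absorb1)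
  also have "\<dots> = (\<Sum>X\<in>Pow V. if X = A then \<Sum>Y\<in>Pow (U - V). of_bool (card Y = j - card A) else 0)"
  proof (intro sum.cong refl)
    fix X assume X: "X \<in> Pow V"
    have "of_bool (card (X \<union> Y) = j) * of_bool ((X \<union> Y) \<inter> V = A)
        = (if X = A then of_bool (card Y = j - card A) else 0 :: real)" if Y: "Y \<in> Pow (U - V)" for Y
    proof -
      have "(X \<union> Y) \<inter> V = X" using X Y by auto
      moreover have "card (A \<union> Y) = card A + card Y"
        using Y assms(3) fin by (intro card_Un_disjoint) (auto intro: finite_subset)
      ultimately show ?thesis using assms(4) by auto
    qed
    then show "(\<Sum>Y\<in>Pow (U - V). of_bool (card (X \<union> Y) = j) * of_bool ((X \<union> Y) \<inter> V = A))
        = (if X = A then \<Sum>Y\<in>Pow (U - V). of_bool (card Y = j - card A) else 0 :: real)"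
      by (auto intro!: sum.cong)
  qed
  also have "\<dots> = real (card (U - V) choose (j - card A))"
    using fin assms(3) by (simp only: sum.delta finite_Pow_iff Pow_iff if_True sum_Pow_card)
  finally show ?thesis using assms(2) fin by (simp add: card_Diff_subset)
qed

section \<open>Radial noise\<close>

lemma eventually_scalingD:
  assumes "eventually P (scaling \<beta>)"
  obtains \<delta> N where "0 < \<delta>" "\<And>n j. N \<le> n \<Longrightarrow> \<bar>real j / real n - \<beta>\<bar> < \<delta> \<Longrightarrow> P (n, j)"
proof -
  from assms obtain Q R where Q: "eventually Q (filtercomap fst at_top)"
    and R: "eventually R (filtercomap (\<lambda>(n, j). real j / real n) (nhds \<beta>))"
    and P: "\<And>x. Q x \<Longrightarrow> R x \<Longrightarrow> P x"
    unfolding scaling_def eventually_inf by blast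
  from Q obtain N where N: "\<And>x. N \<le> fst x \<Longrightarrow> Q x"
    unfolding eventually_filtercomap eventually_at_top_linorder by blast
  from R obtain \<delta> where "0 < \<delta>" and \<delta>: "\<And>x. dist (case x of (n, j) \<Rightarrow> real j / real n) \<beta> < \<delta> \<Longrightarrow> R x"
    unfolding eventually_filtercomap eventually_nhds_metric by blast
  show thesis
    using that[of \<delta> N] \<open>0 < \<delta>\<close> P N \<delta> by (force simp: dist_real_def)
qed

text \<open>\<open>W n\<close> is the law of the number of flipped coordinates; given this number,
  the flip set is uniform. The total mass is 1 only eventually, because in small dimensions a
  prescribed sphere radius can exceed \<open>n\<close>. Concentration is stated through the filter:
  the radii at which an eventually true property fails carry vanishing mass.\<close>

locale radial_noise =
  fixes W :: "nat \<Rightarrow> nat \<Rightarrow> real" and \<beta> :: real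
  assumes \<beta>: "0 < \<beta>" "\<beta> \<le> 1 / 2"
    and W_nonneg: "0 \<le> W n j"
    and W_sum: "\<forall>\<^sub>F n in sequentially. (\<Sum>j\<le>n. W n j) = 1"
    and W_conc: "eventually P (scaling \<beta>) \<Longrightarrow>
      (\<lambda>n. \<Sum>j\<in>{j. j \<le> n \<and> \<not> P (n, j)}. W n j) \<longlonglongrightarrow> 0"
begin

definition kern :: "nat \<Rightarrow> nat set \<Rightarrow> real" where
  "kern n J = W n (card J) / real (n choose card J)"

definition parity :: "nat \<Rightarrow> real" where
  "parity n = (\<Sum>j\<le>n. W n j * (- 1) ^ j)"

lemma kern_nonneg: "0 \<le> kern n J"
  by (simp add: kern_def W_nonneg)

lemma sum_kern:
  "(\<Sum>J\<in>Pow {..<n}. kern n J * h J)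
    = (\<Sum>j\<le>n. W n j * ((\<Sum>J\<in>Pow {..<n}. of_bool (card J = j) * h J) / real (n choose j)))"
proof -
  have "(\<Sum>j\<le>n. W n j * ((\<Sum>J\<in>Pow {..<n}. of_bool (card J = j) * h J) / real (n choose j)))
      = (\<Sum>J\<in>Pow {..<n}. \<Sum>j\<le>n. W n j * (of_bool (card J = j) * h J / real (n choose j)))"
    unfolding sum_divide_distrib sum_distrib_left by (rule sum.swap)
  also have "\<dots> = (\<Sum>J\<in>Pow {..<n}. \<Sum>j\<le>n. if j = card J then kern n J * h J else 0)"
    by (intro sum.cong refl) (auto simp: kern_def)
  also have "\<dots> = (\<Sum>J\<in>Pow {..<n}. kern n J * h J)"
  proof (intro sum.cong refl)
    fix J assume "J \<in> Pow {..<n}"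
    then have "card J \<le> n" using card_mono[of "{..<n}" J] by simp
    then show "(\<Sum>j\<le>n. if j = card J then kern n J * h J else 0) = kern n J * h J" by simp
  qed
  finally show ?thesis by simp
qed

text \<open>Radii close to \<open>\<beta> * n\<close> contribute at most \<epsilon>, and the others
  at most \<open>C\<close> times a vanishing mass. The quantifier over \<open>a\<close> stands
  inside the eventuality because \<open>a\<close> will depend on the character \<open>S\<close>, and
  one dimension threshold has to serve all of them.\<close>

lemma sum_W_le:
  assumes P: "eventually P (scaling \<beta>)" and \<epsilon>: "0 < \<epsilon>" and C: "0 \<le> C"
  shows "\<forall>\<^sub>F n in sequentially. \<forall>a. (\<forall>j\<le>n. \<bar>a j\<bar> \<le> C) \<and> (\<forall>j\<le>n. P (n, j) \<longrightarrow> \<bar>a j\<bar> \<le> \<epsilon>) \<longrightarrow>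
     \<bar>\<Sum>j\<le>n. W n j * a j\<bar> \<le> 2 * \<epsilon>"
proof -
  \<comment> \<open>The denominator is \<open>C + 1\<close> because \<open>C = 0\<close> is
    allowed.\<close>
  have "\<forall>\<^sub>F n in sequentially. (\<Sum>j\<in>{j. j \<le> n \<and> \<not> P (n, j)}. W n j) < \<epsilon> / (C + 1)"
    using order_tendstoD(2)[OF W_conc[OF P]] \<epsilon> C by simp
  with W_sum show ?thesis
  proof eventually_elim
    case (elim n)
    let ?B = "{j. j \<le> n \<and> \<not> P (n, j)}"
    have "\<bar>\<Sum>j\<le>n. W n j * a j\<bar> \<le> 2 * \<epsilon>"
      if a: "\<forall>j\<le>n. \<bar>a j\<bar> \<le> C" "\<forall>j\<le>n. P (n, j) \<longrightarrow> \<bar>a j\<bar> \<le> \<epsilon>" for a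
    proof -
      have "\<bar>\<Sum>j\<le>n. W n j * a j\<bar> \<le> (\<Sum>j\<le>n. W n j * \<bar>a j\<bar>)"
        by (rule order_trans[OF sum_abs]) (simp add: abs_mult W_nonneg)
      also have "\<dots> \<le> (\<Sum>j\<le>n. \<epsilon> * W n j + C * (if j \<in> ?B then W n j else 0))"
      proof (rule sum_mono)
        fix j assume j: "j \<in> {..n}"
        show "W n j * \<bar>a j\<bar> \<le> \<epsilon> * W n j + C * (if j \<in> ?B then W n j else 0)"
        proof (cases "P (n, j)")
          case True
          then have "\<bar>a j\<bar> * W n j \<le> \<epsilon> * W n j"
            using a(2) j by (intro mult_right_mono W_nonneg) auto
          then show ?thesis using True by (simp add: mult.commute)
        next
          case False
          have "\<bar>a j\<bar> * W n j \<le> C * W n j"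
            using a(1) j by (intro mult_right_mono W_nonneg) auto
          moreover have "0 \<le> \<epsilon> * W n j" using \<epsilon> W_nonneg by simp
          ultimately show ?thesis using False j by (simp add: mult.commute)
        qed
      qed
      also have "\<dots> = \<epsilon> * (\<Sum>j\<le>n. W n j) + C * (\<Sum>j\<le>n. if j \<in> ?B then W n j else 0)"
        by (simp only: sum.distrib sum_distrib_left)
      also have "(\<Sum>j\<le>n. if j \<in> ?B then W n j else 0) = (\<Sum>j\<in>?B. W n j)"
        by (intro sum.mono_neutral_cong_right) auto
      also have "C * (\<Sum>j\<in>?B. W n j) \<le> (C + 1) * (\<epsilon> / (C + 1))"
        using elim C by (intro mult_mono) (auto intro: sum_nonneg W_nonneg)
      finally show ?thesis using elim C by simp
    qed
    then show ?case by blast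
  qed
qed

lemma tendsto_sum_W:
  assumes g: "(g \<longlongrightarrow> L) (scaling \<beta>)" and C: "\<forall>\<^sub>F n in sequentially. \<forall>j\<le>n. \<bar>g (n, j)\<bar> \<le> C"
  shows "(\<lambda>n. \<Sum>j\<le>n. W n j * g (n, j)) \<longlonglongrightarrow> L"
proof (rule tendstoI)
  fix e :: real assume "0 < e"
  then have e: "0 < e / 3" by simp
  have "\<forall>\<^sub>F x in scaling \<beta>. \<bar>g x - L\<bar> < e / 3"
    using tendstoD[OF g e] by (simp add: dist_real_def)
  from sum_W_le[OF this e, of "\<bar>C\<bar> + \<bar>L\<bar>", simplified] C W_sum
  show "\<forall>\<^sub>F n in sequentially. dist (\<Sum>j\<le>n. W n j * g (n, j)) L < e"
  proof eventually_elim
    case (elim n)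
    have "\<bar>\<Sum>j\<le>n. W n j * (g (n, j) - L)\<bar> \<le> 2 * (e / 3)"
      using elim(1)[rule_format, of "\<lambda>j. g (n, j) - L"] elim(2) by fastforce
    moreover have "(\<Sum>j\<le>n. W n j * (g (n, j) - L)) = (\<Sum>j\<le>n. W n j * g (n, j)) - L"
      using elim(3) by (simp add: right_diff_distrib sum_subtractf sum_distrib_right[symmetric])
    ultimately show ?case using \<open>0 < e\<close> by (simp add: dist_real_def)
  qed
qed

text \<open>For small \<open>S\<close> the first power is the right size, for large \<open>S\<close>
  the second. Both are added and the parity is cut off at 0 so that every summand is nonnegative and
  a single bound is valid for all \<open>S\<close>.\<close>

lemma kern_eigenvalue_le:
  assumes "0 < \<epsilon>"
  shows "\<forall>\<^sub>F n in sequentially. \<forall>S. S \<subseteq> {..<n} \<longrightarrow> (\<Sum>J\<in>Pow {..<n}. kern n J * chi S J)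
     \<le> (1 - 2 * \<beta>) ^ card S + max 0 (parity n) * (1 - 2 * \<beta>) ^ card ({..<n} - S) + \<epsilon>"
proof -
  let ?\<rho> = "1 - 2 * \<beta>"
  have \<epsilon>: "0 < \<epsilon> / 2" using assms by simp
  from sum_W_le[OF ksum_sphere_uniform[OF \<beta> \<epsilon>] \<epsilon>, of 2, simplified] W_sum
  show ?thesis
  proof eventually_elim
    case (elim n)
    define \<kappa> where "\<kappa> = (\<lambda>S j. ksum {..<n} S (\<lambda>i. of_bool (i = j)) / real (n choose j))"
    have eig: "(\<Sum>J\<in>Pow {..<n}. kern n J * chi S J) = (\<Sum>j\<le>n. W n j * \<kappa> S j)" for S
      by (simp only: sum_kern \<kappa>_def ksum_def)
    have \<kappa>1: "\<bar>\<kappa> S j\<bar> \<le> 1" for S j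
      using ksum_sphere_abs_le[of "{..<n}" S j] by (simp add: \<kappa>_def divide_le_eq_1 linorder_le_less_linear)
    have \<rho>1: "0 \<le> ?\<rho> ^ k \<and> ?\<rho> ^ k \<le> 1" for k :: nat
      using \<beta> by (auto intro: power_le_one)
    have d2: "\<bar>\<kappa> S j - ?\<rho> ^ k\<bar> \<le> 2" for S j and k :: nat
      using \<kappa>1[of S j] \<rho>1[of k] by linarith
    \<comment> \<open>The signs \<open>s\<close> let one estimate serve both cases: they are
      constantly 1 for small \<open>S\<close> and \<open>(- 1) ^ j\<close> when \<open>S\<close> is
      replaced by its complement.\<close>
    have main: "\<bar>\<Sum>j\<le>n. W n j * (s j * (\<kappa> S j - ?\<rho> ^ card S))\<bar> \<le> \<epsilon>"
      if S: "S \<subseteq> {..<n}" "2 * card S \<le> n" and s: "\<And>j. \<bar>s j\<bar> = 1" for S s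
      using elim(1)[rule_format, of "\<lambda>j. s j * (\<kappa> S j - ?\<rho> ^ card S)"] S s d2
      by (simp add: abs_mult \<kappa>_def)
    have "(\<Sum>j\<le>n. W n j * \<kappa> S j) \<le> ?\<rho> ^ card S + max 0 (parity n) * ?\<rho> ^ card ({..<n} - S) + \<epsilon>"
      if S: "S \<subseteq> {..<n}" for S
    proof (cases "2 * card S \<le> n")
      case True
      have "(\<Sum>j\<le>n. W n j * (1 * (\<kappa> S j - ?\<rho> ^ card S))) = (\<Sum>j\<le>n. W n j * \<kappa> S j) - ?\<rho> ^ card S"
        using elim(2) by (simp add: right_diff_distrib sum_subtractf sum_distrib_right[symmetric])
      with main[OF S True, of "\<lambda>_. 1"] have "(\<Sum>j\<le>n. W n j * \<kappa> S j) \<le> ?\<rho> ^ card S + \<epsilon>" by simp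
      moreover have "0 \<le> max 0 (parity n) * ?\<rho> ^ card ({..<n} - S)"
        using \<rho>1 by (intro mult_nonneg_nonneg) auto
      ultimately show ?thesis by linarith
    next
      case False
      define S' where "S' = {..<n} - S"
      have S': "S' \<subseteq> {..<n}" "S = {..<n} - S'" using S by (auto simp: S'_def)
      have "card S' = n - card S"
        using S by (simp add: S'_def card_Diff_subset finite_subset)
      then have "2 * card S' \<le> n" using False by simp
      have \<kappa>': "\<kappa> S j = (- 1) ^ j * \<kappa> S' j" for j
      proof -
        have "ksum {..<n} S (\<lambda>i. of_bool (i = j)) = ksum {..<n} S' (\<lambda>i. (- 1) ^ i * of_bool (i = j))"
          unfolding S'(2) by (rule ksum_complement) (use S' in auto)
        also have "\<dots> = (- 1) ^ j * ksum {..<n} S' (\<lambda>i. of_bool (i = j))"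
          unfolding ksum_def sum_distrib_left by (intro sum.cong refl) auto
        finally show ?thesis by (simp add: \<kappa>_def)
      qed
      have "(\<Sum>j\<le>n. W n j * ((- 1) ^ j * (\<kappa> S' j - ?\<rho> ^ card S')))
          = (\<Sum>j\<le>n. W n j * \<kappa> S j) - parity n * ?\<rho> ^ card S'"
        by (simp add: \<kappa>' parity_def right_diff_distrib sum_subtractf sum_distrib_right mult.assoc)
      with main[OF S'(1) \<open>2 * card S' \<le> n\<close>, of "\<lambda>j. (- 1) ^ j"]
      have "(\<Sum>j\<le>n. W n j * \<kappa> S j) \<le> parity n * ?\<rho> ^ card S' + \<epsilon>" by (simp add: power_abs)
      moreover have "parity n * ?\<rho> ^ card S' \<le> max 0 (parity n) * ?\<rho> ^ card S'"
        using \<rho>1 by (intro mult_right_mono) auto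
      ultimately show ?thesis using \<rho>1[of "card S"] by (simp add: S'_def)
    qed
    then show ?case by (simp add: eig)
  qed
qed

text \<open>The eigenvalue error is weighted by squared Fourier coefficients, whose sum is the
  measure of \<open>A\<close> and so at most 1. Hence the same \<epsilon> works for all
  sets.\<close>

lemma stab_kern_le:
  assumes "0 < \<epsilon>"
  shows "\<forall>\<^sub>F n in sequentially. \<forall>A. A \<subseteq> Pow {..<n} \<longrightarrow> stab {..<n} (kern n) (ind A) (ind A)
    \<le> (1 + max 0 (parity n)) * stab {..<n} (bern \<beta> {..<n}) (ind A) (ind A) + \<epsilon>"
  using kern_eigenvalue_le[OF assms]
proof eventually_elim
  case (elim n)
  have "stab {..<n} (kern n) (ind A) (ind A)
      \<le> (1 + max 0 (parity n)) * stab {..<n} (bern \<beta> {..<n}) (ind A) (ind A) + \<epsilon>"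
    if "A \<subseteq> Pow {..<n}" for A
  proof -
    have "stab {..<n} (kern n) (ind A) (ind A)
      \<le> (1 + max 0 (parity n)) * stab {..<n} (bern \<beta> {..<n}) (ind A) (ind A)
        + \<epsilon> * ((\<Sum>X\<in>Pow {..<n}. (ind A X)\<^sup>2) / 2 ^ card {..<n})"
      using \<beta> elim by (intro stab_bern_le) (auto simp: ind_def)
    also have "(\<Sum>X\<in>Pow {..<n}. (ind A X)\<^sup>2) \<le> (\<Sum>X\<in>Pow {..<n}. 1)"
      by (intro sum_mono) (simp add: ind_def)
    then have "\<epsilon> * ((\<Sum>X\<in>Pow {..<n}. (ind A X)\<^sup>2) / 2 ^ card {..<n}) \<le> \<epsilon> * 1"
      using assms by (intro mult_left_mono) (auto simp: card_Pow)
    finally show ?thesis by simp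
  qed
  then show ?case by blast
qed

text \<open>Given its size, the flip set has a hypergeometric trace on the window, with the
  quotients of binomials as probabilities. They are bounded by 1, so their limit passes through the
  average over sizes.\<close>

lemma tendsto_kern_trace:
  assumes A: "A \<subseteq> {..<m}"
  shows "(\<lambda>n. \<Sum>J\<in>Pow {..<n}. kern n J * of_bool (J \<inter> {..<m} = A)) \<longlonglongrightarrow> bern \<beta> {..<m} A"
proof -
  define g where "g = (\<lambda>(n, j). (\<Sum>J\<in>Pow {..<n}. of_bool (card J = j) * of_bool (J \<inter> {..<m} = A)) / real (n choose j))"
  have fin: "finite A" using A finite_subset by blast
  have cA: "card A \<le> m" using card_mono[OF _ A] by simp
  have "((\<lambda>(n, j). real ((n - (card A + (m - card A))) choose (j - card A)) / real (n choose j))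
     \<longlongrightarrow> \<beta> ^ card A * (1 - \<beta>) ^ (m - card A)) (scaling \<beta>)"
    using \<beta> by (intro tendsto_binomial_shift_scaling) auto
  moreover have "\<beta> ^ card A * (1 - \<beta>) ^ (m - card A) = bern \<beta> {..<m} A"
    using A fin by (simp add: bern_def card_Diff_subset)
  moreover have "\<forall>\<^sub>F x in scaling \<beta>.
      (case x of (n, j) \<Rightarrow> real ((n - (card A + (m - card A))) choose (j - card A)) / real (n choose j)) = g x"
    using eventually_scaling_ge[of m] eventually_scaling_snd_ge[OF \<beta>(1), of "card A"]
  proof eventually_elim
    case (elim x)
    obtain n j where x: "x = (n, j)" by fastforce
    have "(\<Sum>J\<in>Pow {..<n}. of_bool (card J = j) * of_bool (J \<inter> {..<m} = A)) = real ((n - m) choose (j - card A))"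
      using sum_Pow_card_trace[of "{..<n}" "{..<m}" A j] elim A by (simp add: x)
    then show ?case using cA by (simp add: x g_def)
  qed
  ultimately have "(g \<longlongrightarrow> bern \<beta> {..<m} A) (scaling \<beta>)"
    using Lim_transform_eventually by fastforce
  moreover have "\<bar>g (n, j)\<bar> \<le> 1" for n j
  proof -
    have "(\<Sum>J\<in>Pow {..<n}. of_bool (card J = j) * of_bool (J \<inter> {..<m} = A)) \<le> (\<Sum>J\<in>Pow {..<n}. of_bool (card J = j) :: real)"
      by (intro sum_mono) auto
    also have "\<dots> = real (n choose j)" using sum_Pow_card[of "{..<n}" j] by (simp only: finite_lessThan card_lessThan)
    finally show ?thesis by (simp add: g_def divide_le_eq_1 linorder_le_less_linear sum_nonneg abs_of_nonneg)
  qed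
  ultimately have "(\<lambda>n. \<Sum>j\<le>n. W n j * g (n, j)) \<longlonglongrightarrow> bern \<beta> {..<m} A"
    by (intro tendsto_sum_W[where C = 1]) auto
  then show ?thesis by (simp only: sum_kern g_def case_prod_conv)
qed

end

section \<open>Functions of a fixed window of coordinates\<close>

lemma sum_trace:
  assumes "finite U" "V \<subseteq> U"
  shows "(\<Sum>X\<in>Pow U. k X * h (X \<inter> V)) = (\<Sum>A\<in>Pow V. (\<Sum>X\<in>Pow U. k X * of_bool (X \<inter> V = A)) * (h A :: real))"
proof -
  have "finite V" using assms finite_subset by blast
  have "(\<Sum>A\<in>Pow V. (\<Sum>X\<in>Pow U. k X * of_bool (X \<inter> V = A)) * h A)
      = (\<Sum>X\<in>Pow U. \<Sum>A\<in>Pow V. if A = X \<inter> V then k X * h A else 0)"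
    unfolding sum_distrib_right by (subst sum.swap) (intro sum.cong refl, auto)
  also have "\<dots> = (\<Sum>X\<in>Pow U. k X * h (X \<inter> V))"
    using \<open>finite V\<close> by (intro sum.cong refl) (simp add: sum.delta)
  finally show ?thesis by simp
qed

text \<open>The weight \<open>e\<close> on the starting point is required only to have a uniform
  trace on \<open>V\<close>, up to the factor \<open>c\<close>. This covers the constant weight as
  well as the restriction to even sets.\<close>

lemma stab_trace:
  fixes e k :: "'a set \<Rightarrow> real"
  assumes "finite U" "V \<subseteq> U"
    and e: "\<And>h :: 'a set \<Rightarrow> real. (\<Sum>X\<in>Pow U. e X * h (X \<inter> V)) = c * (\<Sum>X\<in>Pow V. h X)"
  shows "(\<Sum>X\<in>Pow U. \<Sum>J\<in>Pow U. e X * (k J * f (X \<inter> V) * f (sym_diff X J \<inter> V)))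
    = c * (\<Sum>A\<in>Pow V. (\<Sum>J\<in>Pow U. k J * of_bool (J \<inter> V = A)) * (\<Sum>X\<in>Pow V. f X * f (sym_diff X A)))"
proof -
  have d: "sym_diff X J \<inter> V = sym_diff (X \<inter> V) (J \<inter> V)" for X J by auto
  have "(\<Sum>X\<in>Pow U. \<Sum>J\<in>Pow U. e X * (k J * f (X \<inter> V) * f (sym_diff X J \<inter> V)))
      = (\<Sum>X\<in>Pow U. e X * (\<Sum>J\<in>Pow U. k J * f (X \<inter> V) * f (sym_diff (X \<inter> V) (J \<inter> V))))"
    unfolding d sum_distrib_left ..
  also have "\<dots> = c * (\<Sum>X\<in>Pow V. \<Sum>J\<in>Pow U. k J * f X * f (sym_diff X (J \<inter> V)))"
    by (rule e)
  also have "(\<Sum>X\<in>Pow V. \<Sum>J\<in>Pow U. k J * f X * f (sym_diff X (J \<inter> V)))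
      = (\<Sum>J\<in>Pow U. k J * (\<Sum>X\<in>Pow V. f X * f (sym_diff X (J \<inter> V))))"
    unfolding sum_distrib_left mult.assoc by (rule sum.swap)
  also have "\<dots> = (\<Sum>A\<in>Pow V. (\<Sum>J\<in>Pow U. k J * of_bool (J \<inter> V = A)) * (\<Sum>X\<in>Pow V. f X * f (sym_diff X A)))"
    by (rule sum_trace[OF assms(1,2)])
  finally show ?thesis .
qed

lemma sum_Pow_trace_const:
  fixes h :: "'a set \<Rightarrow> real"
  assumes "finite U" "V \<subseteq> U"
  shows "(\<Sum>X\<in>Pow U. h (X \<inter> V)) = 2 ^ card (U - V) * (\<Sum>X\<in>Pow V. h X)"
proof -
  have fin: "finite V" "finite (U - V)" using assms finite_subset by auto
  have "(\<Sum>X\<in>Pow U. h (X \<inter> V)) = (\<Sum>X\<in>Pow V. \<Sum>Y\<in>Pow (U - V). h ((X \<union> Y) \<inter> V))"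
    using sum_Pow_Un[OF fin, of "\<lambda>X. h (X \<inter> V)"] assms(2) by (simp add: Un_absorb1)
  also have "\<dots> = (\<Sum>X\<in>Pow V. \<Sum>Y\<in>Pow (U - V). h X)"
  proof (intro sum.cong refl)
    fix X Y assume "X \<in> Pow V" "Y \<in> Pow (U - V)"
    then have "(X \<union> Y) \<inter> V = X" by auto
    then show "h ((X \<union> Y) \<inter> V) = h X" by simp
  qed
  also have "\<dots> = 2 ^ card (U - V) * (\<Sum>X\<in>Pow V. h X)"
    using fin by (simp add: card_Pow sum_distrib_left)
  finally show ?thesis .
qed

text \<open>Toggling a point outside \<open>V\<close> flips the sign and leaves the trace alone; the
  strict inclusion provides such a point.\<close>

lemma sum_Pow_trace_sign:
  fixes h :: "'a set \<Rightarrow> real"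
  assumes "finite U" "V \<subset> U"
  shows "(\<Sum>X\<in>Pow U. (- 1) ^ card X * h (X \<inter> V)) = 0"
proof -
  obtain u where u: "u \<in> U" "u \<notin> V" using assms by auto
  define U' where "U' = U - {u}"
  have U': "U = insert u U'" "u \<notin> U'" "finite U'" using u assms by (auto simp: U'_def)
  have "(\<Sum>X\<in>Pow U. (- 1) ^ card X * h (X \<inter> V))
      = (\<Sum>X\<in>Pow U'. (- 1) ^ card X * h (X \<inter> V) + (- 1) ^ card (insert u X) * h (insert u X \<inter> V))"
    unfolding U'(1) by (rule sum_Pow_insert[OF U'(3,2)])
  also have "\<dots> = 0"
  proof (intro sum.neutral ballI)
    fix X assume "X \<in> Pow U'"
    then have "finite X" "u \<notin> X" using U' finite_subset by auto
    then show "(- 1) ^ card X * h (X \<inter> V) + (- 1) ^ card (insert u X) * h (insert u X \<inter> V) = 0"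
      using u(2) by simp
  qed
  finally show ?thesis .
qed

text \<open>The indicator of even size is the mean of 1 and the sign, and the sign part vanishes:
  parity is independent of a proper window.\<close>

lemma sum_Pow_trace_even:
  fixes h :: "'a set \<Rightarrow> real"
  assumes "finite U" "V \<subset> U"
  shows "(\<Sum>X\<in>Pow U. of_bool (even (card X)) * h (X \<inter> V)) = 2 ^ card (U - V) / 2 * (\<Sum>X\<in>Pow V. h X)"
proof -
  have "(\<Sum>X\<in>Pow U. of_bool (even (card X)) * h (X \<inter> V))
      = (\<Sum>X\<in>Pow U. (h (X \<inter> V) + (- 1) ^ card X * h (X \<inter> V)) / 2)"
    by (intro sum.cong refl) (simp add: of_bool_def)
  also have "\<dots> = ((\<Sum>X\<in>Pow U. h (X \<inter> V)) + (\<Sum>X\<in>Pow U. (- 1) ^ card X * h (X \<inter> V))) / 2"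
    unfolding sum_divide_distrib[symmetric] sum.distrib ..
  finally show ?thesis
    using sum_Pow_trace_sign[OF assms, of h] sum_Pow_trace_const[OF assms(1), of V h] assms(2) by auto
qed

lemma even_card_sym_diff:
  assumes "finite U" "X \<subseteq> U" "J \<subseteq> U" "even (card J)"
  shows "even (card (sym_diff X J)) \<longleftrightarrow> even (card X)"
proof -
  have "sym_diff X J \<subseteq> U" using assms by auto
  then have "(- 1 :: real) ^ card (sym_diff X J) = (- 1) ^ card X"
    using chi_sym_diff[of U X J] chi_superset[OF assms(1)] assms by simp
  then show ?thesis by (metis neg_one_even_power neg_one_odd_power one_neq_neg_one)
qed

context radial_noise begin

lemma tendsto_trace_sum:
  "(\<lambda>n. (\<Sum>A\<in>Pow {..<m}. (\<Sum>J\<in>Pow {..<n}. kern n J * of_bool (J \<inter> {..<m} = A))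
      * (\<Sum>X\<in>Pow {..<m}. f X * f (sym_diff X A))) / 2 ^ m)
    \<longlonglongrightarrow> stab {..<m} (bern \<beta> {..<m}) f f"
proof -
  have "(\<lambda>n. (\<Sum>A\<in>Pow {..<m}. (\<Sum>J\<in>Pow {..<n}. kern n J * of_bool (J \<inter> {..<m} = A))
      * (\<Sum>X\<in>Pow {..<m}. f X * f (sym_diff X A))) / 2 ^ m)
    \<longlonglongrightarrow> (\<Sum>A\<in>Pow {..<m}. bern \<beta> {..<m} A * (\<Sum>X\<in>Pow {..<m}. f X * f (sym_diff X A))) / 2 ^ m"
    by (intro tendsto_intros tendsto_kern_trace) auto
  also have "(\<Sum>A\<in>Pow {..<m}. bern \<beta> {..<m} A * (\<Sum>X\<in>Pow {..<m}. f X * f (sym_diff X A))) / 2 ^ m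
      = stab {..<m} (bern \<beta> {..<m}) f f"
    unfolding stab_def sum_distrib_left mult.assoc by (subst sum.swap) simp
  finally show ?thesis .
qed

lemma tendsto_stab_lift:
  "(\<lambda>n. stab {..<n} (kern n) (\<lambda>X. f (X \<inter> {..<m})) (\<lambda>X. f (X \<inter> {..<m})))
    \<longlonglongrightarrow> stab {..<m} (bern \<beta> {..<m}) f f"
proof (rule Lim_transform_eventually[OF tendsto_trace_sum], rule eventually_sequentiallyI)
  fix n assume "m \<le> n"
  then have sub: "{..<m} \<subseteq> {..<n}" by auto
  have e: "(\<Sum>X\<in>Pow {..<n}. 1 * h (X \<inter> {..<m})) = 2 ^ (n - m) * (\<Sum>X\<in>Pow {..<m}. h X)" for h :: "nat set \<Rightarrow> real"
    using sum_Pow_trace_const[OF _ sub, of h] sub by (simp add: card_Diff_subset)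
  have "(2 :: real) ^ n = 2 ^ (n - m) * 2 ^ m" using \<open>m \<le> n\<close> by (simp add: power_add[symmetric])
  then show "(\<Sum>A\<in>Pow {..<m}. (\<Sum>J\<in>Pow {..<n}. kern n J * of_bool (J \<inter> {..<m} = A))
      * (\<Sum>X\<in>Pow {..<m}. f X * f (sym_diff X A))) / 2 ^ m
    = stab {..<n} (kern n) (\<lambda>X. f (X \<inter> {..<m})) (\<lambda>X. f (X \<inter> {..<m}))"
    using stab_trace[OF _ sub e, of "kern n" f] by (simp add: stab_def)
qed

text \<open>Flip sets that carry weight have even size and preserve parity, so an even start implies
  an even end. Only the parity factor of the starting point remains, and it halves the sum.\<close>

lemma tendsto_stab_lift_even:
  assumes "\<And>n j. odd j \<Longrightarrow> W n j = 0"
  shows "(\<lambda>n. stab {..<n} (kern n) (\<lambda>X. of_bool (even (card X)) * f (X \<inter> {..<m}))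
      (\<lambda>X. of_bool (even (card X)) * f (X \<inter> {..<m})))
    \<longlonglongrightarrow> stab {..<m} (bern \<beta> {..<m}) f f / 2"
proof (rule Lim_transform_eventually[OF tendsto_divide[OF tendsto_trace_sum tendsto_const]], simp,
    rule eventually_sequentiallyI)
  \<comment> \<open>One coordinate beyond the window is needed for the parity to be independent of
    it.\<close>
  fix n assume n: "Suc m \<le> n"
  then have sub: "{..<m} \<subset> {..<n}" by auto
  then have sub': "{..<m} \<subseteq> {..<n}" by auto
  let ?e = "\<lambda>X :: nat set. of_bool (even (card X)) :: real"
  have e: "(\<Sum>X\<in>Pow {..<n}. ?e X * h (X \<inter> {..<m})) = 2 ^ (n - m) / 2 * (\<Sum>X\<in>Pow {..<m}. h X)" for h :: "nat set \<Rightarrow> real"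
    using sum_Pow_trace_even[OF _ sub, of h] sub' by (simp add: card_Diff_subset)
  have "(\<Sum>X\<in>Pow {..<n}. \<Sum>J\<in>Pow {..<n}. kern n J * (?e X * f (X \<inter> {..<m})) * (?e (sym_diff X J) * f (sym_diff X J \<inter> {..<m})))
      = (\<Sum>X\<in>Pow {..<n}. \<Sum>J\<in>Pow {..<n}. ?e X * (kern n J * f (X \<inter> {..<m}) * f (sym_diff X J \<inter> {..<m})))"
  proof (intro sum.cong refl)
    fix X J assume XJ: "X \<in> Pow {..<n}" "J \<in> Pow {..<n}"
    show "kern n J * (?e X * f (X \<inter> {..<m})) * (?e (sym_diff X J) * f (sym_diff X J \<inter> {..<m}))
      = ?e X * (kern n J * f (X \<inter> {..<m}) * f (sym_diff X J \<inter> {..<m}))"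
    proof (cases "even (card J)")
      case True
      then show ?thesis using even_card_sym_diff[of "{..<n}" X J] XJ by auto
    next
      case False
      then show ?thesis using assms by (simp add: kern_def)
    qed
  qed
  then have "stab {..<n} (kern n) (\<lambda>X. ?e X * f (X \<inter> {..<m})) (\<lambda>X. ?e X * f (X \<inter> {..<m}))
      = 2 ^ (n - m) / 2 * (\<Sum>A\<in>Pow {..<m}. (\<Sum>J\<in>Pow {..<n}. kern n J * of_bool (J \<inter> {..<m} = A))
      * (\<Sum>X\<in>Pow {..<m}. f X * f (sym_diff X A))) / 2 ^ n"
    using stab_trace[OF _ sub' e, of "kern n" f] by (simp only: stab_def finite_lessThan card_lessThan)
  moreover have "(2 :: real) ^ n = 2 ^ (n - m) * 2 ^ m" using n by (simp add: power_add[symmetric])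
  ultimately show "(\<Sum>A\<in>Pow {..<m}. (\<Sum>J\<in>Pow {..<n}. kern n J * of_bool (J \<inter> {..<m} = A))
      * (\<Sum>X\<in>Pow {..<m}. f X * f (sym_diff X A))) / 2 ^ m / 2
    = stab {..<n} (kern n) (\<lambda>X. ?e X * f (X \<inter> {..<m})) (\<lambda>X. ?e X * f (X \<inter> {..<m}))"
    by simp
qed

end

section \<open>Spheres and balls as radial noise\<close>

lemma sphere_radial_noise:
  assumes \<beta>: "0 < \<beta>" "\<beta> \<le> 1 / 2" and r: "(\<lambda>n. real (r n) / real n) \<longlonglongrightarrow> \<beta>"
  shows "radial_noise (\<lambda>n j. of_bool (j = r n)) \<beta>"
proof
  have lim: "filterlim (\<lambda>n. (n, r n)) (scaling \<beta>) sequentially"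
    using r by (simp add: filterlim_scaling_iff filterlim_ident)
  have "\<forall>\<^sub>F n in sequentially. r n < n"
    using eventually_compose_filterlim[OF eventually_scaling_snd_less lim] \<beta> by simp
  then show "\<forall>\<^sub>F n in sequentially. (\<Sum>j\<le>n. of_bool (j = r n)) = (1 :: real)"
    by eventually_elim (simp add: of_bool_def)
  show "(\<lambda>n. \<Sum>j\<in>{j. j \<le> n \<and> \<not> P (n, j)}. of_bool (j = r n) :: real) \<longlonglongrightarrow> 0" if "eventually P (scaling \<beta>)" for P
  proof (rule tendsto_eventually)
    show "\<forall>\<^sub>F n in sequentially. (\<Sum>j\<in>{j. j \<le> n \<and> \<not> P (n, j)}. of_bool (j = r n) :: real) = 0"
      using eventually_compose_filterlim[OF that lim]
      by eventually_elim (auto intro!: sum.neutral)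
  qed
qed (use \<beta> in auto)

definition ball_size :: "nat \<Rightarrow> nat \<Rightarrow> real" where
  "ball_size n r = (\<Sum>i\<le>r. real (n choose i))"

lemma ball_size_pos: "0 < ball_size n r"
proof -
  have "real (n choose 0) \<le> ball_size n r"
    unfolding ball_size_def by (rule member_le_sum) auto
  then show ?thesis by simp
qed

lemma ball_size_mono: "r \<le> s \<Longrightarrow> ball_size n r \<le> ball_size n s"
  unfolding ball_size_def by (intro sum_mono2) auto

text \<open>The quotient of consecutive binomials is \<open>(n - i) / (i + 1)\<close>, which is at
  least \<open>1 + \<eta>\<close> over the whole range of radii; every added layer therefore
  multiplies the volume by this factor.\<close>

lemma ball_size_growth:
  assumes "0 \<le> \<eta>" "(2 + \<eta>) * real (s + t) \<le> real n"
  shows "(1 + \<eta>) ^ t * ball_size n s \<le> ball_size n (s + t)"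
  using assms(2)
proof (induction t)
  case (Suc t)
  have i: "(1 + \<eta>) * real (n choose i) \<le> real (n choose Suc i)" if "i \<le> s + t" for i
  proof -
    have "(2 + \<eta>) * real (Suc i) \<le> (2 + \<eta>) * real (s + Suc t)"
      using that assms(1) by (intro mult_left_mono) auto
    then have "(1 + \<eta>) * real (Suc i) + real i \<le> real n" using Suc.prems by (simp add: algebra_simps)
    moreover have "0 \<le> (1 + \<eta>) * real (Suc i)" using assms(1) by simp
    ultimately have le: "(1 + \<eta>) * real (Suc i) \<le> real (n - i)" by linarith
    have "Suc i * (n choose Suc i) = (n - i) * (n choose i)"
      using binomial_absorption[of i n] binomial_absorb_comp[of n i] by simp
    then have "real (Suc i) * real (n choose Suc i) = real (n - i) * real (n choose i)"
      by (metis of_nat_mult)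
    also have "\<dots> \<ge> (1 + \<eta>) * real (Suc i) * real (n choose i)"
      using le by (intro mult_right_mono) auto
    finally have "real (Suc i) * ((1 + \<eta>) * real (n choose i)) \<le> real (Suc i) * real (n choose Suc i)"
      by (simp only: mult_ac)
    then show ?thesis by (rule mult_left_le_imp_le) simp
  qed
  have "(1 + \<eta>) ^ Suc t * ball_size n s \<le> (1 + \<eta>) * ball_size n (s + t)"
  proof -
    have "(1 + \<eta>) ^ t * ball_size n s \<le> ball_size n (s + t)"
      using Suc.prems assms(1) by (intro Suc.IH) (simp add: algebra_simps)
    then have "(1 + \<eta>) * ((1 + \<eta>) ^ t * ball_size n s) \<le> (1 + \<eta>) * ball_size n (s + t)"
      using assms(1) by (intro mult_left_mono) auto
    then show ?thesis by (simp add: mult.assoc)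
  qed
  also have "\<dots> \<le> (\<Sum>i\<le>s + t. real (n choose Suc i))"
    unfolding ball_size_def sum_distrib_left using i by (intro sum_mono) auto
  also have "\<dots> \<le> ball_size n (s + Suc t)"
    unfolding ball_size_def by (simp add: sum.atMost_Suc_shift del: sum.atMost_Suc)
  finally show ?case .
qed simp

text \<open>A ball of radius near \<open>\<beta> * n\<close> has almost all its points near its
  boundary. Even at \<beta> = 1/2, where the layers stop growing at the boundary, those between
  \<open>(\<beta> - \<delta>) * n\<close> and \<open>(\<beta> - \<delta> / 2) * n\<close> still grow
  geometrically.\<close>

lemma ball_radial_noise:
  assumes \<beta>: "0 < \<beta>" "\<beta> \<le> 1 / 2" and r: "(\<lambda>n. real (r n) / real n) \<longlonglongrightarrow> \<beta>"
  shows "radial_noise (\<lambda>n j. of_bool (j \<le> r n) * real (n choose j) / ball_size n (r n)) \<beta>"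
    (is "radial_noise ?W \<beta>")
proof
  have lim: "filterlim (\<lambda>n. (n, r n)) (scaling \<beta>) sequentially"
    using r by (simp add: filterlim_scaling_iff filterlim_ident)
  show nonneg: "0 \<le> ?W n j" for n j
    using ball_size_pos[of n "r n"] by simp
  have "\<forall>\<^sub>F n in sequentially. r n < n"
    using eventually_compose_filterlim[OF eventually_scaling_snd_less lim] \<beta> by simp
  then show "\<forall>\<^sub>F n in sequentially. (\<Sum>j\<le>n. ?W n j) = 1"
  proof eventually_elim
    case (elim n)
    then have "(\<Sum>j\<le>n. of_bool (j \<le> r n) * real (n choose j)) = ball_size n (r n)"
      unfolding ball_size_def by (intro sum.mono_neutral_cong_right) auto
    then show ?case
      using ball_size_pos[of n "r n"] by (simp only: sum_divide_distrib[symmetric]) simp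
  qed
  show "(\<lambda>n. \<Sum>j\<in>{j. j \<le> n \<and> \<not> P (n, j)}. ?W n j) \<longlonglongrightarrow> 0" if P: "eventually P (scaling \<beta>)" for P
  proof (rule tendstoI)
    fix e :: real assume e: "0 < e"
    obtain \<delta>' N where \<delta>': "0 < \<delta>'" and N: "\<And>n j. N \<le> n \<Longrightarrow> \<bar>real j / real n - \<beta>\<bar> < \<delta>' \<Longrightarrow> P (n, j)"
      using eventually_scalingD[OF P] by blast
    \<comment> \<open>The cap \<open>\<beta> / 2\<close> keeps
      \<open>(\<beta> - \<delta>) * n\<close> nonnegative, so that the floor below can be taken as a
      natural number.\<close>
    define \<delta> where "\<delta> = min \<delta>' (\<beta> / 2)"
    have \<delta>: "0 < \<delta>" "\<delta> \<le> \<delta>'" "\<delta> < \<beta>" using \<delta>' \<beta> by (auto simp: \<delta>_def)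
    \<comment> \<open>A fixed number of layers is enough, since the inner ball only has to become a
      fraction \<open>e\<close> of the whole.\<close>
    obtain t where t: "1 / e < (1 + \<delta>) ^ t"
      using real_arch_pow[of "1 + \<delta>" "1 / e"] \<delta> by auto
    have "\<forall>\<^sub>F n in sequentially. real (r n) / real n < \<beta> + \<delta>"
      using \<delta> by (intro order_tendstoD(2)[OF r]) auto
    moreover have "\<forall>\<^sub>F n in sequentially. \<beta> - \<delta> / 2 < real (r n) / real n"
      using \<delta> by (intro order_tendstoD(1)[OF r]) auto
    moreover have "\<forall>\<^sub>F n in sequentially. max N (Suc (nat \<lceil>2 * real t / \<delta>\<rceil>)) \<le> n"
      by (rule eventually_ge_at_top)
    ultimately show "\<forall>\<^sub>F n in sequentially. dist (\<Sum>j\<in>{j. j \<le> n \<and> \<not> P (n, j)}. ?W n j) 0 < e"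
    proof eventually_elim
      case (elim n)
      have n: "N \<le> n" "0 < real n" "2 * real t / \<delta> \<le> real n" using elim(3) by linarith+
      have tn: "real t \<le> \<delta> / 2 * real n" using n(3) \<delta> by (simp add: field_simps)
      define s where "s = nat \<lfloor>(\<beta> - \<delta>) * real n\<rfloor>"
      have s: "real s \<le> (\<beta> - \<delta>) * real n" using \<delta> n unfolding s_def by simp
      have st: "real (s + t) \<le> (\<beta> - \<delta> / 2) * real n" using s tn by (simp add: algebra_simps)
      also have "\<dots> < real (r n)" using elim(2) n by (simp add: field_simps)
      finally have "s + t \<le> r n" by simp
      \<comment> \<open>This verifies the growth condition up to radius \<open>s + t\<close>. The
        margin \<open>\<delta> / 2\<close> below 1/2 is what admits the growth factor
        \<open>1 + \<delta>\<close>.\<close>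
      have "(2 + \<delta>) * real (s + t) \<le> (2 + \<delta>) * ((\<beta> - \<delta> / 2) * real n)"
        using st \<delta> by (intro mult_left_mono) auto
      also have "\<dots> \<le> (2 + \<delta>) * ((1 / 2 - \<delta> / 2) * real n)"
        using \<beta> \<delta> n by (intro mult_left_mono mult_right_mono) auto
      also have "\<dots> = (1 - \<delta> / 2 - \<delta> * \<delta> / 2) * real n" by (simp add: field_simps)
      also have "\<dots> \<le> 1 * real n"
      proof (rule mult_right_mono)
        have "0 \<le> \<delta> * \<delta>" by simp
        then show "1 - \<delta> / 2 - \<delta> * \<delta> / 2 \<le> 1" using \<delta>(1) by linarith
      qed simp
      finally have "(1 + \<delta>) ^ t * ball_size n s \<le> ball_size n (s + t)"
        using \<delta> by (intro ball_size_growth) auto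
      also have "\<dots> \<le> ball_size n (r n)" using \<open>s + t \<le> r n\<close> by (rule ball_size_mono)
      finally have grow: "(1 + \<delta>) ^ t * ball_size n s \<le> ball_size n (r n)" .
      have "(\<Sum>j\<in>{j. j \<le> n \<and> \<not> P (n, j)}. of_bool (j \<le> r n) * real (n choose j)) \<le> ball_size n s"
      proof -
        have "j \<le> s" if j: "j \<le> r n" "\<not> P (n, j)" for j
        proof (rule ccontr)
          assume "\<not> j \<le> s"
          then have "(\<beta> - \<delta>) * real n < real j" unfolding s_def by linarith
          then have "\<beta> - \<delta> < real j / real n" using n by (simp add: field_simps)
          moreover have "real j / real n \<le> real (r n) / real n" using j by (simp add: divide_right_mono)
          ultimately have "\<bar>real j / real n - \<beta>\<bar> < \<delta>'" using elim(1) \<delta> by linarith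
          with N[OF n(1)] j show False by blast
        qed
        then have "(\<Sum>j\<in>{j. j \<le> n \<and> \<not> P (n, j)}. of_bool (j \<le> r n) * real (n choose j))
            = (\<Sum>j\<in>{j. j \<le> n \<and> \<not> P (n, j) \<and> j \<le> r n}. real (n choose j))"
          by (intro sum.mono_neutral_cong_right) auto
        also have "\<dots> \<le> (\<Sum>j\<le>s. real (n choose j))"
          using \<open>\<And>j. j \<le> r n \<Longrightarrow> \<not> P (n, j) \<Longrightarrow> j \<le> s\<close> by (intro sum_mono2) auto
        finally show ?thesis by (simp add: ball_size_def)
      qed
      then have "(\<Sum>j\<in>{j. j \<le> n \<and> \<not> P (n, j)}. ?W n j) \<le> ball_size n s / ball_size n (r n)"
        unfolding sum_divide_distrib[symmetric]
        using ball_size_pos[of n "r n"] by (intro divide_right_mono) auto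
      also have "\<dots> \<le> ball_size n s / ((1 + \<delta>) ^ t * ball_size n s)"
        using grow ball_size_pos[of n s] \<delta>
        by (intro divide_left_mono mult_pos_pos ball_size_pos) auto
      also have "\<dots> = 1 / (1 + \<delta>) ^ t" using ball_size_pos[of n s] by simp
      also have "\<dots> < e" using t e \<delta> by (simp add: field_simps)
      finally show ?case using nonneg by (simp add: sum_nonneg)
    qed
  qed
qed (use \<beta> in auto)

text \<open>
  Both the alternating sum of \<open>n choose j\<close> and the sum of \<open>kraw 1 n j\<close> over \<open>j \<le> r\<close> telescope to
  \<open>(n - 1) choose r\<close>, so the mean parity is up to sign the eigenvalue of a singleton.
\<close>

lemma ball_parity:
  assumes \<beta>: "0 < \<beta>" "\<beta> \<le> 1 / 2" and r: "(\<lambda>n. real (r n) / real n) \<longlonglongrightarrow> \<beta>"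
  defines "W \<equiv> \<lambda>n j. of_bool (j \<le> r n) * real (n choose j) / ball_size n (r n)"
  shows "(\<lambda>n. (- 1) ^ r n * radial_noise.parity W n) \<longlonglongrightarrow> 1 - 2 * \<beta>"
proof -
  interpret radial_noise W \<beta>
    unfolding W_def by (rule ball_radial_noise[OF \<beta> r])
  have b1: "\<beta> < 1" using \<beta> by simp
  have lim: "filterlim (\<lambda>n. (n, r n)) (scaling \<beta>) sequentially"
    using r by (simp add: filterlim_scaling_iff filterlim_ident)
  have ev: "\<forall>\<^sub>F n in sequentially. r n < n"
    using eventually_compose_filterlim[OF eventually_scaling_snd_less[OF b1] lim] by simp
  have bound: "\<bar>kraw 1 n j / real (n choose j)\<bar> \<le> 1" if "1 \<le> n" for n j
    using ksum_sphere_eq_kraw[of "{..<n}" "{0}" 1 j] ksum_sphere_abs_le[of "{..<n}" "{0}" j] that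
    by (simp add: divide_le_eq_1 linorder_le_less_linear)
  have "\<forall>\<^sub>F n in sequentially. \<forall>j\<le>n. \<bar>case (n, j) of (n, j) \<Rightarrow> kraw 1 n j / real (n choose j)\<bar> \<le> 1"
    using eventually_ge_at_top[of 1] by eventually_elim (simp only: case_prod_conv bound simp_thms)
  then have "(\<lambda>n. \<Sum>j\<le>n. W n j * (case (n, j) of (n, j) \<Rightarrow> kraw 1 n j / real (n choose j))) \<longlonglongrightarrow> (1 - 2 * \<beta>) ^ 1"
    by (rule tendsto_sum_W[OF tendsto_kraw_scaling[OF \<beta>(1) b1]])
  moreover have "\<forall>\<^sub>F n in sequentially.
      (\<Sum>j\<le>n. W n j * (case (n, j) of (n, j) \<Rightarrow> kraw 1 n j / real (n choose j))) = (- 1) ^ r n * parity n"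
    using ev
  proof eventually_elim
    case (elim n)
    obtain n' where n': "n = Suc n'" using elim by (cases n) auto
    have alt: "(\<Sum>j\<le>s. (- 1) ^ j * real (n choose j)) = (- 1) ^ s * real (n' choose s)" for s
      by (induction s) (auto simp: n' algebra_simps)
    have tel: "(\<Sum>j\<le>s. kraw 1 n j) = real (n' choose s)" for s
      by (induction s) (auto simp: n')
    have restr: "(\<Sum>j\<le>n. W n j * h j) = (\<Sum>j\<le>r n. real (n choose j) * h j) / ball_size n (r n)" for h
      unfolding W_def sum_divide_distrib using elim by (intro sum.mono_neutral_cong_right) auto
    have "(\<Sum>j\<le>n. W n j * (case (n, j) of (n, j) \<Rightarrow> kraw 1 n j / real (n choose j)))
        = (\<Sum>j\<le>r n. kraw 1 n j) / ball_size n (r n)"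
      unfolding restr using elim by (intro arg_cong2[of _ _ _ _ "(/)"] sum.cong) auto
    also have "\<dots> = (- 1) ^ r n * ((- 1) ^ r n * real (n' choose r n)) / ball_size n (r n)"
      by (simp only: tel mult.assoc[symmetric] power_add[symmetric] mult_2[symmetric] power_mult) simp
    also have "\<dots> = (- 1) ^ r n * parity n"
      unfolding parity_def restr alt[symmetric] by (simp add: mult.commute)
    finally show ?case .
  qed
  ultimately have "(\<lambda>n. (- 1) ^ r n * parity n) \<longlonglongrightarrow> (1 - 2 * \<beta>) ^ 1"
    by (rule Lim_transform_eventually)
  then show ?thesis by simp
qed

section \<open>Gaussian limits\<close>

text \<open>
  The weight \<open>w\<close> turns the one-dimensional continuity theorem into a statement about joint laws:
  applied to \<open>1 + cos (b T)\<close>, \<open>1 + sin (b T)\<close> and then to the indicator of \<open>S > t\<close>, it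
  yields the convergence of quadrant probabilities without a two-dimensional theory.
\<close>

lemma weighted_levy_continuity:
  fixes M :: "nat \<Rightarrow> 'a measure" and w X :: "'a \<Rightarrow> real"
  assumes M: "\<And>n. prob_space (M n)" "\<And>n. sets (M n) = sets K" and N: "prob_space N" "sets N = sets K"
    and w[measurable]: "w \<in> borel_measurable K" and X[measurable]: "X \<in> borel_measurable K"
    and wC: "\<And>x. 0 \<le> w x" "\<And>x. w x \<le> C"
    and lim: "\<And>a. (\<lambda>n. CLINT x|M n. w x * iexp (a * X x)) \<longlonglongrightarrow> (CLINT x|N. w x * iexp (a * X x))"
    and null: "AE x in N. X x \<noteq> t"
  shows "(\<lambda>n. LINT x|M n. w x * indicator {t<..} (X x)) \<longlonglongrightarrow> (LINT x|N. w x * indicator {t<..} (X x))"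
proof -
  \<comment> \<open>\<open>c\<close> is the total weighted mass and \<open>D\<close> the law of
    \<open>X\<close> under the normalised weight, a probability measure to which the one-dimensional
    theorem applies.\<close>
  define c where "c = (\<lambda>\<mu>. LINT x|\<mu>. w x)"
  define D where "D = (\<lambda>\<mu>. distr (density \<mu> (\<lambda>x. ennreal (w x / c \<mu>))) borel X)"
  have int: "integrable \<mu> (\<lambda>x. w x * h x)"
    if "prob_space \<mu>" "sets \<mu> = sets K" "h \<in> borel_measurable K" "\<And>x. \<bar>h x\<bar> \<le> 1" for \<mu> h
  proof -
    interpret prob_space \<mu> by fact
    note [measurable_cong] = that(2)
    note [measurable] = that(3)
    have "\<bar>w x * h x\<bar> \<le> C" for x
      using mult_mono[OF wC(2)[of x] that(4)[of x]] wC(1)[of x] order_trans[OF wC(1)[of x] wC(2)] by (simp add: abs_mult)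
    then show ?thesis by (intro integrable_const_bound[where B = C]) auto
  qed
  have intw: "integrable \<mu> w" if "prob_space \<mu>" "sets \<mu> = sets K" for \<mu>
    using int[OF that, of "\<lambda>_. 1"] by simp
  have cn: "(\<lambda>n. c (M n)) \<longlonglongrightarrow> c N"
  proof -
    have "(CLINT x|\<mu>. w x * iexp (0 * X x)) = complex_of_real (c \<mu>)" for \<mu>
      by (simp add: c_def)
    with lim[of 0] show ?thesis by (simp add: tendsto_of_real_iff)
  qed
  have nonneg: "0 \<le> (LINT x|\<mu>. w x * indicator {t<..} (X x))" for \<mu>
    by (rule Bochner_Integration.integral_nonneg) (simp add: wC)
  have le: "(LINT x|\<mu>. w x * indicator {t<..} (X x)) \<le> c \<mu>" if "prob_space \<mu>" "sets \<mu> = sets K" for \<mu>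
    unfolding c_def
    by (rule integral_mono) (auto intro!: int[OF that] intw[OF that] simp: wC split: split_indicator)
  show ?thesis
  \<comment> \<open>A vanishing limit mass cannot be normalised; in that case both integrals are
    squeezed between 0 and the total mass.\<close>
  proof (cases "c N = 0")
    case True
    have "(LINT x|N. w x * indicator {t<..} (X x)) = 0"
      using nonneg[of N] le[OF N] True by simp
    moreover have "(\<lambda>n. LINT x|M n. w x * indicator {t<..} (X x)) \<longlonglongrightarrow> 0"
      by (rule tendsto_sandwich[OF _ _ tendsto_const cn[unfolded True]]) (auto simp: nonneg le M)
    ultimately show ?thesis by simp
  next
    case False
    have "0 \<le> c N" unfolding c_def by (rule Bochner_Integration.integral_nonneg) (simp add: wC)
    with False have cN: "0 < c N" by simp
    have real: "real_distribution (D \<mu>)"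
      and Dint: "integral\<^sup>L (D \<mu>) g = (LINT x|\<mu>. (w x / c \<mu>) *\<^sub>R g (X x))"
      if \<mu>: "prob_space \<mu>" "sets \<mu> = sets K" "0 < c \<mu>" and g: "g \<in> borel_measurable borel"
      for \<mu> and g :: "real \<Rightarrow> 'c :: {banach, second_countable_topology}"
    proof -
      note [measurable_cong] = \<mu>(2)
      note [measurable] = g
      have "(\<integral>\<^sup>+ x. ennreal (w x / c \<mu>) \<partial>\<mu>) = ennreal (LINT x|\<mu>. w x / c \<mu>)"
        using intw[OF \<mu>(1,2)] \<mu>(3) wC by (intro nn_integral_eq_integral) auto
      also have "\<dots> = 1" using \<mu>(3) by (simp add: c_def)
      finally have "prob_space (density \<mu> (\<lambda>x. ennreal (w x / c \<mu>)))"
        by (intro prob_spaceI) (simp add: emeasure_density cong: nn_integral_cong_simp)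
      then have "prob_space (D \<mu>)"
        unfolding D_def by (intro prob_space.prob_space_distr) auto
      then show "real_distribution (D \<mu>)"
        by (simp add: real_distribution_def real_distribution_axioms_def D_def)
      show "integral\<^sup>L (D \<mu>) g = (LINT x|\<mu>. (w x / c \<mu>) *\<^sub>R g (X x))"
        unfolding D_def using \<mu>(3) wC by (subst integral_distr) (auto simp: integral_density)
    qed
    have Dchar: "char (D \<mu>) a = (CLINT x|\<mu>. w x * iexp (a * X x)) / c \<mu>"
      if "prob_space \<mu>" "sets \<mu> = sets K" "0 < c \<mu>" for \<mu> a
    proof -
      have "(\<lambda>x. iexp (a * x)) \<in> borel_measurable borel" by measurable
      from Dint[OF that this] show ?thesis by (simp add: char_def scaleR_conv_of_real)
    qed
    have Dcdf: "cdf (D \<mu>) s = (LINT x|\<mu>. w x * indicator {..s} (X x)) / c \<mu>"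
      and Dnull: "measure (D \<mu>) {s} = (LINT x|\<mu>. w x * indicator {s} (X x)) / c \<mu>"
      if \<mu>: "prob_space \<mu>" "sets \<mu> = sets K" "0 < c \<mu>" for \<mu> s
    proof -
      interpret D: real_distribution "D \<mu>" using real[OF \<mu>, of "\<lambda>_. 0 :: real"] by simp
      have "measure (D \<mu>) A = (LINT x|\<mu>. w x * indicator A (X x)) / c \<mu>" if "A \<in> sets borel" for A
      proof -
        have "measure (D \<mu>) A = integral\<^sup>L (D \<mu>) (indicator A :: real \<Rightarrow> real)"
          using that by simp
        also have "\<dots> = (LINT x|\<mu>. (w x / c \<mu>) *\<^sub>R indicator A (X x))"
          using that by (intro Dint[OF \<mu>]) simp
        finally show ?thesis by simp
      qed
      then show "cdf (D \<mu>) s = (LINT x|\<mu>. w x * indicator {..s} (X x)) / c \<mu>"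
        "measure (D \<mu>) {s} = (LINT x|\<mu>. w x * indicator {s} (X x)) / c \<mu>"
        by (simp_all add: cdf_def)
    qed
    have ev: "\<forall>\<^sub>F n in sequentially. 0 < c (M n)"
      using order_tendstoD(1)[OF cn cN] .
    \<comment> \<open>Early terms may have mass 0. They are replaced by the limit law so that every
      member of the sequence is a distribution.\<close>
    define E where "E = (\<lambda>n. if 0 < c (M n) then D (M n) else D N)"
    have "weak_conv_m E (D N)"
    proof (rule levy_continuity)
      show rN: "real_distribution (D N)" using real[OF N cN, of "\<lambda>_. 0 :: real"] by simp
      show "real_distribution (E n)" for n
        using rN real[OF M(1) M(2), of n "\<lambda>_. 0 :: real"] by (simp add: E_def)
      fix a
      have "(\<lambda>n. (CLINT x|M n. w x * iexp (a * X x)) / c (M n)) \<longlonglongrightarrow> (CLINT x|N. w x * iexp (a * X x)) / c N"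
        using cN by (intro tendsto_divide lim tendsto_of_real cn) auto
      moreover have "\<forall>\<^sub>F n in sequentially. (CLINT x|M n. w x * iexp (a * X x)) / c (M n) = char (E n) a"
        using ev by eventually_elim (simp add: E_def Dchar[OF M])
      ultimately show "(\<lambda>n. char (E n) a) \<longlonglongrightarrow> char (D N) a"
        unfolding Dchar[OF N cN] by (rule Lim_transform_eventually)
    qed
    moreover have "isCont (cdf (D N)) t"
    proof -
      interpret D: real_distribution "D N" using real[OF N cN, of "\<lambda>_. 0 :: real"] by simp
      have "(LINT x|N. w x * indicator {t} (X x)) = (LINT x|N. 0)"
        using null by (intro integral_cong_AE) (use N in \<open>auto simp: measurable_cong_sets[OF N(2) refl] elim!: eventually_mono\<close>)
      then show ?thesis unfolding D.isCont_cdf Dnull[OF N cN] by simp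
    qed
    ultimately have "(\<lambda>n. cdf (E n) t) \<longlonglongrightarrow> cdf (D N) t"
      by (simp add: weak_conv_m_def weak_conv_def)
    then have lim': "(\<lambda>n. c (M n) - cdf (E n) t * c (M n)) \<longlonglongrightarrow> c N - cdf (D N) t * c N"
      by (intro tendsto_intros cn)
    have compl: "(LINT x|\<mu>. w x * indicator {t<..} (X x)) = c \<mu> - cdf (D \<mu>) t * c \<mu>"
      if \<mu>: "prob_space \<mu>" "sets \<mu> = sets K" "0 < c \<mu>" for \<mu>
    proof -
      note [measurable_cong] = \<mu>(2)
      have "(LINT x|\<mu>. w x * indicator {t<..} (X x)) = (LINT x|\<mu>. w x - w x * indicator {..t} (X x))"
        by (intro Bochner_Integration.integral_cong) (auto split: split_indicator)
      also have "\<dots> = c \<mu> - (LINT x|\<mu>. w x * indicator {..t} (X x))"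
        unfolding c_def
        by (intro Bochner_Integration.integral_diff intw[OF \<mu>(1,2)] int[OF \<mu>(1,2)]) (auto split: split_indicator)
      finally show ?thesis using \<mu>(3) by (simp add: Dcdf[OF \<mu>])
    qed
    have "\<forall>\<^sub>F n in sequentially. c (M n) - cdf (E n) t * c (M n) = (LINT x|M n. w x * indicator {t<..} (X x))"
      using ev by eventually_elim (simp add: E_def compl[OF M])
    with lim' show ?thesis
      unfolding compl[OF N cN] by (rule Lim_transform_eventually)
  qed
qed

text \<open>Weights have to be nonnegative, so cosine and sine are raised by 1. Their weighted
  transforms are combinations of the joint characteristic function at \<open>(a, 0)\<close>,
  \<open>(a, b)\<close> and \<open>(a, - b)\<close>, whose limits are known.\<close>

lemma quadrant_convergence:
  fixes M :: "nat \<Rightarrow> (real \<times> real) measure"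
  assumes M: "\<And>n. prob_space (M n)" "\<And>n. sets (M n) = sets borel" and N: "prob_space N" "sets N = sets borel"
    and lim: "\<And>a b. (\<lambda>n. CLINT z|M n. iexp (a * fst z + b * snd z)) \<longlonglongrightarrow> (CLINT z|N. iexp (a * fst z + b * snd z))"
    and null: "AE z in N. fst z \<noteq> t" "AE z in N. snd z \<noteq> t"
  shows "(\<lambda>n. measure (M n) {z. t < fst z}) \<longlonglongrightarrow> measure N {z. t < fst z}"
    and "(\<lambda>n. measure (M n) {z. t < fst z \<and> t < snd z}) \<longlonglongrightarrow> measure N {z. t < fst z \<and> t < snd z}"
proof -
  define I where "I = (\<lambda>z :: real \<times> real. indicator {t<..} (fst z) :: real)"
  define \<phi> where "\<phi> = (\<lambda>\<mu> a b. CLINT z|\<mu>. iexp (a * fst z + b * snd z))"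
  have fs[measurable]: "fst \<in> borel_measurable (borel :: (real \<times> real) measure)"
    "snd \<in> borel_measurable (borel :: (real \<times> real) measure)"
    by (auto intro!: borel_measurable_continuous_onI continuous_intros)
  have I[measurable]: "I \<in> borel_measurable borel" unfolding I_def by measurable
  have int: "integrable \<mu> h" if "prob_space \<mu>" "sets \<mu> = sets borel" "h \<in> borel_measurable borel" "\<And>z. norm (h z) \<le> 2"
    for \<mu> and h :: "real \<times> real \<Rightarrow> 'c :: {banach, second_countable_topology}"
  proof -
    interpret prob_space \<mu> by fact
    note [measurable_cong] = that(2)
    note [measurable] = that(3)
    show ?thesis using that(4) by (intro integrable_const_bound[where B = 2]) auto
  qed
  have iexp_int: "integrable \<mu> (\<lambda>z. iexp (a * fst z + b * snd z))"
    if "prob_space \<mu>" "sets \<mu> = sets borel" for \<mu> a b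
    by (rule int[OF that]) (auto intro!: borel_measurable_continuous_onI continuous_intros)
  \<comment> \<open>The idle summand \<open>0 * v\<close> gives each term the shape of the joint
    characteristic function.\<close>
  have euler: "complex_of_real (1 + cos v) * iexp u = iexp (u + 0 * v) + (iexp (u + v) + iexp (u - v)) / 2"
    "complex_of_real (1 + sin v) * iexp u = iexp (u + 0 * v) + (iexp (u + v) - iexp (u - v)) / (2 * \<i>)" for u v
  proof -
    have add: "iexp (u + v) = iexp u * iexp v" "iexp (u - v) = iexp u * iexp (- v)"
      by (simp_all add: exp_add[symmetric] algebra_simps)
    have c: "complex_of_real (cos v) = (iexp v + iexp (- v)) / 2"
      and s: "complex_of_real (sin v) = (iexp v - iexp (- v)) / (2 * \<i>)"
      by (simp_all add: cos_of_real[symmetric] cos_exp_eq sin_of_real[symmetric] sin_exp_eq)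
    have c': "complex_of_real (1 + cos v) = 1 + (iexp v + iexp (- v)) / 2"
      and s': "complex_of_real (1 + sin v) = 1 + (iexp v - iexp (- v)) / (2 * \<i>)"
      by (simp_all only: of_real_add of_real_1 c s)
    have alg: "(1 + (P + Q) / 2) * E = E + (E * P + E * Q) / 2"
      "(1 + (P - Q) / (2 * \<i>)) * E = E + (E * P - E * Q) / (2 * \<i>)" for P Q E :: complex
      by (simp_all add: field_simps)
    show "complex_of_real (1 + cos v) * iexp u = iexp (u + 0 * v) + (iexp (u + v) + iexp (u - v)) / 2"
      unfolding c' add mult_zero_left add_0_right by (rule alg)
    show "complex_of_real (1 + sin v) * iexp u = iexp (u + 0 * v) + (iexp (u + v) - iexp (u - v)) / (2 * \<i>)"
      unfolding s' add mult_zero_left add_0_right by (rule alg)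
  qed
  have cos_eq: "(CLINT z|\<mu>. complex_of_real (1 + cos (b * snd z)) * iexp (a * fst z)) = \<phi> \<mu> a 0 + (\<phi> \<mu> a b + \<phi> \<mu> a (- b)) / 2"
    and sin_eq: "(CLINT z|\<mu>. complex_of_real (1 + sin (b * snd z)) * iexp (a * fst z)) = \<phi> \<mu> a 0 + (\<phi> \<mu> a b - \<phi> \<mu> a (- b)) / (2 * \<i>)"
    if \<mu>: "prob_space \<mu>" "sets \<mu> = sets borel" for \<mu> a b
  proof -
    have lin: "(CLINT z|\<mu>. F z + (G z + H z) / 2) = (CLINT z|\<mu>. F z) + ((CLINT z|\<mu>. G z) + (CLINT z|\<mu>. H z)) / 2"
      "(CLINT z|\<mu>. F z + (G z - H z) / (2 * \<i>)) = (CLINT z|\<mu>. F z) + ((CLINT z|\<mu>. G z) - (CLINT z|\<mu>. H z)) / (2 * \<i>)"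
      if "complex_integrable \<mu> F" "complex_integrable \<mu> G" "complex_integrable \<mu> H" for F G H
      using that by simp_all
    have "(CLINT z|\<mu>. complex_of_real (1 + cos (b * snd z)) * iexp (a * fst z))
        = (CLINT z|\<mu>. iexp (a * fst z + 0 * snd z) + (iexp (a * fst z + b * snd z) + iexp (a * fst z + (- b) * snd z)) / 2)"
      by (intro Bochner_Integration.integral_cong refl) (subst euler, simp)
    then show "(CLINT z|\<mu>. complex_of_real (1 + cos (b * snd z)) * iexp (a * fst z)) = \<phi> \<mu> a 0 + (\<phi> \<mu> a b + \<phi> \<mu> a (- b)) / 2"
      unfolding \<phi>_def by (rule trans[OF _ lin(1)[OF iexp_int[OF \<mu>] iexp_int[OF \<mu>] iexp_int[OF \<mu>]]])
    have "(CLINT z|\<mu>. complex_of_real (1 + sin (b * snd z)) * iexp (a * fst z))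
        = (CLINT z|\<mu>. iexp (a * fst z + 0 * snd z) + (iexp (a * fst z + b * snd z) - iexp (a * fst z + (- b) * snd z)) / (2 * \<i>))"
      by (intro Bochner_Integration.integral_cong refl) (subst euler, simp)
    then show "(CLINT z|\<mu>. complex_of_real (1 + sin (b * snd z)) * iexp (a * fst z)) = \<phi> \<mu> a 0 + (\<phi> \<mu> a b - \<phi> \<mu> a (- b)) / (2 * \<i>)"
      unfolding \<phi>_def by (rule trans[OF _ lin(2)[OF iexp_int[OF \<mu>] iexp_int[OF \<mu>] iexp_int[OF \<mu>]]])
  qed
  have lim\<phi>: "(\<lambda>n. \<phi> (M n) a b) \<longlonglongrightarrow> \<phi> N a b" for a b
    unfolding \<phi>_def by (rule lim)
  have c1: "(\<lambda>n. LINT z|M n. (1 + cos (b * snd z)) * indicator {t<..} (fst z))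
      \<longlonglongrightarrow> (LINT z|N. (1 + cos (b * snd z)) * indicator {t<..} (fst z))" for b
  proof (rule weighted_levy_continuity[OF M N _ fs(1) _ _ _ null(1), where C = 2])
    show "(\<lambda>z :: real \<times> real. 1 + cos (b * snd z)) \<in> borel_measurable borel"
      by (intro borel_measurable_continuous_onI continuous_intros)
    show "0 \<le> 1 + cos (b * snd z)" "1 + cos (b * snd z) \<le> 2" for z :: "real \<times> real"
      using cos_ge_minus_one[of "b * snd z"] by linarith+ simp
    show "(\<lambda>n. CLINT z|M n. complex_of_real (1 + cos (b * snd z)) * iexp (a * fst z))
        \<longlonglongrightarrow> (CLINT z|N. complex_of_real (1 + cos (b * snd z)) * iexp (a * fst z))" for a
      unfolding cos_eq[OF M] cos_eq[OF N] by (intro tendsto_intros lim\<phi>) auto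
  qed
  have s1: "(\<lambda>n. LINT z|M n. (1 + sin (b * snd z)) * indicator {t<..} (fst z))
      \<longlonglongrightarrow> (LINT z|N. (1 + sin (b * snd z)) * indicator {t<..} (fst z))" for b
  proof (rule weighted_levy_continuity[OF M N _ fs(1) _ _ _ null(1), where C = 2])
    show "(\<lambda>z :: real \<times> real. 1 + sin (b * snd z)) \<in> borel_measurable borel"
      by (intro borel_measurable_continuous_onI continuous_intros)
    show "0 \<le> 1 + sin (b * snd z)" "1 + sin (b * snd z) \<le> 2" for z :: "real \<times> real"
      using sin_ge_minus_one[of "b * snd z"] by linarith+ simp
    show "(\<lambda>n. CLINT z|M n. complex_of_real (1 + sin (b * snd z)) * iexp (a * fst z))
        \<longlonglongrightarrow> (CLINT z|N. complex_of_real (1 + sin (b * snd z)) * iexp (a * fst z))" for a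
      unfolding sin_eq[OF M] sin_eq[OF N] by (intro tendsto_intros lim\<phi>) auto
  qed
  \<comment> \<open>For \<open>b = 0\<close> the sine weight is constantly 1. Subtracting this case
    removes the added 1 and leaves the real and imaginary parts of the transform of the second
    coordinate under the weight \<open>I\<close>.\<close>
  have I0: "(\<lambda>n. LINT z|M n. I z) \<longlonglongrightarrow> (LINT z|N. I z)"
    using s1[of 0] by (simp add: I_def)
  have split: "(LINT z|\<mu>. (1 + h z) * indicator {t<..} (fst z)) = (LINT z|\<mu>. I z) + (LINT z|\<mu>. h z * I z)"
    and hI: "integrable \<mu> (\<lambda>z. h z * I z)"
    if \<mu>: "prob_space \<mu>" "sets \<mu> = sets borel" and h[measurable]: "h \<in> borel_measurable borel" and "\<And>z. \<bar>h z\<bar> \<le> 1"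
    for \<mu> and h :: "real \<times> real \<Rightarrow> real"
  proof -
    have b: "\<bar>I z\<bar> \<le> 1" for z by (simp add: I_def split: split_indicator)
    have "\<bar>h z * I z\<bar> \<le> 2" for z
      using mult_mono[OF that(4)[of z] b[of z]] by (simp add: abs_mult)
    then show i2: "integrable \<mu> (\<lambda>z. h z * I z)" by (intro int[OF \<mu>]) auto
    have i1: "integrable \<mu> I" by (intro int[OF \<mu>]) (auto simp: I_def split: split_indicator)
    have "(LINT z|\<mu>. (1 + h z) * indicator {t<..} (fst z)) = (LINT z|\<mu>. I z + h z * I z)"
      by (simp add: I_def distrib_right)
    also have "\<dots> = (LINT z|\<mu>. I z) + (LINT z|\<mu>. h z * I z)"
      by (rule Bochner_Integration.integral_add[OF i1 i2])
    finally show "(LINT z|\<mu>. (1 + h z) * indicator {t<..} (fst z)) = (LINT z|\<mu>. I z) + (LINT z|\<mu>. h z * I z)" .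
  qed
  have mc: "(\<lambda>z. cos (b * snd z)) \<in> borel_measurable (borel :: (real \<times> real) measure)"
    "(\<lambda>z. sin (b * snd z)) \<in> borel_measurable (borel :: (real \<times> real) measure)" for b
    by (intro borel_measurable_continuous_onI continuous_intros)+
  have c2: "(\<lambda>n. LINT z|M n. cos (b * snd z) * I z) \<longlonglongrightarrow> (LINT z|N. cos (b * snd z) * I z)" for b
    using tendsto_diff[OF c1[of b] I0] by (simp add: split[OF M mc(1)] split[OF N mc(1)])
  have s2: "(\<lambda>n. LINT z|M n. sin (b * snd z) * I z) \<longlonglongrightarrow> (LINT z|N. sin (b * snd z) * I z)" for b
    using tendsto_diff[OF s1[of b] I0] by (simp add: split[OF M mc(2)] split[OF N mc(2)])
  have eI: "(CLINT z|\<mu>. complex_of_real (I z) * iexp (b * snd z))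
      = complex_of_real (LINT z|\<mu>. cos (b * snd z) * I z) + \<i> * complex_of_real (LINT z|\<mu>. sin (b * snd z) * I z)"
    if \<mu>: "prob_space \<mu>" "sets \<mu> = sets borel" for \<mu> b
  proof -
    have "(CLINT z|\<mu>. complex_of_real (I z) * iexp (b * snd z))
        = (CLINT z|\<mu>. complex_of_real (cos (b * snd z) * I z) + \<i> * complex_of_real (sin (b * snd z) * I z))"
      by (intro Bochner_Integration.integral_cong refl)
         (simp add: exp_Euler cos_of_real[symmetric] sin_of_real[symmetric] algebra_simps)
    also have "\<dots> = complex_of_real (LINT z|\<mu>. cos (b * snd z) * I z) + \<i> * complex_of_real (LINT z|\<mu>. sin (b * snd z) * I z)"
      using hI[OF \<mu> mc(1)] hI[OF \<mu> mc(2)]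
      by (subst Bochner_Integration.integral_add) (auto simp del: of_real_mult intro: integrable_of_real)
    finally show ?thesis .
  qed
  have q: "(\<lambda>n. LINT z|M n. I z * indicator {t<..} (snd z)) \<longlonglongrightarrow> (LINT z|N. I z * indicator {t<..} (snd z))"
  proof (rule weighted_levy_continuity[OF M N I fs(2) _ _ _ null(2), where C = 1])
    show "0 \<le> I z" "I z \<le> 1" for z by (auto simp: I_def split: split_indicator)
    show "(\<lambda>n. CLINT z|M n. complex_of_real (I z) * iexp (a * snd z)) \<longlonglongrightarrow> (CLINT z|N. complex_of_real (I z) * iexp (a * snd z))" for a
      unfolding eI[OF M] eI[OF N] by (intro tendsto_intros c2 s2)
  qed
  have m1: "(LINT z|\<mu>. I z) = measure \<mu> {z. t < fst z}"
    and m2: "(LINT z|\<mu>. I z * indicator {t<..} (snd z)) = measure \<mu> {z. t < fst z \<and> t < snd z}"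
    if \<mu>: "prob_space \<mu>" "sets \<mu> = sets borel" for \<mu>
  proof -
    interpret prob_space \<mu> by fact
    have sp: "space \<mu> = UNIV" using sets_eq_imp_space_eq[OF \<mu>(2)] by simp
    have "(LINT z|\<mu>. I z) = (LINT z|\<mu>. indicator {z. t < fst z} z)"
      by (intro Bochner_Integration.integral_cong) (auto simp: I_def split: split_indicator)
    then show "(LINT z|\<mu>. I z) = measure \<mu> {z. t < fst z}" by (simp add: sp)
    have "(LINT z|\<mu>. I z * indicator {t<..} (snd z)) = (LINT z|\<mu>. indicator {z. t < fst z \<and> t < snd z} z)"
      by (intro Bochner_Integration.integral_cong) (auto simp: I_def split: split_indicator)
    then show "(LINT z|\<mu>. I z * indicator {t<..} (snd z)) = measure \<mu> {z. t < fst z \<and> t < snd z}" by (simp add: sp)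
  qed
  show "(\<lambda>n. measure (M n) {z. t < fst z}) \<longlonglongrightarrow> measure N {z. t < fst z}"
    using I0 by (simp add: m1[OF M] m1[OF N])
  show "(\<lambda>n. measure (M n) {z. t < fst z \<and> t < snd z}) \<longlonglongrightarrow> measure N {z. t < fst z \<and> t < snd z}"
    using q by (simp add: m2[OF M] m2[OF N])
qed

section \<open>Central limit theorem for a pair of correlated walks\<close>

definition walk :: "'a set \<Rightarrow> 'a set \<Rightarrow> real" where
  "walk U X = (\<Sum>i\<in>U. if i \<in> X then - 1 else 1)"

lemma walk_insert:
  assumes "finite U" "u \<notin> U"
  shows "walk (insert u U) X = (if u \<in> X then - 1 else 1) + walk U X"
  using assms by (simp add: walk_def)

lemma walk_insert_arg: "u \<notin> U \<Longrightarrow> walk U (insert u X) = walk U X"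
  unfolding walk_def by (intro sum.cong) auto

text \<open>The characteristic function factorises over coordinates. A coordinate moves both walks
  alike with probability \<open>1 - \<beta>\<close> and oppositely with probability \<beta>; the
  factor 2 appears because the sum over \<open>X\<close> is not normalised.\<close>

lemma walk_char:
  assumes "finite U"
  shows "(\<Sum>X\<in>Pow U. \<Sum>J\<in>Pow U. complex_of_real (bern \<beta> U J) * iexp (x * walk U X + y * walk U (sym_diff X J)))
    = complex_of_real (2 * ((1 - \<beta>) * cos (x + y) + \<beta> * cos (x - y))) ^ card U"
  using assms
proof (induction U rule: finite_induct)
  case empty
  then show ?case by (simp add: walk_def bern_def)
next
  case (insert u U)
  define e where "e = (\<lambda>X J. iexp (x * walk U X + y * walk U (sym_diff X J)))"
  let ?w = "walk (insert u U)"
  let ?t = "\<lambda>X J. complex_of_real (bern \<beta> (insert u U) J) * iexp (x * ?w X + y * ?w (sym_diff X J))"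
  let ?b = "\<lambda>J. complex_of_real (bern \<beta> U J)"
  have iexp_add: "iexp (p + q) = iexp p * iexp q" for p q
    by (simp add: exp_add[symmetric] distrib_left)
  have step: "?t X J + ?t X (insert u J) + (?t (insert u X) J + ?t (insert u X) (insert u J))
      = complex_of_real (2 * ((1 - \<beta>) * cos (x + y) + \<beta> * cos (x - y))) * (?b J * e X J)"
    if XJ: "X \<in> Pow U" "J \<in> Pow U" for X J
  proof -
    have u: "u \<notin> X" "u \<notin> J" using XJ insert.hyps by auto
    have d: "sym_diff (insert u X) J = insert u (sym_diff X J)"
      "sym_diff X (insert u J) = insert u (sym_diff X J)"
      "sym_diff (insert u X) (insert u J) = sym_diff X J" using u by auto
    have w: "?w Z = 1 + walk U Z" "?w (insert u Z) = - 1 + walk U Z" if "u \<notin> Z" for Z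
      using that walk_insert[OF insert.hyps] walk_insert_arg[OF insert.hyps(2)] by auto
    have nin: "u \<notin> sym_diff X J" using u by auto
    have t1: "?t X J = complex_of_real (1 - \<beta>) * iexp (x + y) * (?b J * e X J)"
      unfolding bern_insert[OF insert.hyps XJ(2)] w[OF u(1)] w[OF nin] e_def
      by (simp add: iexp_add[symmetric] algebra_simps exp_add[symmetric])
    have t2: "?t X (insert u J) = complex_of_real \<beta> * iexp (x - y) * (?b J * e X J)"
      unfolding bern_insert[OF insert.hyps XJ(2)] d w[OF u(1)] w[OF nin] e_def
      by (simp add: iexp_add[symmetric] algebra_simps exp_add[symmetric])
    have t3: "?t (insert u X) J = complex_of_real (1 - \<beta>) * iexp (- (x + y)) * (?b J * e X J)"
      unfolding bern_insert[OF insert.hyps XJ(2)] d w[OF u(1)] w[OF nin] e_def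
      by (simp add: iexp_add[symmetric] algebra_simps exp_add[symmetric])
    have t4: "?t (insert u X) (insert u J) = complex_of_real \<beta> * iexp (- (x - y)) * (?b J * e X J)"
      unfolding bern_insert[OF insert.hyps XJ(2)] d w[OF u(1)] w[OF nin] e_def
      by (simp add: iexp_add[symmetric] algebra_simps exp_add[symmetric])
    have cc: "2 * complex_of_real (cos v) = iexp v + iexp (- v)" for v
      by (simp add: cos_of_real[symmetric] cos_exp_eq)
    have "?t X J + ?t X (insert u J) + (?t (insert u X) J + ?t (insert u X) (insert u J))
        = (complex_of_real (1 - \<beta>) * (iexp (x + y) + iexp (- (x + y)))
          + complex_of_real \<beta> * (iexp (x - y) + iexp (- (x - y)))) * (?b J * e X J)"
      unfolding t1 t2 t3 t4 by (simp only: distrib_left distrib_right ac_simps)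
    then show ?thesis
      unfolding cc[symmetric] by (simp only: of_real_mult of_real_add of_real_numeral distrib_left ac_simps)
  qed
  have "(\<Sum>X\<in>Pow (insert u U). \<Sum>J\<in>Pow (insert u U). ?t X J)
      = (\<Sum>X\<in>Pow U. \<Sum>J\<in>Pow U. ?t X J + ?t X (insert u J) + (?t (insert u X) J + ?t (insert u X) (insert u J)))"
    by (simp only: sum_Pow_insert[OF insert.hyps] sum.distrib add_ac)
  also have "\<dots> = (\<Sum>X\<in>Pow U. \<Sum>J\<in>Pow U.
      complex_of_real (2 * ((1 - \<beta>) * cos (x + y) + \<beta> * cos (x - y))) * (?b J * e X J))"
    by (intro sum.cong refl step)
  also have "\<dots> = complex_of_real (2 * ((1 - \<beta>) * cos (x + y) + \<beta> * cos (x - y)))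
      * (\<Sum>X\<in>Pow U. \<Sum>J\<in>Pow U. ?b J * e X J)"
    by (simp only: sum_distrib_left)
  finally show ?case using insert.hyps unfolding e_def insert.IH by simp
qed

text \<open>The half-angle formula turns \<open>cos - 1\<close> into a squared sine, and continuity
  of \<open>sinc\<close> at 0 replaces a Taylor expansion.\<close>

lemma tendsto_mult_cos_minus_one:
  "(\<lambda>n. real n * (cos (c / sqrt (real n)) - 1)) \<longlonglongrightarrow> - (c\<^sup>2 / 2)"
proof -
  have inv: "(\<lambda>n. c / 2 / sqrt (real n)) \<longlonglongrightarrow> 0"
    by (intro tendsto_divide_0[OF tendsto_const] filterlim_at_top_imp_at_infinity
        filterlim_compose[OF sqrt_at_top filterlim_real_sequentially])
  have "(\<lambda>n. - (c\<^sup>2 / 2) * (sinc (c / 2 / sqrt (real n)))\<^sup>2) \<longlonglongrightarrow> - (c\<^sup>2 / 2) * (sinc 0)\<^sup>2"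
    by (intro tendsto_intros isCont_tendsto_compose[OF isCont_sinc inv])
  moreover have "\<forall>\<^sub>F n in sequentially. - (c\<^sup>2 / 2) * (sinc (c / 2 / sqrt (real n)))\<^sup>2
      = real n * (cos (c / sqrt (real n)) - 1)"
    using eventually_gt_at_top[of 0]
  proof eventually_elim
    case (elim n)
    define h where "h = c / 2 / sqrt (real n)"
    have "c / sqrt (real n) = 2 * h" by (simp add: h_def)
    then have "cos (c / sqrt (real n)) - 1 = - 2 * (sin h)\<^sup>2" by (simp add: cos_double_sin)
    also have "(sin h)\<^sup>2 = h\<^sup>2 * (sinc h)\<^sup>2" by (simp add: power_divide)
    finally have "real n * (cos (c / sqrt (real n)) - 1) = - 2 * (real n * h\<^sup>2) * (sinc h)\<^sup>2"
      by (simp only: mult_ac)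
    also have "real n * h\<^sup>2 = c\<^sup>2 / 4" using elim by (simp add: h_def power_divide)
    finally show ?case unfolding h_def[symmetric] by simp
  qed
  ultimately show ?thesis using Lim_transform_eventually by fastforce
qed

text \<open>For numbers of modulus at most 1, powers with exponent \<open>n\<close> differ by at
  most \<open>n\<close> times the difference of the bases. The comparison is with
  \<open>(1 - q / n) ^ n\<close>.\<close>

lemma tendsto_power_exp:
  fixes z :: "nat \<Rightarrow> real"
  assumes z: "\<And>n. \<bar>z n\<bar> \<le> 1" and lim: "(\<lambda>n. real n * (z n - 1)) \<longlonglongrightarrow> - q" and q: "0 \<le> q"
  shows "(\<lambda>n. z n ^ n) \<longlonglongrightarrow> exp (- q)"
proof -
  have "(\<lambda>n. \<bar>real n * (z n - 1) - - q\<bar>) \<longlonglongrightarrow> \<bar>- q - - q\<bar>"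
    by (intro tendsto_intros lim)
  then have lim0: "(\<lambda>n. \<bar>real n * (z n - 1) - - q\<bar>) \<longlonglongrightarrow> 0" by simp
  have "(\<lambda>n. z n ^ n - (1 + - q / real n) ^ n) \<longlonglongrightarrow> 0"
  proof (rule Lim_null_comparison[OF _ lim0])
    show "\<forall>\<^sub>F n in sequentially. norm (z n ^ n - (1 + - q / real n) ^ n) \<le> \<bar>real n * (z n - 1) - - q\<bar>"
      \<comment> \<open>Taking \<open>n\<close> beyond \<open>q\<close> puts
        \<open>1 - q / n\<close> into the unit interval.\<close>
      using eventually_gt_at_top[of "nat \<lceil>q\<rceil>"]
    proof eventually_elim
      case (elim n)
      then have n: "0 < real n" "q \<le> real n" using q by linarith+
      then have "0 \<le> q / real n" "q / real n \<le> 1" using q by auto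
      then have "norm (1 + - q / real n) \<le> 1" by simp
      then have "norm (z n ^ n - (1 + - q / real n) ^ n) \<le> real n * norm (z n - (1 + - q / real n))"
        using z by (intro norm_power_diff) auto
      also have "\<dots> = \<bar>real n * (z n - (1 + - q / real n))\<bar>" by (simp add: abs_mult)
      also have "real n * (z n - (1 + - q / real n)) = real n * (z n - 1) - - q"
        using n by (simp add: field_simps)
      finally show ?case .
    qed
  qed
  from tendsto_add[OF this tendsto_exp_limit_sequentially[of "- q"]] show ?thesis by simp
qed

lemma prob_space_std_normal_pair: "prob_space (std_normal_pair \<rho>)"
  and sets_std_normal_pair: "sets (std_normal_pair \<rho>) = sets borel"
proof -
  interpret N: real_distribution std_normal_distribution by (rule real_dist_normal_dist)
  interpret P: pair_prob_space std_normal_distribution std_normal_distribution ..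
  have "(\<lambda>(u, v). (u, \<rho> * u + sqrt (1 - \<rho>\<^sup>2) * v)) \<in>
      (std_normal_distribution \<Otimes>\<^sub>M std_normal_distribution) \<rightarrow>\<^sub>M (borel \<Otimes>\<^sub>M borel)"
    by measurable
  then show "prob_space (std_normal_pair \<rho>)"
    unfolding std_normal_pair_def by (rule P.prob_space_distr)
  show "sets (std_normal_pair \<rho>) = sets borel"
    by (simp add: std_normal_pair_def borel_prod)
qed

lemma std_normal_pair_marginals:
  assumes "\<bar>\<rho>\<bar> \<le> 1"
  shows "distr (std_normal_pair \<rho>) borel fst = std_normal_distribution"
    and "distr (std_normal_pair \<rho>) borel snd = std_normal_distribution"
proof -
  interpret prob_space "std_normal_pair \<rho>" by (rule prob_space_std_normal_pair)
  note [measurable_cong] = sets_std_normal_pair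
  have m[measurable]: "fst \<in> borel_measurable (borel :: (real \<times> real) measure)"
    "snd \<in> borel_measurable (borel :: (real \<times> real) measure)"
    by (auto intro!: borel_measurable_continuous_onI continuous_intros)
  have r: "real_distribution (distr (std_normal_pair \<rho>) borel f)" if [measurable]: "f \<in> borel_measurable borel" for f
    by (simp add: real_distribution_def real_distribution_axioms_def prob_space_distr)
  have c: "char (distr (std_normal_pair \<rho>) borel f) a = (CLINT z|std_normal_pair \<rho>. iexp (a * f z))"
    if [measurable]: "f \<in> borel_measurable borel" for f a
    unfolding char_def by (subst integral_distr) auto
  have "char (distr (std_normal_pair \<rho>) borel fst) = char std_normal_distribution"
  proof
    fix a
    show "char (distr (std_normal_pair \<rho>) borel fst) a = char std_normal_distribution a"
      using char_std_normal_pair[OF assms, of a 0]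
      by (simp add: c char_std_normal_distribution split_def exp_of_real[symmetric])
  qed
  then show "distr (std_normal_pair \<rho>) borel fst = std_normal_distribution"
    by (intro Levy_uniqueness r real_dist_normal_dist) auto
  have "char (distr (std_normal_pair \<rho>) borel snd) = char std_normal_distribution"
  proof
    fix a
    show "char (distr (std_normal_pair \<rho>) borel snd) a = char std_normal_distribution a"
      using char_std_normal_pair[OF assms, of 0 a]
      by (simp add: c char_std_normal_distribution split_def exp_of_real[symmetric])
  qed
  then show "distr (std_normal_pair \<rho>) borel snd = std_normal_distribution"
    by (intro Levy_uniqueness r real_dist_normal_dist) auto
qed

lemma AE_std_normal_neq: "AE x in std_normal_distribution. x \<noteq> t"
proof -
  have "AE x in lborel. x \<noteq> t" by (rule AE_lborel_singleton)
  then show ?thesis by (subst AE_density) (auto elim: eventually_mono)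
qed

lemma AE_std_normal_pair_neq:
  assumes "\<bar>\<rho>\<bar> \<le> 1"
  shows "AE z in std_normal_pair \<rho>. fst z \<noteq> t" "AE z in std_normal_pair \<rho>. snd z \<noteq> t"
proof -
  note [measurable_cong] = sets_std_normal_pair
  have m[measurable]: "fst \<in> borel_measurable (borel :: (real \<times> real) measure)"
    "snd \<in> borel_measurable (borel :: (real \<times> real) measure)"
    by (auto intro!: borel_measurable_continuous_onI continuous_intros)
  have "AE x in distr (std_normal_pair \<rho>) borel fst. x \<noteq> t" "AE x in distr (std_normal_pair \<rho>) borel snd. x \<noteq> t"
    unfolding std_normal_pair_marginals[OF assms] by (rule AE_std_normal_neq)+
  then show "AE z in std_normal_pair \<rho>. fst z \<noteq> t" "AE z in std_normal_pair \<rho>. snd z \<noteq> t"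
    by (simp_all add: AE_distr_iff)
qed

lemma exists_finite_pmf:
  fixes w :: "'a \<Rightarrow> real"
  assumes "finite A" "\<And>x. x \<in> A \<Longrightarrow> 0 \<le> w x" "(\<Sum>x\<in>A. w x) = 1"
  shows "\<exists>p. set_pmf p \<subseteq> A \<and> (\<forall>x\<in>A. pmf p x = w x)"
proof -
  define v where "v = (\<lambda>x. if x \<in> A then w x else 0)"
  have "(\<integral>\<^sup>+ x. ennreal (v x) \<partial>count_space UNIV) = (\<Sum>x\<in>A. ennreal (v x))"
    using assms(1) by (intro nn_integral_count_space') (auto simp: v_def)
  also have "\<dots> = ennreal (\<Sum>x\<in>A. v x)" using assms(2) by (intro sum_ennreal) (auto simp: v_def)
  also have "(\<Sum>x\<in>A. v x) = 1" using assms(3) by (simp add: v_def)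
  finally have "pmf (embed_pmf v) x = v x" for x
    using assms(2) by (intro pmf_embed_pmf) (auto simp: v_def)
  then show ?thesis
    by (intro exI[of _ "embed_pmf v"]) (auto simp: set_pmf_iff v_def split: if_splits)
qed

text \<open>On subsets of \<open>{..<n}\<close> the walk equals \<open>n - 2 * card X\<close>, so
  these are Hamming balls around the empty set, with the radius placed at the Gaussian
  scale.\<close>

definition threshold_sets :: "nat \<Rightarrow> real \<Rightarrow> nat set set" where
  "threshold_sets n t = {X \<in> Pow {..<n}. t < walk {..<n} X / sqrt (real n)}"

text \<open>Measure and stability of a threshold set are a half-plane and a quadrant probability for
  the two normalised walks, whose joint law converges to the correlated Gaussian pair.\<close>

lemma threshold_sets_limits:
  assumes \<beta>: "0 \<le> \<beta>" "\<beta> \<le> 1" and \<rho>: "\<rho> = 1 - 2 * \<beta>"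
  shows "(\<lambda>n. real (card (threshold_sets n t)) / 2 ^ n) \<longlonglongrightarrow> measure std_normal_distribution {t<..}"
    and "(\<lambda>n. stab {..<n} (bern \<beta> {..<n}) (ind (threshold_sets n t)) (ind (threshold_sets n t)))
      \<longlonglongrightarrow> measure (std_normal_pair \<rho>) {z. t < fst z \<and> t < snd z}"
proof -
  have \<rho>1: "\<bar>\<rho>\<bar> \<le> 1" using \<beta> \<rho> by auto
  let ?A = "\<lambda>n. Pow {..<n} \<times> Pow {..<n :: nat}"
  let ?w = "\<lambda>n. \<lambda>(X, J). bern \<beta> {..<n :: nat} J / 2 ^ n"
  \<comment> \<open>The joint law of a uniform start \<open>X\<close> and an independent flip set
    \<open>J\<close>, made a probability mass function so that integrals become finite sums.\<close>
  have "\<exists>p. set_pmf p \<subseteq> ?A n \<and> (\<forall>x\<in>?A n. pmf p x = ?w n x)" for n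
  proof -
    have "(\<Sum>x\<in>?A n. ?w n x) = (\<Sum>X\<in>Pow {..<n}. \<Sum>J\<in>Pow {..<n}. bern \<beta> {..<n} J / 2 ^ n)"
      by (simp only: sum.cartesian_product)
    also have "\<dots> = 1"
      unfolding sum_divide_distrib[symmetric] sum_bern[OF finite_lessThan] by (simp add: card_Pow)
    finally have sum1: "(\<Sum>x\<in>?A n. ?w n x) = 1" .
    have nonneg: "\<And>x. x \<in> ?A n \<Longrightarrow> 0 \<le> ?w n x" using \<beta> by (auto simp: bern_nonneg)
    show ?thesis by (rule exists_finite_pmf[OF _ nonneg sum1]) simp
  qed
  then obtain p where p: "\<And>n. set_pmf (p n) \<subseteq> ?A n" "\<And>n x. x \<in> ?A n \<Longrightarrow> pmf (p n) x = ?w n x"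
    by metis
  define T where "T = (\<lambda>n (X, J). (walk {..<n} X / sqrt (real n), walk {..<n} (sym_diff X J) / sqrt (real n)))"
  define M where "M = (\<lambda>n. distr (measure_pmf (p n)) borel (T n))"
  have Tm[measurable]: "T n \<in> measurable (measure_pmf (p n)) borel" for n by simp
  have ps: "prob_space (M n)" for n
    unfolding M_def by (intro prob_space.prob_space_distr measure_pmf.prob_space_axioms Tm)
  have sM: "sets (M n) = sets borel" for n by (simp add: M_def)
  have expand: "(LINT x|measure_pmf (p n). h x) = (\<Sum>X\<in>Pow {..<n}. \<Sum>J\<in>Pow {..<n}. (bern \<beta> {..<n} J / 2 ^ n) *\<^sub>R h (X, J))"
    for n and h :: "_ \<Rightarrow> 'c :: {banach, second_countable_topology}"
  proof -
    have "(LINT x|measure_pmf (p n). h x) = (\<Sum>x\<in>?A n. pmf (p n) x *\<^sub>R h x)"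
      using p(1) by (intro integral_measure_pmf) auto
    also have "\<dots> = (\<Sum>x\<in>?A n. ?w n x *\<^sub>R h x)" by (intro sum.cong refl) (simp add: p(2))
    also have "\<dots> = (\<Sum>(X, J)\<in>?A n. (bern \<beta> {..<n} J / 2 ^ n) *\<^sub>R h (X, J))"
      by (intro sum.cong) auto
    finally show ?thesis by (simp only: sum.cartesian_product)
  qed
  have charM: "(CLINT z|M n. iexp (a * fst z + b * snd z))
      = complex_of_real (((1 - \<beta>) * cos ((a + b) / sqrt (real n)) + \<beta> * cos ((a - b) / sqrt (real n))) ^ n)" for n a b
  proof -
    have "(CLINT z|M n. iexp (a * fst z + b * snd z)) = (CLINT x|measure_pmf (p n). iexp (a * fst (T n x) + b * snd (T n x)))"
      unfolding M_def by (rule integral_distr[OF Tm]) (intro borel_measurable_continuous_onI continuous_intros)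
    also have "\<dots> = (\<Sum>X\<in>Pow {..<n}. \<Sum>J\<in>Pow {..<n}. (bern \<beta> {..<n} J / 2 ^ n) *\<^sub>R
        iexp ((a / sqrt (real n)) * walk {..<n} X + (b / sqrt (real n)) * walk {..<n} (sym_diff X J)))"
      unfolding expand by (simp add: T_def)
    also have "\<dots> = (\<Sum>X\<in>Pow {..<n}. \<Sum>J\<in>Pow {..<n}. complex_of_real (bern \<beta> {..<n} J) *
        iexp ((a / sqrt (real n)) * walk {..<n} X + (b / sqrt (real n)) * walk {..<n} (sym_diff X J))) / 2 ^ n"
      unfolding sum_divide_distrib by (simp add: scaleR_conv_of_real)
    also have "\<dots> = complex_of_real (((1 - \<beta>) * cos ((a + b) / sqrt (real n)) + \<beta> * cos ((a - b) / sqrt (real n))) ^ n)"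
    proof -
      have "complex_of_real (2 * v) ^ n / 2 ^ n = complex_of_real (v ^ n)" for v
        by (simp add: power_mult_distrib)
      then show ?thesis
        unfolding walk_char[OF finite_lessThan] card_lessThan
        by (simp only: add_divide_distrib diff_divide_distrib)
    qed
    finally show ?thesis .
  qed
  have lim: "(\<lambda>n. CLINT z|M n. iexp (a * fst z + b * snd z)) \<longlonglongrightarrow> (CLINT z|std_normal_pair \<rho>. iexp (a * fst z + b * snd z))" for a b
  proof -
    \<comment> \<open>Half the limiting variance of \<open>a * Z1 + b * Z2\<close>; the cross term
      is \<open>(1 - 2 * \<beta>) * a * b\<close>, which identifies the correlation as
      \<rho>.\<close>
    define q where "q = (1 - \<beta>) * ((a + b)\<^sup>2 / 2) + \<beta> * ((a - b)\<^sup>2 / 2)"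
    have "(\<lambda>n. ((1 - \<beta>) * cos ((a + b) / sqrt (real n)) + \<beta> * cos ((a - b) / sqrt (real n))) ^ n) \<longlonglongrightarrow> exp (- q)"
    proof (rule tendsto_power_exp)
      fix n
      have "\<bar>(1 - \<beta>) * cos ((a + b) / sqrt (real n))\<bar> \<le> (1 - \<beta>) * 1"
        unfolding abs_mult using \<beta> by (intro mult_mono) auto
      moreover have "\<bar>\<beta> * cos ((a - b) / sqrt (real n))\<bar> \<le> \<beta> * 1"
        unfolding abs_mult using \<beta> by (intro mult_mono) auto
      ultimately have "\<bar>(1 - \<beta>) * cos ((a + b) / sqrt (real n)) + \<beta> * cos ((a - b) / sqrt (real n))\<bar>
          \<le> (1 - \<beta>) * 1 + \<beta> * 1"
        by (intro order_trans[OF abs_triangle_ineq] add_mono)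
      then show "\<bar>(1 - \<beta>) * cos ((a + b) / sqrt (real n)) + \<beta> * cos ((a - b) / sqrt (real n))\<bar> \<le> 1"
        by simp
    next
      have "(\<lambda>n. (1 - \<beta>) * (real n * (cos ((a + b) / sqrt (real n)) - 1)) + \<beta> * (real n * (cos ((a - b) / sqrt (real n)) - 1)))
          \<longlonglongrightarrow> (1 - \<beta>) * - ((a + b)\<^sup>2 / 2) + \<beta> * - ((a - b)\<^sup>2 / 2)"
        by (intro tendsto_intros tendsto_mult_cos_minus_one)
      then show "(\<lambda>n. real n * ((1 - \<beta>) * cos ((a + b) / sqrt (real n)) + \<beta> * cos ((a - b) / sqrt (real n)) - 1)) \<longlonglongrightarrow> - q"
        by (simp add: q_def algebra_simps)
      show "0 \<le> q" using \<beta> by (simp add: q_def)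
    qed
    moreover have "q = (a\<^sup>2 + 2 * \<rho> * a * b + b\<^sup>2) / 2"
      unfolding q_def \<rho> by (simp add: power2_eq_square field_simps)
    moreover have "(CLINT z|std_normal_pair \<rho>. iexp (a * fst z + b * snd z)) = complex_of_real (exp (- ((a\<^sup>2 + 2 * \<rho> * a * b + b\<^sup>2) / 2)))"
      using char_std_normal_pair[OF \<rho>1, of a b] by (simp only: split_def exp_of_real[symmetric] of_real_minus)
    ultimately show ?thesis unfolding charM by (simp only: tendsto_of_real_iff)
  qed
  note q = quadrant_convergence[OF ps sM prob_space_std_normal_pair sets_std_normal_pair lim AE_std_normal_pair_neq[OF \<rho>1], of t]
  have mM: "measure (M n) {z. P z} = (\<Sum>X\<in>Pow {..<n}. \<Sum>J\<in>Pow {..<n}. (bern \<beta> {..<n} J / 2 ^ n) * of_bool (P (T n (X, J))))"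
    if P: "{z. P z} \<in> sets borel" for n P
  proof -
    have "measure (M n) {z. P z} = measure (measure_pmf (p n)) (T n -` {z. P z})"
      unfolding M_def using P by (subst measure_distr) auto
    also have "\<dots> = (LINT x|measure_pmf (p n). indicator (T n -` {z. P z}) x)" by simp
    also have "\<dots> = (LINT x|measure_pmf (p n). of_bool (P (T n x)))"
      by (intro Bochner_Integration.integral_cong) (auto split: split_indicator)
    also have "\<dots> = (\<Sum>X\<in>Pow {..<n}. \<Sum>J\<in>Pow {..<n}. (bern \<beta> {..<n} J / 2 ^ n) *\<^sub>R of_bool (P (T n (X, J))))"
      by (rule expand)
    finally show ?thesis by (simp only: real_scaleR_def)
  qed
  have op: "open {z :: real \<times> real. t < fst z}" "open {z :: real \<times> real. t < fst z \<and> t < snd z}"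
    by (intro open_Collect_less open_Collect_conj continuous_intros)+
  have "measure (M n) {z. t < fst z} = real (card (threshold_sets n t)) / 2 ^ n" for n
  proof -
    have "measure (M n) {z. t < fst z}
        = (\<Sum>X\<in>Pow {..<n}. of_bool (t < walk {..<n} X / sqrt (real n)) * (\<Sum>J\<in>Pow {..<n}. bern \<beta> {..<n} J) / 2 ^ n)"
      unfolding mM[OF borel_open[OF op(1)]] sum_distrib_left sum_divide_distrib
      by (intro sum.cong refl) (simp add: T_def mult.commute)
    also have "\<dots> = (\<Sum>X\<in>Pow {..<n}. of_bool (t < walk {..<n} X / sqrt (real n))) / 2 ^ n"
      unfolding sum_bern[OF finite_lessThan] sum_divide_distrib by simp
    also have "(\<Sum>X\<in>Pow {..<n}. of_bool (t < walk {..<n} X / sqrt (real n))) = (\<Sum>X\<in>threshold_sets n t. 1 :: real)"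
      by (intro sum.mono_neutral_cong_right) (auto simp: threshold_sets_def)
    finally show ?thesis by simp
  qed
  moreover have "measure (std_normal_pair \<rho>) {z. t < fst z} = measure std_normal_distribution {t<..}"
  proof -
    note [measurable_cong] = sets_std_normal_pair
    have "fst \<in> borel_measurable (std_normal_pair \<rho>)"
      by (subst measurable_cong_sets[OF sets_std_normal_pair refl])
         (auto intro!: borel_measurable_continuous_onI continuous_intros)
    moreover have "space (std_normal_pair \<rho>) = UNIV"
      using sets_eq_imp_space_eq[OF sets_std_normal_pair] by simp
    moreover have "fst -` {t<..} = {z :: real \<times> real. t < fst z}" by auto
    ultimately show ?thesis
      unfolding std_normal_pair_marginals(1)[OF \<rho>1, symmetric] by (subst measure_distr) auto
  qed
  ultimately show "(\<lambda>n. real (card (threshold_sets n t)) / 2 ^ n) \<longlonglongrightarrow> measure std_normal_distribution {t<..}"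
    using q(1) by simp
  have "measure (M n) {z. t < fst z \<and> t < snd z}
      = stab {..<n} (bern \<beta> {..<n}) (ind (threshold_sets n t)) (ind (threshold_sets n t))" for n
    unfolding mM[OF borel_open[OF op(2)]] stab_def sum_divide_distrib
  proof (intro sum.cong refl)
    fix X J assume XJ: "X \<in> Pow {..<n}" "J \<in> Pow {..<n}"
    then have "sym_diff X J \<in> Pow {..<n}" by auto
    then show "(bern \<beta> {..<n} J / 2 ^ n) * of_bool (t < fst (T n (X, J)) \<and> t < snd (T n (X, J)))
        = bern \<beta> {..<n} J * ind (threshold_sets n t) X * ind (threshold_sets n t) (sym_diff X J) / 2 ^ card {..<n}"
      using XJ by (auto simp: T_def ind_def threshold_sets_def)
  qed
  then show "(\<lambda>n. stab {..<n} (bern \<beta> {..<n}) (ind (threshold_sets n t)) (ind (threshold_sets n t)))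
      \<longlonglongrightarrow> measure (std_normal_pair \<rho>) {z. t < fst z \<and> t < snd z}"
    using q(2) by simp
qed

definition iid_sup :: "real \<Rightarrow> real \<Rightarrow> real" where
  "iid_sup \<beta> a = Sup {stab {..<m} (bern \<beta> {..<m}) (ind A) (ind A) | m A.
     A \<subseteq> Pow {..<m} \<and> real (card A) \<le> a * 2 ^ m}"

lemma iid_sup_upper:
  assumes \<beta>: "0 \<le> \<beta>" "\<beta> \<le> 1 / 2" and A: "A \<subseteq> Pow {..<m}" "real (card A) \<le> a * 2 ^ m"
  shows "stab {..<m} (bern \<beta> {..<m}) (ind A) (ind A) \<le> iid_sup \<beta> a"
  unfolding iid_sup_def
proof (rule cSup_upper)
  show "bdd_above {stab {..<m} (bern \<beta> {..<m}) (ind A) (ind A) | m A.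
     A \<subseteq> Pow {..<m} \<and> real (card A) \<le> a * 2 ^ m}"
    by (intro bdd_aboveI[of _ "a powr (1 / (1 - \<beta>))"]) (auto intro!: stab_bern_ind_le \<beta>)
qed (use A in auto)

lemma iid_sup_set_nonempty:
  assumes "0 \<le> a"
  shows "{stab {..<m} (bern \<beta> {..<m}) (ind A) (ind A) | m A.
     A \<subseteq> Pow {..<m} \<and> real (card A) \<le> a * 2 ^ m} \<noteq> {}"
proof -
  have "{} \<subseteq> Pow {..<0 :: nat}" "real (card ({} :: nat set set)) \<le> a * 2 ^ 0" using assms by auto
  then show ?thesis by blast
qed

lemma iid_sup_le:
  assumes \<beta>: "0 \<le> \<beta>" "\<beta> \<le> 1 / 2" and "0 \<le> a"
  shows "iid_sup \<beta> a \<le> a powr (1 / (1 - \<beta>))"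
  unfolding iid_sup_def
  by (rule cSup_least[OF iid_sup_set_nonempty[OF assms(3)]]) (auto intro!: stab_bern_ind_le \<beta>)

lemma iid_sup_nonneg:
  assumes \<beta>: "0 \<le> \<beta>" "\<beta> \<le> 1 / 2" and "0 \<le> a"
  shows "0 \<le> iid_sup \<beta> a"
  using iid_sup_upper[OF \<beta>, of "{}" 0 a] assms(3) by (simp add: stab_def ind_def)

lemma iid_sup_approx:
  assumes "0 \<le> a" "0 < \<epsilon>"
  obtains m A where "A \<subseteq> Pow {..<m}" "real (card A) \<le> a * 2 ^ m"
    "iid_sup \<beta> a - \<epsilon> < stab {..<m} (bern \<beta> {..<m}) (ind A) (ind A)"
proof -
  have "iid_sup \<beta> a - \<epsilon> < iid_sup \<beta> a" using assms by simp
  then show thesis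
    using less_cSupE[OF _ iid_sup_set_nonempty[OF assms(1), of \<beta>], of "iid_sup \<beta> a - \<epsilon>"] that
    unfolding iid_sup_def by blast
qed

text \<open>A single point of the \<open>k\<close>-dimensional cube, in higher dimensions a subcube
  of codimension \<open>k\<close>: each coordinate must start correctly, with probability 1/2, and
  stay unflipped, with probability \<open>1 - \<beta>\<close>.\<close>

lemma subcube_le_iid_sup:
  assumes \<beta>: "0 \<le> \<beta>" "\<beta> \<le> 1 / 2"
  shows "((1 - \<beta>) / 2) ^ k \<le> iid_sup \<beta> (1 / 2 ^ k)"
proof -
  have *: "bern \<beta> {..<k} J * ind {{}} X * ind {{}} (sym_diff X J)
      = (if J = {} then if X = {} then (1 - \<beta>) ^ k else 0 else 0)" for X J
    by (auto simp: ind_def bern_def)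
  have "stab {..<k} (bern \<beta> {..<k}) (ind {{}}) (ind {{}}) = ((1 - \<beta>) / 2) ^ k"
    unfolding stab_def * by (simp add: sum.delta power_divide)
  moreover have "stab {..<k} (bern \<beta> {..<k}) (ind {{}}) (ind {{}}) \<le> iid_sup \<beta> (1 / 2 ^ k)"
    using \<beta> by (intro iid_sup_upper) auto
  ultimately show ?thesis by simp
qed

section \<open>Gaussian tails and thresholds\<close>

lemma normal_tail_strict_antimono:
  assumes "s < t"
  shows "measure std_normal_distribution {t<..} < measure std_normal_distribution {s<..}"
proof -
  interpret N: real_distribution std_normal_distribution by (rule real_dist_normal_dist)
  have "measure std_normal_distribution {s<..t} \<noteq> 0"
  proof
    assume "measure std_normal_distribution {s<..t} = 0"
    then have "{s<..t} \<in> null_sets std_normal_distribution"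
      by (intro null_setsI) (auto simp: N.emeasure_eq_measure)
    then have "AE x in lborel. x \<in> {s<..t} \<longrightarrow> ennreal (normal_density 0 1 x) = 0"
      by (subst (asm) null_sets_density_iff) auto
    then have "AE x in lborel. x \<notin> {s<..t}"
    proof eventually_elim
      case (elim x)
      have "0 < std_normal_density x" by (rule normal_density_pos) simp
      then show ?case using elim by (auto simp: ennreal_eq_0_iff)
    qed
    then have "emeasure lborel {s<..t} = 0"
      using AE_iff_measurable[of "{s<..t}" lborel "\<lambda>x. x \<notin> {s<..t}"]
      by (simp add: greaterThanAtMost_def greaterThan_def atMost_def Int_def)
    then show False using assms by simp
  qed
  then have "0 < measure std_normal_distribution {s<..t}" by (simp add: zero_less_measure_iff)
  moreover have "measure std_normal_distribution {s<..} = measure std_normal_distribution ({s<..t} \<union> {t<..})"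
    using assms by (intro arg_cong2[of _ _ _ _ measure]) auto
  moreover have "measure std_normal_distribution ({s<..t} \<union> {t<..})
      = measure std_normal_distribution {s<..t} + measure std_normal_distribution {t<..}"
    by (rule N.finite_measure_Union) auto
  ultimately show ?thesis by simp
qed

lemma normal_tail_bounds: "0 < measure std_normal_distribution {t<..}" "measure std_normal_distribution {t<..} < 1"
proof -
  interpret N: real_distribution std_normal_distribution by (rule real_dist_normal_dist)
  show "0 < measure std_normal_distribution {t<..}"
    using normal_tail_strict_antimono[of t "t + 1"] order_le_less_trans[OF measure_nonneg] by force
  show "measure std_normal_distribution {t<..} < 1"
    by (rule order_less_le_trans[OF normal_tail_strict_antimono[of "t - 1"] N.prob_le_1]) simp
qed

lemma measure_normal_ereal_tail:
  "measure std_normal_distribution {z. t < ereal z}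
    = (case t of ereal r \<Rightarrow> measure std_normal_distribution {r<..} | PInfty \<Rightarrow> 0 | MInfty \<Rightarrow> 1)"
proof -
  interpret N: real_distribution std_normal_distribution by (rule real_dist_normal_dist)
  have "{z. ereal r < ereal z} = {r<..}" for r by auto
  then show ?thesis using N.prob_space by (cases t) auto
qed

text \<open>Uniqueness behind the definite description: real thresholds are separated by strict
  monotonicity of the tail, and the infinite ones give the values 0 and 1, which no real threshold
  attains.\<close>

lemma normal_threshold_eqI:
  assumes "measure std_normal_distribution {z. t < ereal z} = a"
  shows "normal_threshold a = t"
  unfolding normal_threshold_def
proof (rule the_equality)
  show "measure std_normal_distribution {z. t < ereal z} = a" by (rule assms)
  fix s assume "measure std_normal_distribution {z. s < ereal z} = a"
  then have "(case s of ereal r \<Rightarrow> measure std_normal_distribution {r<..} | PInfty \<Rightarrow> 0 | MInfty \<Rightarrow> 1)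
      = (case t of ereal r \<Rightarrow> measure std_normal_distribution {r<..} | PInfty \<Rightarrow> 0 | MInfty \<Rightarrow> 1)"
    using assms by (simp only: measure_normal_ereal_tail)
  moreover have "r = r'" if "measure std_normal_distribution {r<..} = measure std_normal_distribution {r'<..}" for r r'
    using that normal_tail_strict_antimono[of r r'] normal_tail_strict_antimono[of r' r] by (cases r r' rule: linorder_cases) auto
  moreover have "measure std_normal_distribution {r<..} \<noteq> 0" "measure std_normal_distribution {r<..} \<noteq> 1" for r
    using normal_tail_bounds[of r] by auto
  ultimately show "s = t" by (cases s; cases t) auto
qed

text \<open>Intermediate value theorem for the distribution function, which is continuous because
  the normal law has no atoms.\<close>

lemma normal_threshold_real:
  assumes "0 < a" "a < 1"
  obtains t where "normal_threshold a = ereal t" "measure std_normal_distribution {t<..} = a"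
proof -
  interpret N: real_distribution std_normal_distribution by (rule real_dist_normal_dist)
  have tail: "measure std_normal_distribution {t<..} = 1 - cdf std_normal_distribution t" for t
    using N.prob_compl[of "{..t}"] by (simp add: cdf_def Compl_eq_Diff_UNIV[symmetric])
  have cont: "isCont (cdf std_normal_distribution) t" for t
    unfolding N.isCont_cdf
    using N.prob_eq_0[of "{t}"] AE_std_normal_neq[of t] by simp
  have "\<forall>\<^sub>F x in at_bot. cdf std_normal_distribution x < 1 - a"
    using assms by (intro order_tendstoD(2)[OF N.cdf_lim_at_bot]) auto
  then obtain l where l: "\<And>x. x \<le> l \<Longrightarrow> cdf std_normal_distribution x < 1 - a"
    by (auto simp: eventually_at_bot_linorder)
  have "\<forall>\<^sub>F x in at_top. 1 - a < cdf std_normal_distribution x"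
    using assms by (intro order_tendstoD(1)[OF N.cdf_lim_at_top_prob]) auto
  then obtain u where u: "\<And>x. u \<le> x \<Longrightarrow> 1 - a < cdf std_normal_distribution x"
    by (auto simp: eventually_at_top_linorder)
  have "\<exists>t. l \<le> t \<and> t \<le> max l u \<and> cdf std_normal_distribution t = 1 - a"
    using l[of l] u[of "max l u"] cont by (intro IVT) auto
  then obtain t where "cdf std_normal_distribution t = 1 - a" by blast
  then have t: "measure std_normal_distribution {t<..} = a" by (simp add: tail)
  then have "normal_threshold a = ereal t"
    by (intro normal_threshold_eqI) (simp only: measure_normal_ereal_tail ereal.case)
  with t show thesis by (rule that[rotated])
qed

text \<open>At the exact threshold the Hamming balls may slightly exceed the volume
  \<open>a\<close>. They are taken at a larger \<open>s\<close>, where the volume constraint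
  eventually holds, and then \<open>s\<close> decreases to \<open>t\<close>. The value
  \<open>a = 1\<close>, needed for 2\<alpha> when \<alpha> = 1/2, has threshold minus infinity and
  is settled by the whole cube.\<close>

lemma Lambda_le_iid_sup:
  assumes \<beta>: "0 \<le> \<beta>" "\<beta> \<le> 1 / 2" and \<rho>: "\<rho> = 1 - 2 * \<beta>" and a: "0 < a" "a \<le> 1"
  shows "Lambda \<rho> a \<le> iid_sup \<beta> a"
proof (cases "a = 1")
  case True
  interpret prob_space "std_normal_pair \<rho>" by (rule prob_space_std_normal_pair)
  have "Lambda \<rho> a \<le> 1" unfolding Lambda_def by (rule prob_le_1)
  also have "1 \<le> iid_sup \<beta> a" using subcube_le_iid_sup[OF \<beta>, of 0] True by simp
  finally show ?thesis .
next
  case False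
  then obtain t where t: "normal_threshold a = ereal t" "measure std_normal_distribution {t<..} = a"
    using normal_threshold_real[of a] a by auto
  interpret P: prob_space "std_normal_pair \<rho>" by (rule prob_space_std_normal_pair)
  define Q where "Q = (\<lambda>s. {z :: real \<times> real. s < fst z \<and> s < snd z})"
  have Q_sets: "Q s \<in> sets (std_normal_pair \<rho>)" for s
    unfolding Q_def sets_std_normal_pair
    by (intro borel_open open_Collect_less open_Collect_conj continuous_intros)
  have le: "measure (std_normal_pair \<rho>) (Q s) \<le> iid_sup \<beta> a" if "t < s" for s
  proof (rule tendsto_upperbound)
    have b1: "\<beta> \<le> 1" using \<beta> by simp
    show "(\<lambda>n. stab {..<n} (bern \<beta> {..<n}) (ind (threshold_sets n s)) (ind (threshold_sets n s)))
        \<longlonglongrightarrow> measure (std_normal_pair \<rho>) (Q s)"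
      unfolding Q_def by (rule threshold_sets_limits(2)[OF \<beta>(1) b1 \<rho>])
    have "measure std_normal_distribution {s<..} < a"
      using normal_tail_strict_antimono[OF that] t(2) by simp
    from order_tendstoD(2)[OF threshold_sets_limits(1)[OF \<beta>(1) b1 \<rho>] this]
    show "\<forall>\<^sub>F n in sequentially. stab {..<n} (bern \<beta> {..<n}) (ind (threshold_sets n s)) (ind (threshold_sets n s)) \<le> iid_sup \<beta> a"
    proof eventually_elim
      case (elim n)
      then show ?case
        by (intro iid_sup_upper \<beta>) (auto simp: threshold_sets_def divide_less_eq)
    qed
  qed simp
  \<comment> \<open>The inequalities defining the quadrants are strict, so the quadrants increase to
    the one at \<open>t\<close> and continuity from below applies.\<close>
  have "(\<lambda>k. measure (std_normal_pair \<rho>) (Q (t + 1 / real (Suc k))))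
      \<longlonglongrightarrow> measure (std_normal_pair \<rho>) (\<Union>k. Q (t + 1 / real (Suc k)))"
  proof (rule P.finite_Lim_measure_incseq)
    show "incseq (\<lambda>k. Q (t + 1 / real (Suc k)))"
    proof (rule incseq_SucI)
      fix k
      have "1 / real (Suc (Suc k)) \<le> 1 / real (Suc k)" by (intro divide_left_mono) auto
      then show "Q (t + 1 / real (Suc k)) \<le> Q (t + 1 / real (Suc (Suc k)))" unfolding Q_def by auto
    qed
  qed (use Q_sets in auto)
  moreover have "(\<Union>k. Q (t + 1 / real (Suc k))) = Q t"
  proof (intro equalityI subsetI)
    fix z assume "z \<in> (\<Union>k. Q (t + 1 / real (Suc k)))"
    then obtain k where "t + 1 / real (Suc k) < fst z" "t + 1 / real (Suc k) < snd z" by (auto simp: Q_def)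
    moreover have "0 < 1 / real (Suc k)" by simp
    ultimately show "z \<in> Q t" unfolding Q_def mem_Collect_eq by (intro conjI) linarith+
  next
    fix z assume "z \<in> Q t"
    then have "0 < min (fst z) (snd z) - t" by (simp add: Q_def)
    then obtain k where "inverse (real (Suc k)) < min (fst z) (snd z) - t"
      using reals_Archimedean by blast
    then have "1 / real (Suc k) < min (fst z) (snd z) - t" by (simp only: inverse_eq_divide)
    then have "z \<in> Q (t + 1 / real (Suc k))" unfolding Q_def mem_Collect_eq by (intro conjI) linarith+
    then show "z \<in> (\<Union>k. Q (t + 1 / real (Suc k)))" by blast
  qed
  ultimately have lim: "(\<lambda>k. measure (std_normal_pair \<rho>) (Q (t + 1 / real (Suc k))))
      \<longlonglongrightarrow> measure (std_normal_pair \<rho>) (Q t)" by simp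
  have "{(z1, z2). normal_threshold a < ereal z1 \<and> normal_threshold a < ereal z2} = Q t"
    unfolding t(1) Q_def by auto
  then have "Lambda \<rho> a = measure (std_normal_pair \<rho>) (Q t)" by (simp add: Lambda_def)
  also have "\<dots> \<le> iid_sup \<beta> a"
    by (rule LIMSEQ_le_const2[OF lim]) (auto intro!: le)
  finally show ?thesis .
qed

section \<open>Maximal stability on the cube\<close>

definition enc :: "nat \<Rightarrow> nat set \<Rightarrow> nat \<Rightarrow> int" where
  "enc n J = (\<lambda>i\<in>{..<n}. if i \<in> J then - 1 else 1)"

lemma inj_on_enc: "inj_on (enc n) (Pow {..<n})"
proof (rule inj_onI)
  fix X Y assume XY: "X \<in> Pow {..<n}" "Y \<in> Pow {..<n}" and eq: "enc n X = enc n Y"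
  have "i \<in> X \<longleftrightarrow> i \<in> Y" for i
  proof (cases "i < n")
    case True
    then show ?thesis using fun_cong[OF eq, of i] by (auto simp: enc_def split: if_splits)
  next
    case False
    then show ?thesis using XY by auto
  qed
  then show "X = Y" by auto
qed

lemma enc_image: "enc n ` Pow {..<n} = cube n"
proof (intro equalityI subsetI)
  fix x assume "x \<in> enc n ` Pow {..<n}"
  then show "x \<in> cube n" by (auto simp: enc_def cube_def PiE_iff split: if_splits)
next
  fix x assume x: "x \<in> cube n"
  have "x = enc n {i \<in> {..<n}. x i = - 1}"
  proof
    fix i
    show "x i = enc n {i \<in> {..<n}. x i = - 1} i"
      using x by (cases "i < n") (auto simp: enc_def cube_def PiE_iff extensional_def)
  qed
  then show "x \<in> enc n ` Pow {..<n}" by blast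
qed

lemma cube_mult_enc:
  "cube_mult n (enc n X) (enc n J) = enc n (sym_diff X J)"
  by (auto simp: cube_mult_def enc_def restrict_def fun_eq_iff)

lemma hamming_enc:
  assumes "J \<subseteq> {..<n}"
  shows "hamming n (enc n J) (ones n) = card J"
proof -
  have "{i \<in> {..<n}. enc n J i \<noteq> ones n i} = J"
    using assms by (auto simp: enc_def ones_def)
  then show ?thesis by (simp add: hamming_def)
qed

lemma cube_sphere_enc: "cube_sphere n r = enc n ` {J \<in> Pow {..<n}. card J = r}"
  unfolding cube_sphere_def enc_image[symmetric] using hamming_enc by force

lemma cube_ball_enc: "cube_ball n r = enc n ` {J \<in> Pow {..<n}. card J \<le> r}"
  unfolding cube_ball_def enc_image[symmetric] using hamming_enc by force

lemma card_cube: "card (cube n) = 2 ^ n"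
  unfolding enc_image[symmetric] by (simp add: card_image[OF inj_on_enc] card_Pow)

lemma finite_cube: "finite (cube n)"
  unfolding enc_image[symmetric] by simp

lemma cube_nonempty: "cube n \<noteq> {}"
  unfolding enc_image[symmetric] by auto

lemma pair_pmf_pmf_of_set:
  fixes A :: "'a set" and B :: "'b set"
  assumes "finite A" "A \<noteq> {}" "finite B" "B \<noteq> {}"
  shows "pair_pmf (pmf_of_set A) (pmf_of_set B) = pmf_of_set (A \<times> B)"
proof (rule pmf_eqI)
  fix x :: "'a \<times> 'b"
  obtain a b where "x = (a, b)" by fastforce
  then show "pmf (pair_pmf (pmf_of_set A) (pmf_of_set B)) x = pmf (pmf_of_set (A \<times> B)) x"
    using assms by (simp add: pmf_pair card_cartesian_product indicator_def)
qed

text \<open>An arbitrary nonempty family \<open>F\<close> of flip sets is allowed, so that spheres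
  and balls are transferred by the same computation.\<close>

lemma noise_stab_enc:
  assumes F: "F \<subseteq> Pow {..<n}" "F \<noteq> {}"
  shows "noise_stab n (pmf_of_set (enc n ` F)) f
    = stab {..<n} (\<lambda>J. of_bool (J \<in> F) / real (card F)) (\<lambda>X. f (enc n X)) (\<lambda>X. f (enc n X))"
proof -
  have fin: "finite F" using F finite_subset by blast
  have inj: "inj_on (enc n) F" using inj_on_enc F inj_on_subset by blast
  let ?B = "enc n ` F"
  have ne: "?B \<noteq> {}" "finite ?B" using F fin by auto
  have "noise_stab n (pmf_of_set ?B) f
      = (\<Sum>(x, z)\<in>cube n \<times> ?B. f x * f (cube_mult n x z)) / real (card (cube n \<times> ?B))"
    unfolding noise_stab_def
    by (subst pair_pmf_pmf_of_set) (use ne finite_cube cube_nonempty in \<open>auto simp: integral_pmf_of_set\<close>)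
  also have "(\<Sum>(x, z)\<in>cube n \<times> ?B. f x * f (cube_mult n x z)) = (\<Sum>x\<in>cube n. \<Sum>z\<in>?B. f x * f (cube_mult n x z))"
    by (simp only: sum.cartesian_product)
  also have "\<dots> = (\<Sum>X\<in>Pow {..<n}. \<Sum>J\<in>F. f (enc n X) * f (enc n (sym_diff X J)))"
    unfolding enc_image[symmetric] by (simp add: sum.reindex[OF inj_on_enc] sum.reindex[OF inj] cube_mult_enc)
  also have "\<dots> = (\<Sum>X\<in>Pow {..<n}. \<Sum>J\<in>Pow {..<n}. of_bool (J \<in> F) * (f (enc n X) * f (enc n (sym_diff X J))))"
    using F by (intro sum.cong refl sum.mono_neutral_cong_left) auto
  also have "real (card (cube n \<times> ?B)) = real (card F) * 2 ^ card {..<n}"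
    by (simp add: card_cartesian_product card_cube card_image[OF inj])
  finally have eq: "noise_stab n (pmf_of_set ?B) f
    = (\<Sum>X\<in>Pow {..<n}. \<Sum>J\<in>Pow {..<n}. of_bool (J \<in> F) * (f (enc n X) * f (enc n (sym_diff X J))))
      / (real (card F) * 2 ^ card {..<n})" .
  have "of_bool (J \<in> F) / real (card F) * u * v = of_bool (J \<in> F) * (u * v) / real (card F)" for J u v
    by simp
  then show ?thesis
    unfolding eq stab_def by (simp only: sum_divide_distrib[symmetric] divide_divide_eq_left)
qed

section \<open>Maxima over Boolean functions of given volume\<close>

lemma stab_cong:
  assumes "\<And>J. J \<subseteq> U \<Longrightarrow> k J = k' J" "\<And>X. X \<subseteq> U \<Longrightarrow> f X = f' X" "\<And>X. X \<subseteq> U \<Longrightarrow> g X = g' X"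
  shows "stab U k f g = stab U k' f' g'"
  unfolding stab_def
proof (intro arg_cong2[of _ _ _ _ "(/)"] sum.cong refl)
  fix X J assume "X \<in> Pow U" "J \<in> Pow U"
  then have "sym_diff X J \<subseteq> U" "X \<subseteq> U" "J \<subseteq> U" by auto
  then show "k J * f X * g (sym_diff X J) = k' J * f' X * g' (sym_diff X J)"
    using assms by simp
qed

text \<open>Boolean functions correspond to their level sets. The lower bound accepts sets with
  fewer than \<open>M\<close> points, since adding points cannot decrease the stability under a
  nonnegative kernel. \<open>St\<close> stands for either sphere or ball stability.\<close>

lemma Max_stab_boolean_funs:
  assumes M: "M \<le> 2 ^ n" and k: "\<And>J. J \<subseteq> {..<n} \<Longrightarrow> 0 \<le> k J"
    and St: "\<And>f. St f = stab {..<n} k (\<lambda>X. f (enc n X)) (\<lambda>X. f (enc n X))"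
  shows Max_stab_upper: "(\<And>A. A \<subseteq> Pow {..<n} \<Longrightarrow> card A = M \<Longrightarrow> stab {..<n} k (ind A) (ind A) \<le> c)
      \<Longrightarrow> Max (St ` boolean_funs n M) \<le> c"
    and Max_stab_lower: "A \<subseteq> Pow {..<n} \<Longrightarrow> card A \<le> M \<Longrightarrow>
      stab {..<n} k (ind A) (ind A) \<le> Max (St ` boolean_funs n M)"
proof -
  have prob: "measure_pmf.prob (pmf_of_set (cube n)) {x. f x = 1} = real (card {X \<in> Pow {..<n}. f (enc n X) = 1}) / 2 ^ n"
    for f :: "(nat \<Rightarrow> int) \<Rightarrow> real"
  proof -
    have "cube n \<inter> {x. f x = 1} = enc n ` {X \<in> Pow {..<n}. f (enc n X) = 1}"
      unfolding enc_image[symmetric] by auto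
    then show ?thesis
      using measure_pmf_of_set[OF cube_nonempty finite_cube, of n "{x. f x = 1}"]
        card_image[OF inj_on_subset[OF inj_on_enc[of n]], of "{X \<in> Pow {..<n}. f (enc n X) = 1}"]
      by (simp add: card_cube subset_iff)
  qed
  have fin: "finite (boolean_funs n M)"
    by (rule finite_subset[of _ "cube n \<rightarrow>\<^sub>E {0, 1}"]) (auto simp: boolean_funs_def intro!: finite_PiE finite_cube)
  have St_eq: "\<exists>A \<subseteq> Pow {..<n}. card A = M \<and> St f = stab {..<n} k (ind A) (ind A)" if "f \<in> boolean_funs n M" for f
  proof (intro exI[of _ "{X \<in> Pow {..<n}. f (enc n X) = 1}"] conjI)
    let ?A = "{X \<in> Pow {..<n}. f (enc n X) = 1}"
    have f: "f \<in> cube n \<rightarrow>\<^sub>E {0, 1}" "real (card ?A) / 2 ^ n = real M / 2 ^ n"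
      using that by (auto simp: boolean_funs_def prob)
    then show "card ?A = M" by simp
    have "f (enc n X) = ind ?A X" if "X \<subseteq> {..<n}" for X
    proof -
      have "enc n X \<in> cube n" using that enc_image[of n] by blast
      then show ?thesis using f(1) that by (auto simp: ind_def)
    qed
    then show "St f = stab {..<n} k (ind ?A) (ind ?A)"
      unfolding St by (intro stab_cong) auto
  qed auto
  have ex: "\<exists>f \<in> boolean_funs n M. St f = stab {..<n} k (ind A) (ind A)" if A: "A \<subseteq> Pow {..<n}" "card A = M" for A
  proof -
    \<comment> \<open>Restriction to the cube makes the function extensional, as membership in
      \<open>boolean_funs\<close> demands.\<close>
    define f where "f = (\<lambda>x\<in>cube n. ind (enc n ` A) x)"
    have fe: "f (enc n X) = ind A X" if "X \<subseteq> {..<n}" for X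
    proof -
      have "enc n X \<in> cube n" using that enc_image[of n] by blast
      moreover have "enc n X \<in> enc n ` A \<longleftrightarrow> X \<in> A"
        using inj_on_image_mem_iff[OF inj_on_enc, of X n A] that A by auto
      ultimately show ?thesis by (simp add: f_def ind_def)
    qed
    have "{X \<in> Pow {..<n}. f (enc n X) = 1} = A"
      using A fe by (auto simp: ind_def split: if_splits)
    then have "f \<in> boolean_funs n M"
      using A(2) by (auto simp: boolean_funs_def prob f_def ind_def)
    moreover have "St f = stab {..<n} k (ind A) (ind A)"
      unfolding St by (intro stab_cong fe) auto
    ultimately show ?thesis by blast
  qed
  have sup: "\<exists>A'. A \<subseteq> A' \<and> A' \<subseteq> Pow {..<n} \<and> card A' = M" if "A \<subseteq> Pow {..<n}" "card A \<le> M" for A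
    using exists_subset_between[of A M "Pow {..<n}"] that M by (auto simp: card_Pow)
  show "Max (St ` boolean_funs n M) \<le> c"
    if "\<And>A. A \<subseteq> Pow {..<n} \<Longrightarrow> card A = M \<Longrightarrow> stab {..<n} k (ind A) (ind A) \<le> c"
  proof (rule Max.boundedI)
    show "finite (St ` boolean_funs n M)" using fin by simp
    obtain A where "A \<subseteq> Pow {..<n}" "card A = M" using sup[of "{}"] by auto
    then show "St ` boolean_funs n M \<noteq> {}" using ex by blast
    fix a assume "a \<in> St ` boolean_funs n M"
    then obtain A where "A \<subseteq> Pow {..<n}" "card A = M" "a = stab {..<n} k (ind A) (ind A)" using St_eq by blast
    with that show "a \<le> c" by blast
  qed
  show "stab {..<n} k (ind A) (ind A) \<le> Max (St ` boolean_funs n M)" if A: "A \<subseteq> Pow {..<n}" "card A \<le> M"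
  proof -
    obtain A' where A': "A \<subseteq> A'" "A' \<subseteq> Pow {..<n}" "card A' = M" using sup[OF A] by blast
    obtain f where f: "f \<in> boolean_funs n M" "St f = stab {..<n} k (ind A') (ind A')" using ex[OF A'(2,3)] by blast
    have "stab {..<n} k (ind A) (ind A) \<le> stab {..<n} k (ind A') (ind A')"
      using A'(1) k by (intro stab_mono) (auto simp: ind_def)
    also have "\<dots> \<le> Max (St ` boolean_funs n M)"
      unfolding f(2)[symmetric] using fin f(1) by (intro Max_ge) auto
    finally show ?thesis .
  qed
qed

lemma vol_seq_le:
  assumes "0 \<le> \<alpha>"
  shows "real (vol_seq \<alpha> n) \<le> \<alpha> * 2 ^ n"
  using assms by (simp add: vol_seq_def)

lemma le_vol_seq:
  assumes "real c \<le> \<alpha> * 2 ^ n"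
  shows "c \<le> vol_seq \<alpha> n"
  using assms unfolding vol_seq_def by (simp add: le_nat_floor)

lemma vol_seq_le_power:
  assumes "0 \<le> \<alpha>" "\<alpha> \<le> 1"
  shows "vol_seq \<alpha> n \<le> 2 ^ n"
proof -
  have "real (vol_seq \<alpha> n) \<le> \<alpha> * 2 ^ n" by (rule vol_seq_le[OF assms(1)])
  also have "\<dots> \<le> 1 * 2 ^ n" using assms(2) by (intro mult_right_mono) auto
  finally show ?thesis by simp
qed

section \<open>Asymptotic bounds for the maxima\<close>

context radial_noise begin

text \<open>What the asymptotic bounds use of a maximum, shared by spheres and balls. It is only
  eventual because a sphere may be empty in small dimensions. Upper bounds are tested on sets of the
  exact size, lower bounds on sets of at most that size.\<close>

definition max_seq :: "real \<Rightarrow> (nat \<Rightarrow> real) \<Rightarrow> bool" where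
  "max_seq \<alpha> G \<longleftrightarrow> (\<forall>\<^sub>F n in sequentially.
     (\<forall>c. (\<forall>A. A \<subseteq> Pow {..<n} \<and> card A = vol_seq \<alpha> n \<longrightarrow> stab {..<n} (kern n) (ind A) (ind A) \<le> c) \<longrightarrow> G n \<le> c) \<and>
     (\<forall>A. A \<subseteq> Pow {..<n} \<and> card A \<le> vol_seq \<alpha> n \<longrightarrow> stab {..<n} (kern n) (ind A) (ind A) \<le> G n))"

lemma max_seq_upper:
  assumes G: "max_seq \<alpha> G" and \<alpha>: "0 \<le> \<alpha>" and \<tau>: "0 \<le> \<tau>"
    and par: "\<And>\<epsilon>. 0 < \<epsilon> \<Longrightarrow> \<forall>\<^sub>F n in sequentially. parity n \<le> \<tau> + \<epsilon>" and \<epsilon>: "0 < \<epsilon>"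
  shows "\<forall>\<^sub>F n in sequentially. G n \<le> (1 + \<tau>) * iid_sup \<beta> \<alpha> + \<epsilon>"
proof -
  define L where "L = iid_sup \<beta> \<alpha>"
  have b: "0 \<le> \<beta>" "\<beta> \<le> 1 / 2" using \<beta> by auto
  have L0: "0 \<le> L" unfolding L_def by (rule iid_sup_nonneg[OF b \<alpha>])
  \<comment> \<open>Half of the error goes to the eigenvalues and half to the parity; the latter is
    multiplied by \<open>L\<close>, and \<open>L + 1\<close> avoids division by 0.\<close>
  have "0 < \<epsilon> / (2 * (L + 1))" "0 < \<epsilon> / 2" using \<epsilon> L0 by auto
  from G[unfolded max_seq_def] par[OF this(1)] stab_kern_le[OF this(2)]
  show ?thesis
  proof eventually_elim
    case (elim n)
    have "stab {..<n} (kern n) (ind A) (ind A) \<le> (1 + \<tau>) * L + \<epsilon>"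
      if A: "A \<subseteq> Pow {..<n}" "card A = vol_seq \<alpha> n" for A
    proof -
      let ?s = "stab {..<n} (bern \<beta> {..<n}) (ind A) (ind A)"
      have s: "?s \<le> L" unfolding L_def
        using vol_seq_le[OF \<alpha>, of n] A by (intro iid_sup_upper b) auto
      have "stab {..<n} (kern n) (ind A) (ind A) \<le> (1 + max 0 (parity n)) * ?s + \<epsilon> / 2"
        using elim(3) A by blast
      also have "(1 + max 0 (parity n)) * ?s \<le> (1 + max 0 (parity n)) * L"
        using s by (intro mult_left_mono) auto
      also have "\<dots> \<le> (1 + (\<tau> + \<epsilon> / (2 * (L + 1)))) * L"
        using elim(2) L0 \<tau> \<epsilon> by (intro mult_right_mono) auto
      also have "\<dots> = (1 + \<tau>) * L + \<epsilon> / 2 * (L / (L + 1))"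
        using L0 by (simp add: field_simps)
      also have "\<epsilon> / 2 * (L / (L + 1)) \<le> \<epsilon> / 2 * 1"
        using L0 \<epsilon> by (intro mult_left_mono) auto
      finally show ?thesis by simp
    qed
    then show ?case using elim(1) unfolding L_def by blast
  qed
qed

text \<open>A nearly optimal set in a fixed dimension is lifted to a cylinder. Its size is an
  integer not exceeding \<open>\<alpha> * 2 ^ n\<close>, so the floor in \<open>vol_seq\<close>
  costs nothing.\<close>

lemma max_seq_lower:
  assumes G: "max_seq \<alpha> G" and \<alpha>: "0 \<le> \<alpha>" and \<epsilon>: "0 < \<epsilon>"
  shows "\<forall>\<^sub>F n in sequentially. iid_sup \<beta> \<alpha> - \<epsilon> \<le> G n"
proof -
  obtain m A where A: "A \<subseteq> Pow {..<m}" "real (card A) \<le> \<alpha> * 2 ^ m"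
    and s: "iid_sup \<beta> \<alpha> - \<epsilon> < stab {..<m} (bern \<beta> {..<m}) (ind A) (ind A)"
    using iid_sup_approx[OF \<alpha> \<epsilon>] by blast
  have "\<forall>\<^sub>F n in sequentially. m \<le> n" by (rule eventually_ge_at_top)
  with order_tendstoD(1)[OF tendsto_stab_lift s] G[unfolded max_seq_def]
  show ?thesis
  proof eventually_elim
    case (elim n)
    define B where "B = {X \<in> Pow {..<n}. X \<inter> {..<m} \<in> A}"
    have sub: "{..<m} \<subseteq> {..<n}" using elim(3) by auto
    have "real (card B) = (\<Sum>X\<in>Pow {..<n}. ind A (X \<inter> {..<m}))"
    proof -
      have "(\<Sum>X\<in>Pow {..<n}. ind A (X \<inter> {..<m})) = (\<Sum>X\<in>B. 1)"
        by (intro sum.mono_neutral_cong_right) (auto simp: B_def ind_def)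
      then show ?thesis by simp
    qed
    also have "\<dots> = 2 ^ (n - m) * (\<Sum>X\<in>Pow {..<m}. ind A X)"
      using sum_Pow_trace_const[OF _ sub, of "ind A"] sub by (simp add: card_Diff_subset)
    also have "(\<Sum>X\<in>Pow {..<m}. ind A X) = (\<Sum>X\<in>A. 1)"
      using A(1) by (intro sum.mono_neutral_cong_right) (auto simp: ind_def)
    also have "2 ^ (n - m) * (\<Sum>X\<in>A. 1 :: real) \<le> 2 ^ (n - m) * (\<alpha> * 2 ^ m)"
      using A(2) by simp
    also have "\<dots> = \<alpha> * 2 ^ n" using elim(3) by (simp add: power_add[symmetric])
    finally have "card B \<le> vol_seq \<alpha> n" by (rule le_vol_seq)
    moreover have "B \<subseteq> Pow {..<n}" by (auto simp: B_def)
    ultimately have "stab {..<n} (kern n) (ind B) (ind B) \<le> G n" using elim(2) by blast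
    moreover have "stab {..<n} (kern n) (ind B) (ind B)
        = stab {..<n} (kern n) (\<lambda>X. ind A (X \<inter> {..<m})) (\<lambda>X. ind A (X \<inter> {..<m}))"
      by (intro stab_cong) (auto simp: B_def ind_def)
    ultimately show ?case using elim(1) by simp
  qed
qed

text \<open>Since the restriction to even sets halves the volume, the base of the cylinder may have
  measure up to 2\<alpha>; this is the origin of the doubled argument.\<close>

lemma max_seq_lower_even:
  assumes G: "max_seq \<alpha> G" and \<alpha>: "0 \<le> \<alpha>" and \<epsilon>: "0 < \<epsilon>" and W: "\<And>n j. odd j \<Longrightarrow> W n j = 0"
  shows "\<forall>\<^sub>F n in sequentially. iid_sup \<beta> (2 * \<alpha>) / 2 - \<epsilon> \<le> G n"
proof -
  have \<alpha>2: "0 \<le> 2 * \<alpha>" using \<alpha> by simp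
  obtain m A where A: "A \<subseteq> Pow {..<m}" "real (card A) \<le> 2 * \<alpha> * 2 ^ m"
    and s: "iid_sup \<beta> (2 * \<alpha>) - \<epsilon> < stab {..<m} (bern \<beta> {..<m}) (ind A) (ind A)"
    using iid_sup_approx[OF \<alpha>2 \<epsilon>] by blast
  then have s': "iid_sup \<beta> (2 * \<alpha>) / 2 - \<epsilon> < stab {..<m} (bern \<beta> {..<m}) (ind A) (ind A) / 2" using \<epsilon> by simp
  have ge: "\<forall>\<^sub>F n in sequentially. Suc m \<le> n" by (rule eventually_ge_at_top)
  have lim: "(\<lambda>n. stab {..<n} (kern n) (\<lambda>X. of_bool (even (card X)) * ind A (X \<inter> {..<m}))
      (\<lambda>X. of_bool (even (card X)) * ind A (X \<inter> {..<m}))) \<longlonglongrightarrow> stab {..<m} (bern \<beta> {..<m}) (ind A) (ind A) / 2"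
    by (rule tendsto_stab_lift_even) (rule W)
  from order_tendstoD(1)[OF lim s'] G[unfolded max_seq_def] ge
  show ?thesis
  proof eventually_elim
    case (elim n)
    let ?e = "\<lambda>X :: nat set. of_bool (even (card X)) :: real"
    define B where "B = {X \<in> Pow {..<n}. even (card X) \<and> X \<inter> {..<m} \<in> A}"
    have sub: "{..<m} \<subset> {..<n}" using elim(3) by auto
    have "real (card B) = (\<Sum>X\<in>Pow {..<n}. ?e X * ind A (X \<inter> {..<m}))"
    proof -
      have "(\<Sum>X\<in>Pow {..<n}. ?e X * ind A (X \<inter> {..<m})) = (\<Sum>X\<in>B. 1)"
        by (intro sum.mono_neutral_cong_right) (auto simp: B_def ind_def)
      then show ?thesis by simp
    qed
    also have "\<dots> = 2 ^ (n - m) / 2 * (\<Sum>X\<in>Pow {..<m}. ind A X)"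
      using sum_Pow_trace_even[OF _ sub, of "ind A"] sub by (simp add: card_Diff_subset psubset_imp_subset)
    also have "(\<Sum>X\<in>Pow {..<m}. ind A X) = (\<Sum>X\<in>A. 1)"
      using A(1) by (intro sum.mono_neutral_cong_right) (auto simp: ind_def)
    also have "2 ^ (n - m) / 2 * (\<Sum>X\<in>A. 1 :: real) \<le> 2 ^ (n - m) / 2 * (2 * \<alpha> * 2 ^ m)"
      using A(2) by (intro mult_left_mono) auto
    also have "\<dots> = \<alpha> * 2 ^ n" using elim(3) by (simp add: power_add[symmetric])
    finally have "card B \<le> vol_seq \<alpha> n" by (rule le_vol_seq)
    moreover have "B \<subseteq> Pow {..<n}" by (auto simp: B_def)
    ultimately have "stab {..<n} (kern n) (ind B) (ind B) \<le> G n" using elim(2) by blast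
    moreover have "stab {..<n} (kern n) (ind B) (ind B)
        = stab {..<n} (kern n) (\<lambda>X. ?e X * ind A (X \<inter> {..<m})) (\<lambda>X. ?e X * ind A (X \<inter> {..<m}))"
      by (intro stab_cong) (auto simp: B_def ind_def)
    ultimately show ?case using elim(1) by simp
  qed
qed

end

text \<open>The radius is eventually below \<open>n\<close>. Then the sphere is nonempty and the
  uniform distribution on it is the specified one.\<close>

lemma Gamma_S_max_seq:
  assumes \<beta>: "0 < \<beta>" "\<beta> \<le> 1 / 2" and r: "(\<lambda>n. real (r n) / real n) \<longlonglongrightarrow> \<beta>" and \<alpha>: "0 \<le> \<alpha>" "\<alpha> \<le> 1"
  shows "radial_noise.max_seq (\<lambda>n j. of_bool (j = r n)) \<alpha> (\<lambda>n. Gamma_S n (vol_seq \<alpha> n) (r n))"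
proof -
  interpret radial_noise "\<lambda>n j. of_bool (j = r n)" \<beta>
    by (rule sphere_radial_noise[OF \<beta> r])
  have lim: "filterlim (\<lambda>n. (n, r n)) (scaling \<beta>) sequentially"
    using r by (simp add: filterlim_scaling_iff filterlim_ident)
  have "\<forall>\<^sub>F n in sequentially. r n < n"
    using eventually_compose_filterlim[OF eventually_scaling_snd_less lim] \<beta> by simp
  then show ?thesis
    unfolding max_seq_def
  proof eventually_elim
    case (elim n)
    let ?F = "{J \<in> Pow {..<n}. card J = r n}"
    have "card ?F = n choose r n" using n_subsets[of "{..<n}" "r n"] by (simp add: Pow_def)
    moreover have "?F \<noteq> {}" using calculation elim by (metis card.empty less_imp_le less_irrefl zero_less_binomial)
    ultimately have St: "SStab n (r n) f = stab {..<n} (kern n) (\<lambda>X. f (enc n X)) (\<lambda>X. f (enc n X))" for f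
      unfolding SStab_def cube_sphere_enc
      by (subst noise_stab_enc) (auto intro!: stab_cong simp: kern_def)
    note M = Max_stab_boolean_funs[OF vol_seq_le_power[OF \<alpha>, of n] kern_nonneg St]
    show ?case unfolding Gamma_S_def using M by blast
  qed
qed

text \<open>A ball always contains the empty flip set, so every dimension is covered. In
  \<open>kern\<close> the binomial of the weight cancels, leaving the uniform weight on the
  ball.\<close>

lemma Gamma_B_max_seq:
  assumes \<beta>: "0 < \<beta>" "\<beta> \<le> 1 / 2" and r: "(\<lambda>n. real (r n) / real n) \<longlonglongrightarrow> \<beta>" and \<alpha>: "0 \<le> \<alpha>" "\<alpha> \<le> 1"
  shows "radial_noise.max_seq (\<lambda>n j. of_bool (j \<le> r n) * real (n choose j) / ball_size n (r n)) \<alpha>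
    (\<lambda>n. Gamma_B n (vol_seq \<alpha> n) (r n))"
proof -
  interpret radial_noise "\<lambda>n j. of_bool (j \<le> r n) * real (n choose j) / ball_size n (r n)" \<beta>
    by (rule ball_radial_noise[OF \<beta> r])
  show ?thesis
    unfolding max_seq_def
  proof (intro always_eventually allI)
    fix n
    let ?F = "{J \<in> Pow {..<n}. card J \<le> r n}"
    have "?F = (\<Union>i\<le>r n. {J. J \<subseteq> {..<n} \<and> card J = i})" by auto
    also have "card \<dots> = (\<Sum>i\<le>r n. card {J. J \<subseteq> {..<n} \<and> card J = i})"
      by (rule card_UN_disjoint) auto
    finally have cF: "real (card ?F) = ball_size n (r n)"
      by (simp add: n_subsets ball_size_def)
    have "{} \<in> ?F" by simp
    then have "?F \<noteq> {}" by blast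
    then have St: "BStab n (r n) f = stab {..<n} (kern n) (\<lambda>X. f (enc n X)) (\<lambda>X. f (enc n X))" for f
      unfolding BStab_def cube_ball_enc
    proof (subst noise_stab_enc, blast, blast, intro stab_cong refl)
      fix J assume "J \<subseteq> {..<n}"
      moreover have "n choose card J \<noteq> 0"
        using card_mono[OF finite_lessThan \<open>J \<subseteq> {..<n}\<close>] by (simp add: not_less)
      ultimately show "of_bool (J \<in> ?F) / real (card ?F) = kern n J"
        unfolding cF kern_def by simp
    qed
    note M = Max_stab_boolean_funs[OF vol_seq_le_power[OF \<alpha>, of n] kern_nonneg St]
    show "(\<forall>c. (\<forall>A. A \<subseteq> Pow {..<n} \<and> card A = vol_seq \<alpha> n \<longrightarrow> stab {..<n} (kern n) (ind A) (ind A) \<le> c)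
          \<longrightarrow> Gamma_B n (vol_seq \<alpha> n) (r n) \<le> c) \<and>
        (\<forall>A. A \<subseteq> Pow {..<n} \<and> card A \<le> vol_seq \<alpha> n \<longrightarrow>
          stab {..<n} (kern n) (ind A) (ind A) \<le> Gamma_B n (vol_seq \<alpha> n) (r n))"
      unfolding Gamma_B_def using M by blast
  qed
qed

section \<open>Radii and limit criteria\<close>

lemma even_radius_ratio: "0 \<le> \<beta> \<Longrightarrow> (\<lambda>n. real (even_radius \<beta> n) / real n) \<longlonglongrightarrow> \<beta>"
  and odd_radius_ratio: "0 \<le> \<beta> \<Longrightarrow> (\<lambda>n. real (odd_radius \<beta> n) / real n) \<longlonglongrightarrow> \<beta>"
proof -
  assume \<beta>: "0 \<le> \<beta>"
  have b: "\<beta> * real n - 2 \<le> real (even_radius \<beta> n)" "real (even_radius \<beta> n) \<le> \<beta> * real n" for n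
  proof -
    have "0 \<le> \<beta> * real n / 2" using \<beta> by simp
    then have "real (even_radius \<beta> n) = 2 * of_int \<lfloor>\<beta> * real n / 2\<rfloor>"
      by (simp add: even_radius_def)
    then show "\<beta> * real n - 2 \<le> real (even_radius \<beta> n)" "real (even_radius \<beta> n) \<le> \<beta> * real n"
      by linarith+
  qed
  show even: "(\<lambda>n. real (even_radius \<beta> n) / real n) \<longlonglongrightarrow> \<beta>"
  proof (rule tendsto_sandwich)
    show "(\<lambda>n. \<beta> - 2 * (1 / real n)) \<longlonglongrightarrow> \<beta>"
      using tendsto_diff[OF tendsto_const tendsto_mult[OF tendsto_const lim_1_over_n], of \<beta> 2] by simp
    show "(\<lambda>n. \<beta>) \<longlonglongrightarrow> \<beta>" by simp
    show "\<forall>\<^sub>F n in sequentially. \<beta> - 2 * (1 / real n) \<le> real (even_radius \<beta> n) / real n"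
      using eventually_gt_at_top[of 0]
    proof eventually_elim
      case (elim n)
      then have "\<beta> - 2 * (1 / real n) = (\<beta> * real n - 2) / real n" by (simp add: field_simps)
      also have "\<dots> \<le> real (even_radius \<beta> n) / real n" by (intro divide_right_mono b(1)) simp
      finally show ?case .
    qed
    show "\<forall>\<^sub>F n in sequentially. real (even_radius \<beta> n) / real n \<le> \<beta>"
      using eventually_gt_at_top[of 0] by eventually_elim (use b in \<open>simp add: field_simps\<close>)
  qed
  have "(\<lambda>n. real (even_radius \<beta> n) / real n + 1 / real n) \<longlonglongrightarrow> \<beta> + 0"
    by (intro tendsto_add even lim_1_over_n)
  then show "(\<lambda>n. real (odd_radius \<beta> n) / real n) \<longlonglongrightarrow> \<beta>"
    by (simp add: odd_radius_def even_radius_def add_divide_distrib add.commute)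
qed

lemma limsup_ereal_le:
  assumes "\<And>\<epsilon>. 0 < \<epsilon> \<Longrightarrow> \<forall>\<^sub>F n in sequentially. f n \<le> c + \<epsilon>"
  shows "limsup (\<lambda>n. ereal (f n)) \<le> ereal c"
proof (rule ereal_le_epsilon2)
  fix e :: real assume "0 < e"
  from assms[OF this] have "\<forall>\<^sub>F n in sequentially. ereal (f n) \<le> ereal c + ereal e"
    by eventually_elim simp
  then show "limsup (\<lambda>n. ereal (f n)) \<le> ereal c + ereal e" by (rule Limsup_bounded)
qed

lemma le_liminf_ereal:
  assumes "\<And>\<epsilon>. 0 < \<epsilon> \<Longrightarrow> \<forall>\<^sub>F n in sequentially. c - \<epsilon> \<le> f n"
  shows "ereal c \<le> liminf (\<lambda>n. ereal (f n))"
proof (rule ereal_le_epsilon2)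
  fix e :: real assume "0 < e"
  from assms[OF this] have "\<forall>\<^sub>F n in sequentially. ereal (c - e) \<le> ereal (f n)"
    by eventually_elim simp
  then have "ereal (c - e) \<le> liminf (\<lambda>n. ereal (f n))" by (rule Liminf_bounded)
  then show "ereal c \<le> liminf (\<lambda>n. ereal (f n)) + ereal e"
    by (cases "liminf (\<lambda>n. ereal (f n))") auto
qed

lemma LIMSEQ_sandwich_epsilon:
  fixes f :: "nat \<Rightarrow> real"
  assumes "\<And>\<epsilon>. 0 < \<epsilon> \<Longrightarrow> \<forall>\<^sub>F n in sequentially. f n \<le> c + \<epsilon>"
    and "\<And>\<epsilon>. 0 < \<epsilon> \<Longrightarrow> \<forall>\<^sub>F n in sequentially. c - \<epsilon> \<le> f n"
  shows "f \<longlonglongrightarrow> c"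
proof (rule tendstoI)
  fix e :: real assume "0 < e"
  then have "0 < e / 2" by simp
  from assms(1)[OF this] assms(2)[OF this]
  show "\<forall>\<^sub>F n in sequentially. dist (f n) c < e"
    by eventually_elim (use \<open>0 < e\<close> in \<open>simp add: dist_real_def\<close>)
qed

theorem theorem6:
  fixes \<alpha> \<beta> \<rho> :: real
  assumes "0 < \<alpha>" and "\<alpha> \<le> 1/2" and "0 < \<beta>" and "\<beta> \<le> 1/2"
    and "\<rho> = 1 - 2 * \<beta>"
  shows "(convergent (odd_S_seq \<alpha> \<beta>) \<and> convergent (odd_B_seq \<alpha> \<beta>) \<and>
          Lambda \<rho> \<alpha> \<le> Gamma_odd_S \<alpha> \<beta> \<and>
          Gamma_odd_S \<alpha> \<beta> = Gamma_odd_B \<alpha> \<beta> \<and>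
          Gamma_odd_B \<alpha> \<beta> \<le> \<alpha> powr (1 / (1 - \<beta>))) \<and>
         (ereal (1/2 * Lambda \<rho> (2 * \<alpha>)) \<le> Gamma_even_S_inf \<alpha> \<beta> \<and>
          Gamma_even_S_inf \<alpha> \<beta> \<le> Gamma_even_S_sup \<alpha> \<beta> \<and>
          Gamma_even_S_sup \<alpha> \<beta> \<le> ereal (2 * \<alpha> powr (1 / (1 - \<beta>)))) \<and>
         (ereal (Lambda \<rho> \<alpha>) \<le> Gamma_even_B_inf \<alpha> \<beta> \<and>
          Gamma_even_B_inf \<alpha> \<beta> \<le> Gamma_even_B_sup \<alpha> \<beta> \<and>
          Gamma_even_B_sup \<alpha> \<beta> \<le> ereal (2 * (1 - \<beta>) * \<alpha> powr (1 / (1 - \<beta>)))) \<and>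
         (\<forall>k::nat. 0 < k \<and> real k = log 2 (1 / \<alpha>) \<longrightarrow>
            ((1 - \<beta>) / 2) ^ k \<le> Gamma_odd_S \<alpha> \<beta> \<and>
            ereal (((1 - \<beta>) / 2) ^ k) \<le> Gamma_even_B_inf \<alpha> \<beta> \<and>
            ereal (1/2 * ((1 - \<beta>) / 2) ^ (k - 1)) \<le> Gamma_even_S_inf \<alpha> \<beta>)"
proof -
  note \<beta> = assms(3,4) and \<alpha> = assms(1,2)
  have b: "0 \<le> \<beta>" "\<beta> \<le> 1 / 2" and a: "0 \<le> \<alpha>" "\<alpha> \<le> 1" using assms by auto
  \<comment> \<open>\<open>L\<close> is the common limit for odd radii. \<open>L2\<close> is the
    even-sphere lower bound, with the factor 1/2 from the even vectors.\<close>
  define L where "L = iid_sup \<beta> \<alpha>"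
  define L2 where "L2 = iid_sup \<beta> (2 * \<alpha>) / 2"
  define P where "P = \<alpha> powr (1 / (1 - \<beta>))"
  have LP: "L \<le> P" unfolding L_def P_def by (rule iid_sup_le[OF b a(1)])
  let ?ro = "odd_radius \<beta>" and ?re = "even_radius \<beta>"
  note ro = odd_radius_ratio[OF b(1)] and re = even_radius_ratio[OF b(1)]
  interpret SO: radial_noise "\<lambda>n j. of_bool (j = ?ro n)" \<beta>
    by (rule sphere_radial_noise[OF \<beta> ro])
  interpret SE: radial_noise "\<lambda>n j. of_bool (j = ?re n)" \<beta>
    by (rule sphere_radial_noise[OF \<beta> re])
  interpret BO: radial_noise "\<lambda>n j. of_bool (j \<le> ?ro n) * real (n choose j) / ball_size n (?ro n)" \<beta>
    by (rule ball_radial_noise[OF \<beta> ro])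
  interpret BE: radial_noise "\<lambda>n j. of_bool (j \<le> ?re n) * real (n choose j) / ball_size n (?re n)" \<beta>
    by (rule ball_radial_noise[OF \<beta> re])
  have odd: "odd (?ro n)" and even: "even (?re n)" for n
    by (auto simp: odd_radius_def even_radius_def)
  have SOp: "SO.parity n \<le> 0" for n
  proof -
    have "of_bool (j = ?ro n) * (- 1) ^ j \<le> (0 :: real)" for j using odd[of n] by auto
    then show ?thesis unfolding SO.parity_def by (intro sum_nonpos) auto
  qed
  have SEp: "SE.parity n \<le> 1" for n
  proof -
    have "of_bool (j = ?re n) * (- 1) ^ j = (if j = ?re n then 1 else 0 :: real)" for j using even[of n] by auto
    then show ?thesis unfolding SE.parity_def by (simp add: sum.delta)
  qed
  \<comment> \<open>For odd radii the parity tends to \<open>- (1 - 2 * \<beta>)\<close>, which is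
    at most 0 because \<beta> is at most 1/2, so \<tau> = 0 is admissible.\<close>
  have BOp: "\<forall>\<^sub>F n in sequentially. BO.parity n \<le> 0 + \<epsilon>" if "0 < \<epsilon>" for \<epsilon>
  proof -
    have "1 - 2 * \<beta> - \<epsilon> < 1 - 2 * \<beta>" using that by simp
    from order_tendstoD(1)[OF ball_parity[OF \<beta> ro] this] show ?thesis
      by eventually_elim (use odd b in auto)
  qed
  \<comment> \<open>Here \<tau> is \<open>1 - 2 * \<beta>\<close>, and
    \<open>1 + \<tau> = 2 * (1 - \<beta>)\<close> is the constant for even balls.\<close>
  have BEp: "\<forall>\<^sub>F n in sequentially. BE.parity n \<le> (1 - 2 * \<beta>) + \<epsilon>" if "0 < \<epsilon>" for \<epsilon>
  proof -
    have "1 - 2 * \<beta> < 1 - 2 * \<beta> + \<epsilon>" using that by simp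
    from order_tendstoD(2)[OF ball_parity[OF \<beta> re] this] show ?thesis
      by eventually_elim (use even in auto)
  qed
  have Gm: "SO.max_seq \<alpha> (odd_S_seq \<alpha> \<beta>)" "BO.max_seq \<alpha> (odd_B_seq \<alpha> \<beta>)"
    "SE.max_seq \<alpha> (even_S_seq \<alpha> \<beta>)" "BE.max_seq \<alpha> (even_B_seq \<alpha> \<beta>)"
    unfolding odd_S_seq_def[abs_def] odd_B_seq_def[abs_def] even_S_seq_def[abs_def] even_B_seq_def[abs_def]
    by (rule Gamma_S_max_seq[OF \<beta> ro a] Gamma_B_max_seq[OF \<beta> ro a]
        Gamma_S_max_seq[OF \<beta> re a] Gamma_B_max_seq[OF \<beta> re a])+
  have limS: "odd_S_seq \<alpha> \<beta> \<longlonglongrightarrow> L"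
  proof (rule LIMSEQ_sandwich_epsilon)
    show "\<forall>\<^sub>F n in sequentially. odd_S_seq \<alpha> \<beta> n \<le> L + \<epsilon>" if "0 < \<epsilon>" for \<epsilon>
    proof -
      have "\<forall>\<^sub>F n in sequentially. SO.parity n \<le> 0 + \<epsilon>" if "0 < \<epsilon>" for \<epsilon>
        using order_trans[OF SOp less_imp_le[OF that]] by (intro always_eventually allI) simp
      from SO.max_seq_upper[OF Gm(1) a(1) order_refl this \<open>0 < \<epsilon>\<close>] show ?thesis by (simp add: L_def)
    qed
    show "\<forall>\<^sub>F n in sequentially. L - \<epsilon> \<le> odd_S_seq \<alpha> \<beta> n" if "0 < \<epsilon>" for \<epsilon>
      unfolding L_def by (rule SO.max_seq_lower[OF Gm(1) a(1) that])
  qed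
  have limB: "odd_B_seq \<alpha> \<beta> \<longlonglongrightarrow> L"
  proof (rule LIMSEQ_sandwich_epsilon)
    show "\<forall>\<^sub>F n in sequentially. odd_B_seq \<alpha> \<beta> n \<le> L + \<epsilon>" if "0 < \<epsilon>" for \<epsilon>
      using BO.max_seq_upper[OF Gm(2) a(1) order_refl BOp that] by (simp add: L_def)
    show "\<forall>\<^sub>F n in sequentially. L - \<epsilon> \<le> odd_B_seq \<alpha> \<beta> n" if "0 < \<epsilon>" for \<epsilon>
      unfolding L_def by (rule BO.max_seq_lower[OF Gm(2) a(1) that])
  qed
  have Gam: "Gamma_odd_S \<alpha> \<beta> = L" "Gamma_odd_B \<alpha> \<beta> = L"
    unfolding Gamma_odd_S_def Gamma_odd_B_def using limS limB by (auto intro: limI)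
  have SEinf: "ereal L2 \<le> Gamma_even_S_inf \<alpha> \<beta>"
    unfolding Gamma_even_S_inf_def
  proof (rule le_liminf_ereal)
    show "\<forall>\<^sub>F n in sequentially. L2 - \<epsilon> \<le> even_S_seq \<alpha> \<beta> n" if "0 < \<epsilon>" for \<epsilon>
      unfolding L2_def using even by (intro SE.max_seq_lower_even[OF Gm(3) a(1) that]) auto
  qed
  have SEsup: "Gamma_even_S_sup \<alpha> \<beta> \<le> ereal (2 * L)"
    unfolding Gamma_even_S_sup_def
  proof (rule limsup_ereal_le)
    show "\<forall>\<^sub>F n in sequentially. even_S_seq \<alpha> \<beta> n \<le> 2 * L + \<epsilon>" if "0 < \<epsilon>" for \<epsilon>
    proof -
      have "\<forall>\<^sub>F n in sequentially. SE.parity n \<le> 1 + \<epsilon>" if "0 < \<epsilon>" for \<epsilon>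
        using SEp that by (intro always_eventually allI) (simp add: add_increasing2)
      from SE.max_seq_upper[OF Gm(3) a(1) _ this \<open>0 < \<epsilon>\<close>] show ?thesis by (simp add: L_def)
    qed
  qed
  have BEinf: "ereal L \<le> Gamma_even_B_inf \<alpha> \<beta>"
    unfolding Gamma_even_B_inf_def L_def
    by (rule le_liminf_ereal) (rule BE.max_seq_lower[OF Gm(4) a(1)])
  have BEsup: "Gamma_even_B_sup \<alpha> \<beta> \<le> ereal (2 * (1 - \<beta>) * L)"
    unfolding Gamma_even_B_sup_def
  proof (rule limsup_ereal_le)
    show "\<forall>\<^sub>F n in sequentially. even_B_seq \<alpha> \<beta> n \<le> 2 * (1 - \<beta>) * L + \<epsilon>" if "0 < \<epsilon>" for \<epsilon>
      using BE.max_seq_upper[OF Gm(4) a(1) _ BEp that] b by (simp add: L_def algebra_simps)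
  qed
  have Lam: "Lambda \<rho> \<alpha> \<le> L" "1/2 * Lambda \<rho> (2 * \<alpha>) \<le> L2"
    unfolding L_def L2_def
    using Lambda_le_iid_sup[OF b assms(5), of \<alpha>] Lambda_le_iid_sup[OF b assms(5), of "2 * \<alpha>"] \<alpha> by auto
  have cubes: "((1 - \<beta>) / 2) ^ k \<le> L \<and> 1/2 * ((1 - \<beta>) / 2) ^ (k - 1) \<le> L2"
    if k: "0 < k" "real k = log 2 (1 / \<alpha>)" for k :: nat
  proof -
    \<comment> \<open>Thus \<alpha> is exactly the volume of a subcube of codimension
      \<open>k\<close>, and 2\<alpha> that of one of codimension \<open>k - 1\<close>, a true
      difference since \<open>k\<close> is positive.\<close>
    have "2 powr real k = 1 / \<alpha>" unfolding k(2) using \<alpha> by (intro powr_log_cancel) auto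
    then have "\<alpha> = 1 / 2 ^ k" using \<alpha> by (simp add: powr_realpow field_simps)
    moreover obtain k' where "k = Suc k'" using k(1) by (cases k) auto
    ultimately have "\<alpha> = 1 / 2 ^ k" "2 * \<alpha> = 1 / 2 ^ (k - 1)" by auto
    then show ?thesis
      using subcube_le_iid_sup[OF b, of k] subcube_le_iid_sup[OF b, of "k - 1"] by (simp add: L_def L2_def)
  qed
  have "Gamma_even_S_inf \<alpha> \<beta> \<le> Gamma_even_S_sup \<alpha> \<beta>" "Gamma_even_B_inf \<alpha> \<beta> \<le> Gamma_even_B_sup \<alpha> \<beta>"
    unfolding Gamma_even_S_inf_def Gamma_even_S_sup_def Gamma_even_B_inf_def Gamma_even_B_sup_def
    by (simp_all add: Liminf_le_Limsup)
  moreover have "convergent (odd_S_seq \<alpha> \<beta>)" "convergent (odd_B_seq \<alpha> \<beta>)"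
    using limS limB by (auto simp: convergent_def)
  moreover have "ereal (1/2 * Lambda \<rho> (2 * \<alpha>)) \<le> Gamma_even_S_inf \<alpha> \<beta>"
    using Lam(2) by (intro order_trans[OF _ SEinf]) simp
  moreover have "ereal (Lambda \<rho> \<alpha>) \<le> Gamma_even_B_inf \<alpha> \<beta>"
    using Lam(1) by (intro order_trans[OF _ BEinf]) simp
  moreover have "Gamma_even_S_sup \<alpha> \<beta> \<le> ereal (2 * P)"
    using LP by (intro order_trans[OF SEsup]) simp
  moreover have "Gamma_even_B_sup \<alpha> \<beta> \<le> ereal (2 * (1 - \<beta>) * P)"
    using LP b by (intro order_trans[OF BEsup]) (simp add: mult_left_mono)
  moreover have "((1 - \<beta>) / 2) ^ k \<le> L \<and> ereal (((1 - \<beta>) / 2) ^ k) \<le> Gamma_even_B_inf \<alpha> \<beta> \<and>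
      ereal (1/2 * ((1 - \<beta>) / 2) ^ (k - 1)) \<le> Gamma_even_S_inf \<alpha> \<beta>"
    if "0 < k \<and> real k = log 2 (1 / \<alpha>)" for k :: nat
  proof (intro conjI)
    have c: "((1 - \<beta>) / 2) ^ k \<le> L" "1/2 * ((1 - \<beta>) / 2) ^ (k - 1) \<le> L2" using cubes[of k] that by auto
    show "((1 - \<beta>) / 2) ^ k \<le> L" by (rule c)
    show "ereal (((1 - \<beta>) / 2) ^ k) \<le> Gamma_even_B_inf \<alpha> \<beta>"
      using c(1) by (intro order_trans[OF _ BEinf]) simp
    show "ereal (1/2 * ((1 - \<beta>) / 2) ^ (k - 1)) \<le> Gamma_even_S_inf \<alpha> \<beta>"
      using c(2) by (intro order_trans[OF _ SEinf]) (simp only: ereal_less_eq)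
  qed
  ultimately show ?thesis
    unfolding Gam P_def[symmetric] using Lam(1) LP by blast
qed

end
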